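(* Let $P_1$ and $P_2$ be distinct places in a function field $F/K$ of genus $g$. For all integers $i,j\geq 0$, $$G_{i,j}=G_{i+j,0}+\mathbf{w}_j.$$ In particular, $$|G_0(P_1,P_2)|=\sum_{k=0}^{\lceil (2g-1)/\pi\rceil-1}(k+1)|G_{k,0}|.$$
   Context: $K$ is the algebraic closure of a finite field $\mathbb{F}_q$ and $F/K$ is a function field of one variable of genus $g$. $\mathbb{N}$ is the set of positive integers and $\mathbb{N}_0=\mathbb{N}\cup\{0\}$. $\ell(D)$ is the $K$-dimension of the Riemann-Roch space of a divisor $D$. A pair $(s_1,s_2)\in\mathbb{N}_0^2$ is a pure gap at $P_1,P_2$ if $\ell(s_1P_1+s_2P_2)=\ell(s_1P_1+s_2P_2-P_j)$ for all $j\in\{1,2\}$; $G_0(P_1,P_2)$ is the set of pure gaps at $P_1,P_2$. The period is $\pi=\min\{k\in\mathbb{N}:k(P_1-P_2)\text{ is a principal divisor}\}$. For $k_1,k_2\in\mathbb{N}_0$, $G_{k_1,k_2}=G_0(P_1,P_2)\cap\left((k_1\pi,(k_1+1)\pi]\times(k_2\pi,(k_2+1)\pi]\right)$. For $j\in\mathbb{N}_0$, $\mathbf{w}_j=(-j\pi,j\pi)\in\mathbb{Z}^2$, and for a set $S$, $S+\mathbf{w}_j$ denotes its translate. *)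

theory Defs
  imports
    "HOL-Algebra.Algebraic_Closure_Type"
    "HOL-Library.Poly_Mapping"
    "HOL-Library.Product_Plus"
begin

text \<open>
  The constant field \<open>K\<close> is the type \<open>'k\<close>, the function field \<open>F\<close> is the type \<open>'f\<close>, and \<open>K\<close> is
  regarded as a subfield of \<open>F\<close> through the embedding \<open>emb\<close>.
\<close>

definition field_embedding :: "('k::field \<Rightarrow> 'f::field) \<Rightarrow> bool" where
  "field_embedding emb \<longleftrightarrow>
     emb 1 = 1 \<and> (\<forall>a b. emb (a + b) = emb a + emb b) \<and> (\<forall>a b. emb (a * b) = emb a * emb b)"

definition transcendental_over :: "('k::field \<Rightarrow> 'f::field) \<Rightarrow> 'f \<Rightarrow> bool" where
  "transcendental_over emb x \<longleftrightarrow> (\<forall>p. p \<noteq> 0 \<longrightarrow> poly (map_poly emb p) x \<noteq> 0)"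

text \<open>The field \<open>K(x)\<close> generated by \<open>x\<close> over \<open>K\<close>.\<close>

definition simple_extension :: "('k::field \<Rightarrow> 'f::field) \<Rightarrow> 'f \<Rightarrow> 'f set" where
  "simple_extension emb x =
     {poly (map_poly emb p) x / poly (map_poly emb q) x | p q. poly (map_poly emb q) x \<noteq> 0}"

text \<open>A function field of one variable is a finite extension of some \<open>K(x)\<close>, \<open>x\<close> transcendental.\<close>

locale function_field =
  fixes emb :: "'k::field \<Rightarrow> 'f::field"
  assumes embedding: "field_embedding emb"
    and finite_over_rational:
      "\<exists>x B. transcendental_over emb x \<and> finite B \<and>
         (\<forall>y. \<exists>c. (\<forall>b\<in>B. c b \<in> simple_extension emb x) \<and> y = (\<Sum>b\<in>B. c b * b))"
begin

sublocale vector_space "\<lambda>a x. emb a * x"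
  using embedding unfolding field_embedding_def
  by unfold_locales (simp_all add: algebra_simps)

subsection \<open>Places and valuations\<close>

definition valuation_ring :: "'f set \<Rightarrow> bool" where
  "valuation_ring R \<longleftrightarrow>
     (\<forall>x\<in>R. \<forall>y\<in>R. x - y \<in> R \<and> x * y \<in> R) \<and> range emb \<subset> R \<and> R \<subset> UNIV \<and>
     (\<forall>z. z \<in> R \<or> inverse z \<in> R)"

definition ideal_of :: "'f set \<Rightarrow> 'f set \<Rightarrow> bool" where
  "ideal_of R I \<longleftrightarrow>
     I \<subseteq> R \<and> 0 \<in> I \<and> (\<forall>x\<in>I. \<forall>y\<in>I. x + y \<in> I) \<and> (\<forall>r\<in>R. \<forall>x\<in>I. r * x \<in> I)"

definition maximal_ideal_of :: "'f set \<Rightarrow> 'f set \<Rightarrow> bool" where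
  "maximal_ideal_of R I \<longleftrightarrow>
     ideal_of R I \<and> I \<noteq> R \<and> (\<forall>J. ideal_of R J \<and> I \<subseteq> J \<longrightarrow> J = I \<or> J = R)"

definition places :: "'f set set" where
  "places = {P. \<exists>R. valuation_ring R \<and> maximal_ideal_of R P}"

text \<open>
  The valuation ring of a place \<open>P\<close> is determined by \<open>P\<close>. The case \<open>z = 0\<close> is listed separately
  because \<open>inverse 0 = 0 \<in> P\<close>.
\<close>

definition place_ring :: "'f set \<Rightarrow> 'f set" where
  "place_ring P = {z. z = 0 \<or> inverse z \<notin> P}"

text \<open>
  Normalised discrete valuation: \<open>z = t\<^sup>n u\<close> with \<open>t\<close> a generator of \<open>P\<close> and \<open>u\<close> a unit of its
  valuation ring. The value at \<open>0\<close>, which is infinite, is never used.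
\<close>

definition valuation :: "'f set \<Rightarrow> 'f \<Rightarrow> int" where
  "valuation P z = (THE n. \<exists>t u. P = {t * y | y. y \<in> place_ring P} \<and>
     u \<noteq> 0 \<and> u \<in> place_ring P \<and> inverse u \<in> place_ring P \<and> z = t powi n * u)"

text \<open>
  \<open>[R/P : K]\<close> for the valuation ring \<open>R\<close> of \<open>P\<close>: the size of a finite \<open>B \<subseteq> R\<close> whose residue
  classes form a \<open>K\<close>-basis of \<open>R/P\<close>.
\<close>

definition place_degree :: "'f set \<Rightarrow> nat" where
  "place_degree P = (THE n. \<exists>B. finite B \<and> card B = n \<and> B \<subseteq> place_ring P \<and>
     (\<forall>z\<in>place_ring P. \<exists>!c. (\<forall>b. b \<notin> B \<longrightarrow> c b = 0) \<and> z - (\<Sum>b\<in>B. emb (c b) * b) \<in> P))"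

subsection \<open>Divisors and the genus\<close>

text \<open>Divisors are the elements of the free abelian group on the places.\<close>

definition divisors :: "('f set \<Rightarrow>\<^sub>0 int) set" where
  "divisors = {D. Poly_Mapping.keys D \<subseteq> places}"

definition divisor_degree :: "('f set \<Rightarrow>\<^sub>0 int) \<Rightarrow> int" where
  "divisor_degree D =
     (\<Sum>P\<in>Poly_Mapping.keys D. Poly_Mapping.lookup D P * int (place_degree P))"

definition principal_divisor :: "('f set \<Rightarrow>\<^sub>0 int) \<Rightarrow> bool" where
  "principal_divisor D \<longleftrightarrow>
     D \<in> divisors \<and> (\<exists>z. z \<noteq> 0 \<and> (\<forall>P\<in>places. Poly_Mapping.lookup D P = valuation P z))"

definition riemann_roch_space :: "('f set \<Rightarrow>\<^sub>0 int) \<Rightarrow> 'f set" where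
  "riemann_roch_space D =
     {z. z = 0 \<or> (\<forall>P\<in>places. valuation P z \<ge> - Poly_Mapping.lookup D P)}"

definition ell :: "('f set \<Rightarrow>\<^sub>0 int) \<Rightarrow> nat" where
  "ell D = dim (riemann_roch_space D)"

definition genus :: int where
  "genus = (GREATEST n. \<exists>D\<in>divisors. n = divisor_degree D - int (ell D) + 1)"

subsection \<open>Pure gaps at two places\<close>

definition pure_gaps :: "'f set \<Rightarrow> 'f set \<Rightarrow> (int \<times> int) set" where
  "pure_gaps P1 P2 = {(s1, s2). s1 \<ge> 0 \<and> s2 \<ge> 0 \<and>
     (\<forall>P\<in>{P1, P2}. ell (frag_cmul s1 (frag_of P1) + frag_cmul s2 (frag_of P2)) =
                    ell (frag_cmul s1 (frag_of P1) + frag_cmul s2 (frag_of P2) - frag_of P))}"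

definition period :: "'f set \<Rightarrow> 'f set \<Rightarrow> nat" where
  "period P1 P2 =
     (LEAST k. k > 0 \<and> principal_divisor (frag_cmul (int k) (frag_of P1 - frag_of P2)))"

definition pure_gaps_box :: "'f set \<Rightarrow> 'f set \<Rightarrow> nat \<Rightarrow> nat \<Rightarrow> (int \<times> int) set" where
  "pure_gaps_box P1 P2 k1 k2 = pure_gaps P1 P2 \<inter>
     ({int (k1 * period P1 P2) <.. int ((k1 + 1) * period P1 P2)} \<times>
      {int (k2 * period P1 P2) <.. int ((k2 + 1) * period P1 P2)})"

definition shift_vector :: "'f set \<Rightarrow> 'f set \<Rightarrow> nat \<Rightarrow> int \<times> int" where
  "shift_vector P1 P2 j = (- int (j * period P1 P2), int (j * period P1 P2))"

end

end

theory Submission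
  imports Defs
begin

text \<open>
  If \<open>(s\<^sub>1, s\<^sub>2)\<close> is a pure gap, then \<open>s\<^sub>i\<close> is a gap of the Weierstrass semigroup at \<open>P\<^sub>i\<close>, since a
  function with pole divisor \<open>s\<^sub>1 P\<^sub>1\<close> lies in \<open>L(s\<^sub>1 P\<^sub>1 + s\<^sub>2 P\<^sub>2)\<close> but not in \<open>L(s\<^sub>1 P\<^sub>1 + s\<^sub>2 P\<^sub>2 - P\<^sub>1)\<close>.
  By Riemann's inequality there are at most \<open>g\<close> gaps at a place, and as the non-gaps form a
  semigroup, every gap is at most \<open>2g - 1\<close>. This bounds the boxes; Riemann-Roch is not needed.
  Multiplication by a function with divisor \<open>\<pi> (P\<^sub>1 - P\<^sub>2)\<close> yields the translation between the boxes.

  Such a function exists because \<open>P\<^sub>1 - P\<^sub>2\<close> has finite order in the divisor class group: a power of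
  the Frobenius map of the constant field extends to an automorphism \<open>\<sigma>\<close> of the function field
  fixing \<open>P\<^sub>1\<close> and \<open>P\<^sub>2\<close>, and \<open>L(n (P\<^sub>1 - P\<^sub>2) + g P\<^sub>2)\<close>, which is non-zero and \<open>\<sigma>\<close>-stable, contains a
  non-zero \<open>\<sigma>\<close>-fixed function. So \<open>n (P\<^sub>1 - P\<^sub>2) + g P\<^sub>2\<close> is equivalent to a \<open>\<sigma>\<close>-invariant effective divisor
  of degree \<open>g\<close>. There are only finitely many of these, so two values of \<open>n\<close> give the same divisor.
\<close>

text \<open>A function field is given with a finite basis over one single K(x), whereas the argument
  needs such finiteness over K[z] for every function z. \<open>poly_indep_bound\<close> supplies it
  by counting dimensions, without integral closures or ramification. That one bound makes the
  valuations discrete, identifies every residue field with K, limits the zeros of a function and, by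
  comparing growth rates, gives principal divisors degree zero.

  The finite field behind K is essential: over other constant fields P1 - P2 need not be torsion,
  and the \<open>LEAST\<close> in \<open>period\<close> would be meaningless. A fixed function
  exists because a Frobenius-semilinear map over an algebraically closed field leads to a polynomial
  equation for one coefficient. The invariant divisors are finite in number because an orbit in the
  support of an effective divisor of degree g has at most g members, so each of its places is fixed
  by some \<sigma>^k with 1 \<le> k \<le> g; at such a place a fixed nonconstant x has a pole or a
  value in a finite field.\<close>

lemma linear_growth:
  fixes a b c :: int
  assumes "\<And>L :: nat. a * (int L + 1) \<le> int L * b + c"
  shows "a \<le> b"
proof (rule ccontr)
  assume "\<not> a \<le> b"
  define L where "L = nat \<bar>c - a\<bar> + 1"
  have "int L * (b + 1) \<le> int L * a"
    using \<open>\<not> a \<le> b\<close> by (intro mult_left_mono) auto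
  then have "int L \<le> c - a"
    using assms[of L] by (simp add: algebra_simps)
  then show False
    by (simp add: L_def)
qed

text \<open>\<open>GREATEST\<close> denotes something only if a maximum exists, hence the upper
  bound \<open>b\<close>. Riemann's theorem provides that bound for \<open>genus\<close>.\<close>

lemma Greatest_int_ge:
  fixes Q :: "int \<Rightarrow> bool"
  assumes "Q a" "\<And>x. Q x \<Longrightarrow> x \<le> b"
  shows "a \<le> (GREATEST x. Q x)"
proof -
  define S where "S = {x. Q x \<and> a \<le> x}"
  have S: "finite S" "S \<noteq> {}"
    using assms by (auto simp: S_def intro: finite_subset[of _ "{a..b}"])
  have max: "Q (Max S)" "a \<le> Max S"
    using Max_in[OF S] by (auto simp: S_def)
  have "(GREATEST x. Q x) = Max S"
  proof (rule Greatest_equality)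
    fix y assume "Q y"
    then show "y \<le> Max S"
      using Max_ge[OF S(1), of y] max(2) by (cases "a \<le> y") (auto simp: S_def)
  qed (rule max)
  then show ?thesis
    using max by simp
qed

lemma interval_index_unique:
  fixes a :: int
  assumes "int (i * m) < a" "a \<le> int ((i + 1) * m)" "int (j * m) < a" "a \<le> int ((j + 1) * m)"
  shows "i = j"
proof -
  have "\<not> i < j" if "int (j * m) < a" "a \<le> int ((i + 1) * m)" for i j
  proof
    assume "i < j"
    then have "(i + 1) * m \<le> j * m"
      by (intro mult_right_mono) auto
    then show False
      using that by linarith
  qed
  then show ?thesis
    using assms by (metis linorder_neqE_nat)
qed

lemma interval_index_exists:
  fixes a :: int
  assumes "1 \<le> a" "m > 0"
  shows "\<exists>i. int (i * m) < a \<and> a \<le> int ((i + 1) * m)"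
proof -
  \<comment> \<open>The intervals are open on the left and closed on the right, hence the quotient
    of \<open>a - 1\<close> rather than of \<open>a\<close>.\<close>
  define i where "i = nat ((a - 1) div int m)"
  have i: "int i = (a - 1) div int m"
    using assms by (simp add: i_def pos_imp_zdiv_nonneg_iff)
  have "a - 1 = (a - 1) div int m * int m + (a - 1) mod int m"
    by (rule div_mult_mod_eq[symmetric])
  moreover have "0 \<le> (a - 1) mod int m" "(a - 1) mod int m < int m"
    using assms by simp_all
  ultimately have "int i * int m < a" "a \<le> int i * int m + int m"
    unfolding i by linarith+
  then show ?thesis
    by (intro exI[of _ i]) (simp add: algebra_simps)
qed

lemma funpow_fixed: "\<sigma> x = x \<Longrightarrow> (\<sigma> ^^ k) x = x"
  by (induction k) simp_all

lemma funpow_image_add: "(\<tau> ^^ (m + n)) ` P = (\<tau> ^^ m) ` ((\<tau> ^^ n) ` P)"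
  by (simp add: funpow_add image_comp)

lemma funpow_image_Suc: "(\<tau> ^^ Suc n) ` P = \<tau> ` ((\<tau> ^^ n) ` P)"
  using funpow_image_add[of 1 n \<tau> P] by simp

context function_field
begin

section \<open>The constants as a subfield\<close>

lemma emb_1 [simp]: "emb 1 = 1" and emb_add: "emb (a + b) = emb a + emb b"
  and emb_mult: "emb (a * b) = emb a * emb b"
  using embedding unfolding field_embedding_def by auto

lemma emb_0 [simp]: "emb 0 = 0"
proof -
  have "emb 0 + emb 0 = emb 0"
    by (metis emb_add add_0)
  then show ?thesis by (metis add_cancel_left_right)
qed

lemma emb_minus: "emb (- a) = - emb a"
  using emb_add[of a "- a"] by (simp add: eq_neg_iff_add_eq_0 add.commute)

lemma emb_diff: "emb (a - b) = emb a - emb b"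
  using emb_add[of a "- b"] by (simp add: emb_minus)

lemma emb_eq_0_iff [simp]: "emb a = 0 \<longleftrightarrow> a = 0"
proof
  assume "emb a = 0"
  then show "a = 0"
    using emb_mult[of a "inverse a"] by (cases "a = 0") auto
qed simp

lemma emb_inverse: "emb (inverse a) = inverse (emb a)"
proof (cases "a = 0")
  case False
  then have "emb a * emb (inverse a) = 1"
    by (simp flip: emb_mult)
  then show ?thesis
    by (metis inverse_unique)
qed simp

subsection \<open>Polynomials in an element of the function field\<close>

definition ev :: "'k poly \<Rightarrow> 'f \<Rightarrow> 'f" where
  "ev p z = poly (map_poly emb p) z"

lemma ev_0 [simp]: "ev 0 z = 0"
  by (simp add: ev_def)

lemma ev_pCons [simp]: "ev (pCons a p) z = emb a + z * ev p z"
  by (simp add: ev_def map_poly_pCons)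

lemma ev_1 [simp]: "ev 1 z = 1"
  by (simp add: one_pCons)

lemma ev_add: "ev (p + q) z = ev p z + ev q z"
  by (induction p q rule: poly_induct2) (auto simp: emb_add algebra_simps)

lemma ev_minus: "ev (- p) z = - ev p z"
  by (induction p) (auto simp: emb_minus algebra_simps)

lemma ev_diff: "ev (p - q) z = ev p z - ev q z"
  using ev_add[of p "- q"] by (simp add: ev_minus)

lemma ev_smult: "ev (smult a p) z = emb a * ev p z"
  by (induction p) (auto simp: emb_mult algebra_simps)

lemma ev_mult: "ev (p * q) z = ev p z * ev q z"
  by (induction p) (auto simp: ev_add ev_smult algebra_simps)

lemma ev_sum: "ev (sum f A) z = (\<Sum>i\<in>A. ev (f i) z)"
  by (induction A rule: infinite_finite_induct) (auto simp: ev_add)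

lemma ev_prod: "ev (prod f A) z = (\<Prod>i\<in>A. ev (f i) z)"
  by (induction A rule: infinite_finite_induct) (auto simp: ev_mult)

lemma ev_monom [simp]: "ev (monom a n) z = emb a * z ^ n"
  by (induction n) (auto simp: monom_0 monom_Suc algebra_simps)

lemma ev_altdef: "ev p z = (\<Sum>i\<le>degree p. emb (coeff p i) * z ^ i)"
  by (subst poly_as_sum_of_monoms[of p, symmetric]) (simp add: ev_sum)

lemma transcendental_over_iff: "transcendental_over emb z \<longleftrightarrow> (\<forall>p. p \<noteq> 0 \<longrightarrow> ev p z \<noteq> 0)"
  by (simp add: transcendental_over_def ev_def)

lemma simple_extension_iff:
  assumes "transcendental_over emb x"
  shows "r \<in> simple_extension emb x \<longleftrightarrow> (\<exists>p q. q \<noteq> 0 \<and> r = ev p x / ev q x)"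
  using assms unfolding simple_extension_def transcendental_over_def ev_def
  by (auto intro: exI) (metis map_poly_0 poly_0)

subsection \<open>Linear independence of families\<close>

text \<open>Independence of a family instead of a set: a repeated member is a dependence, so members
  can be counted by their indices.\<close>

definition lin_indep_family :: "('i \<Rightarrow> 'f) \<Rightarrow> 'i set \<Rightarrow> bool" where
  "lin_indep_family f I \<longleftrightarrow>
     (\<forall>c. (\<Sum>i\<in>I. emb (c i) * f i) = 0 \<longrightarrow> (\<forall>i\<in>I. c i = 0))"

lemma lin_indep_familyD:
  assumes "finite I" "lin_indep_family f I"
  shows "inj_on f I" "independent (f ` I)"
proof -
  show inj: "inj_on f I"
  proof (rule inj_onI, rule ccontr)
    fix i j assume ij: "i \<in> I" "j \<in> I" "f i = f j" "i \<noteq> j"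
    define c where "c = (\<lambda>k. if k = i then 1 else if k = j then - 1 else 0 :: 'k)"
    have "(\<Sum>k\<in>I. emb (c k) * f k) = (\<Sum>k\<in>{i, j}. emb (c k) * f k)"
      using ij assms(1) by (intro sum.mono_neutral_right) (auto simp: c_def)
    also have "\<dots> = 0"
      using ij by (simp add: c_def emb_minus)
    finally have "c i = 0"
      using assms(2) ij(1) unfolding lin_indep_family_def by blast
    then show False by (simp add: c_def)
  qed
  show "independent (f ` I)"
  proof (rule independent_if_scalars_zero)
    fix c y assume *: "(\<Sum>y\<in>f ` I. emb (c y) * y) = 0" and "y \<in> f ` I"
    then obtain i where i: "i \<in> I" "y = f i" by auto
    have "(\<Sum>i\<in>I. emb ((c \<circ> f) i) * f i) = 0"
      using * by (simp add: sum.reindex[OF inj])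
    then have "(c \<circ> f) i = 0"
      using assms(2) i(1) unfolding lin_indep_family_def by blast
    then show "c y = 0" using i by simp
  qed (use assms in auto)
qed

lemma lin_indep_family_card_le:
  assumes "finite I" "lin_indep_family f I" "f ` I \<subseteq> span T" "finite T"
  shows "card I \<le> card T"
proof -
  have "card (f ` I) \<le> card T"
    using independent_span_bound[OF assms(4) lin_indep_familyD(2)[OF assms(1,2)] assms(3)] by blast
  then show ?thesis
    using card_image[OF lin_indep_familyD(1)[OF assms(1,2)]] by simp
qed

text \<open>Independence over K[z]. For transcendental z it amounts to independence over K(z), but
  polynomial coefficients are what a dimension count over K can handle.\<close>

definition poly_indep :: "'f \<Rightarrow> ('i \<Rightarrow> 'f) \<Rightarrow> 'i set \<Rightarrow> bool" where
  "poly_indep z u I \<longleftrightarrow>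
     (\<forall>p. (\<Sum>i\<in>I. ev (p i) z * u i) = 0 \<longrightarrow> (\<forall>i\<in>I. p i = 0))"

text \<open>Once all constant coefficients of a relation vanish, it can be divided by z and the
  argument repeated. Constant coefficients are what a place at which z vanishes can detect.\<close>

lemma poly_indepI:
  assumes "z \<noteq> 0"
    and "\<And>p i. i \<in> I \<Longrightarrow> (\<Sum>i\<in>I. ev (p i) z * u i) = 0 \<Longrightarrow> coeff (p i) 0 = 0"
  shows "poly_indep z u I"
proof -
  have "coeff (p i) k = 0"
    if "(\<Sum>i\<in>I. ev (p i) z * u i) = 0" "i \<in> I" for p i k
    using that
  proof (induction k arbitrary: p i)
    case 0
    then show ?case using assms(2) by blast
  next
    case (Suc k)
    define q where "q = (\<lambda>i. poly_shift 1 (p i))"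
    have p: "p i = pCons 0 (q i)" if "i \<in> I" for i
      using assms(2)[OF that Suc.prems(1)]
      by (intro poly_eqI) (auto simp: q_def coeff_poly_shift coeff_pCons split: nat.splits)
    have "(\<Sum>i\<in>I. ev (p i) z * u i) = z * (\<Sum>i\<in>I. ev (q i) z * u i)"
      by (auto simp: sum_distrib_left p mult.assoc intro!: sum.cong)
    then have "(\<Sum>i\<in>I. ev (q i) z * u i) = 0"
      using Suc.prems(1) assms(1) by simp
    then have "coeff (q i) k = 0"
      using Suc.IH Suc.prems(2) by blast
    then show ?case using p[OF Suc.prems(2)] by simp
  qed
  then show ?thesis
    unfolding poly_indep_def by (auto intro: poly_eqI)
qed

lemma poly_indep_reindex:
  assumes "bij_betw h J I" "poly_indep z u I"
  shows "poly_indep z (u \<circ> h) J"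
  unfolding poly_indep_def
proof (intro allI impI ballI)
  fix p j assume *: "(\<Sum>j\<in>J. ev (p j) z * (u \<circ> h) j) = 0" and "j \<in> J"
  define q where "q = (\<lambda>i. p (inv_into J h i))"
  have inv: "inv_into J h (h j) = j" if "j \<in> J" for j
    using that assms(1) by (metis bij_betw_inv_into_left)
  have "(\<Sum>i\<in>I. ev (q i) z * u i) = (\<Sum>j\<in>J. ev (p j) z * (u \<circ> h) j)"
    by (subst sum.reindex_bij_betw[OF assms(1), symmetric]) (auto simp: q_def inv intro!: sum.cong)
  then have "\<forall>i\<in>I. q i = 0"
    using * assms(2) unfolding poly_indep_def by simp
  then show "p j = 0"
    using \<open>j \<in> J\<close> assms(1) inv by (auto simp: q_def bij_betw_def)
qed

text \<open>Grouping the powers of z turns a K-relation among the products into a K[z]-relation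
  among the \<open>u i\<close>. The family grows linearly with \<open>L\<close>, which drives all
  later counts.\<close>

lemma lin_indep_family_powers:
  assumes "finite I" "poly_indep z u I"
  shows "lin_indep_family (\<lambda>(i, k). z ^ k * u i) (I \<times> {..<L})"
  unfolding lin_indep_family_def
proof (intro allI impI ballI)
  fix c and ik :: "'a \<times> nat"
  assume *: "(\<Sum>ik\<in>I \<times> {..<L}. emb (c ik) * (case ik of (i, k) \<Rightarrow> z ^ k * u i)) = 0"
    and ik: "ik \<in> I \<times> {..<L}"
  define p where "p = (\<lambda>i. \<Sum>k<L. monom (c (i, k)) k)"
  have "(\<Sum>i\<in>I. ev (p i) z * u i) = 0"
    using * unfolding p_def sum.cartesian_product[symmetric]
    by (simp add: sum.cartesian_product' ev_sum sum_distrib_right mult.assoc)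
  then have "p (fst ik) = 0"
    using assms(2) ik unfolding poly_indep_def by auto
  then have "coeff (p (fst ik)) (snd ik) = 0" by simp
  moreover have "coeff (p (fst ik)) (snd ik) = c ik"
    using ik by (auto simp: p_def coeff_sum coeff_monom if_distrib sum.delta' cong: if_cong)
  ultimately show "c ik = 0" by simp
qed

subsection \<open>Counting dimensions\<close>

text \<open>A finite-dimensional slice of the field, of dimension at most
  \<open>(N + 1) * card B\<close>: linear in the degree bound \<open>N\<close>.\<close>

definition poly_span :: "'f \<Rightarrow> 'f set \<Rightarrow> nat \<Rightarrow> 'f set" where
  "poly_span x B N = {\<Sum>b\<in>B. ev (p b) x * b | p. \<forall>b\<in>B. degree (p b) \<le> N}"

lemma poly_spanI: "(\<And>b. b \<in> B \<Longrightarrow> degree (p b) \<le> N) \<Longrightarrow> (\<Sum>b\<in>B. ev (p b) x * b) \<in> poly_span x B N"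
  by (auto simp: poly_span_def)

lemma poly_span_add:
  assumes "y \<in> poly_span x B N" "y' \<in> poly_span x B N"
  shows "y + y' \<in> poly_span x B N"
proof -
  obtain p p' where "y = (\<Sum>b\<in>B. ev (p b) x * b)" "y' = (\<Sum>b\<in>B. ev (p' b) x * b)"
    and deg: "\<forall>b\<in>B. degree (p b) \<le> N" "\<forall>b\<in>B. degree (p' b) \<le> N"
    using assms by (auto simp: poly_span_def)
  then have "y + y' = (\<Sum>b\<in>B. ev (p b + p' b) x * b)"
    by (simp add: ev_add sum.distrib algebra_simps)
  then show ?thesis
    using deg by (auto intro!: poly_spanI degree_add_le)
qed

lemma poly_span_0 [simp]: "0 \<in> poly_span x B N"
  using poly_spanI[of B "\<lambda>_. 0"] by simp

lemma poly_span_sum: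
  "(\<And>i. i \<in> I \<Longrightarrow> f i \<in> poly_span x B N) \<Longrightarrow> sum f I \<in> poly_span x B N"
  by (induction I rule: infinite_finite_induct) (auto intro: poly_span_add)

lemma poly_span_mult:
  assumes "y \<in> poly_span x B N" "N + degree q \<le> N'"
  shows "ev q x * y \<in> poly_span x B N'"
proof -
  obtain p where "y = (\<Sum>b\<in>B. ev (p b) x * b)" and deg: "\<forall>b\<in>B. degree (p b) \<le> N"
    using assms by (auto simp: poly_span_def)
  then have y: "ev q x * y = (\<Sum>b\<in>B. ev (q * p b) x * b)"
    by (simp add: ev_mult sum_distrib_left mult.assoc)
  have "degree (q * p b) \<le> N'" if "b \<in> B" for b
    using degree_mult_le[of q "p b"] that deg assms(2) by fastforce
  then show ?thesis unfolding y by (rule poly_spanI)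
qed

lemma poly_span_subset_span:
  "poly_span x B N \<subseteq> span ((\<lambda>(i, b). x ^ i * b) ` ({..N} \<times> B))"
proof
  fix y assume "y \<in> poly_span x B N"
  then obtain p where y: "y = (\<Sum>b\<in>B. ev (p b) x * b)" and deg: "\<forall>b\<in>B. degree (p b) \<le> N"
    by (auto simp: poly_span_def)
  show "y \<in> span ((\<lambda>(i, b). x ^ i * b) ` ({..N} \<times> B))"
    unfolding y ev_altdef sum_distrib_right mult.assoc
    using deg by (intro span_sum span_scale span_base) (force intro: order_trans)
qed

lemma common_denominator:
  assumes x: "transcendental_over emb x"
    and span: "\<And>y. \<exists>c. (\<forall>b\<in>B. c b \<in> simple_extension emb x) \<and> y = (\<Sum>b\<in>B. c b * b)"
    and "finite B" "finite Y"
  obtains \<delta> N where "\<delta> \<noteq> 0" "\<And>y. y \<in> Y \<Longrightarrow> ev \<delta> x * y \<in> poly_span x B N"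
proof -
  have single: "\<exists>\<delta> N. \<delta> \<noteq> 0 \<and> ev \<delta> x * y \<in> poly_span x B N" for y
  proof -
    obtain c where c: "\<forall>b\<in>B. c b \<in> simple_extension emb x" and y: "y = (\<Sum>b\<in>B. c b * b)"
      using span by blast
    then obtain p q where pq: "\<And>b. b \<in> B \<Longrightarrow> q b \<noteq> 0 \<and> c b = ev (p b) x / ev (q b) x"
      unfolding simple_extension_iff[OF x] by metis
    have q: "ev (q b) x \<noteq> 0" if "b \<in> B" for b
      using pq[OF that] x by (auto simp: transcendental_over_iff)
    define \<delta> where "\<delta> = (\<Prod>b\<in>B. q b)"
    define r where "r = (\<lambda>b. p b * (\<Prod>b'\<in>B - {b}. q b'))"
    have "ev \<delta> x * (c b * b) = ev (r b) x * b" if "b \<in> B" for b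
      using that pq[OF that] q[OF that] \<open>finite B\<close>
      by (simp add: \<delta>_def r_def ev_prod ev_mult prod.remove[of B b])
    then have "ev \<delta> x * y = (\<Sum>b\<in>B. ev (r b) x * b)"
      unfolding y sum_distrib_left by (intro sum.cong) auto
    moreover have "(\<Sum>b\<in>B. ev (r b) x * b) \<in> poly_span x B (\<Sum>b\<in>B. degree (r b))"
      using \<open>finite B\<close> by (intro poly_spanI member_le_sum) auto
    moreover have "\<delta> \<noteq> 0"
      using pq \<open>finite B\<close> by (auto simp: \<delta>_def)
    ultimately show ?thesis by metis
  qed
  have "\<exists>\<delta> N. \<delta> \<noteq> 0 \<and> (\<forall>y\<in>Y. ev \<delta> x * y \<in> poly_span x B N)"
    using \<open>finite Y\<close>
  proof (induction Y)
    case empty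
    then show ?case by (auto intro: exI[of _ 1])
  next
    case (insert y Y)
    then obtain \<delta> N where 1: "\<delta> \<noteq> 0" "\<And>y. y \<in> Y \<Longrightarrow> ev \<delta> x * y \<in> poly_span x B N" by auto
    obtain \<delta>' N' where 2: "\<delta>' \<noteq> 0" "ev \<delta>' x * y \<in> poly_span x B N'" using single by blast
    have "ev (\<delta> * \<delta>') x * y' \<in> poly_span x B (N + N' + degree \<delta> + degree \<delta>')"
      if "y' \<in> insert y Y" for y'
    proof (cases "y' = y")
      case True
      then show ?thesis
        using poly_span_mult[OF 2(2), of \<delta> "N + N' + degree \<delta> + degree \<delta>'"]
        by (simp add: ev_mult mult_ac)
    next
      case False
      then show ?thesis
        using poly_span_mult[OF 1(2), of y' \<delta>' "N + N' + degree \<delta> + degree \<delta>'"] that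
        by (simp add: ev_mult mult_ac)
    qed
    then show ?case using 1 2 by (metis mult_eq_0_iff)
  qed
  then show thesis using that by blast
qed

text \<open>Plays the role of the finiteness of F over K(z), with z unrelated to the given x. The
  \<open>n * (L + 1)\<close> products of \<open>u i\<close> with powers of z up to \<open>L\<close>,
  multiplied by a common denominator, lie in a slice whose dimension grows like
  \<open>e * card B * L\<close>. Comparing the growth in \<open>L\<close> bounds
  \<open>n\<close>.\<close>

lemma poly_indep_bound_nat: "\<exists>c. \<forall>(u :: nat \<Rightarrow> 'f) n. poly_indep z u {..<n} \<longrightarrow> n \<le> c"
proof -
  obtain x B where x: "transcendental_over emb x" and B: "finite B"
    and span: "\<And>y. \<exists>c. (\<forall>b\<in>B. c b \<in> simple_extension emb x) \<and> y = (\<Sum>b\<in>B. c b * b)"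
    using finite_over_rational by blast
  obtain \<delta> N where \<delta>: "\<delta> \<noteq> 0" "\<And>y. y \<in> (\<lambda>b. z * b) ` B \<Longrightarrow> ev \<delta> x * y \<in> poly_span x B N"
    using common_denominator[OF x span B] B by (metis finite_imageI)
  \<comment> \<open>The cost in degree of one factor \<open>ev \<delta> x\<close>: at most
    \<open>N\<close> if it accompanies a factor z, and \<open>degree \<delta>\<close> if it merely
    fills up the denominator.\<close>
  define e where "e = max N (degree \<delta>)"
  have mult: "ev \<delta> x * (z * y) \<in> poly_span x B (M + e)" if y_in: "y \<in> poly_span x B M" for y M
  proof -
    obtain p where y: "y = (\<Sum>b\<in>B. ev (p b) x * b)" and deg: "\<forall>b\<in>B. degree (p b) \<le> M"
      using y_in by (auto simp: poly_span_def)
    have "ev \<delta> x * (z * y) = (\<Sum>b\<in>B. ev (p b) x * (ev \<delta> x * (z * b)))"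
      by (simp add: y sum_distrib_left mult_ac)
    also have "\<dots> \<in> poly_span x B (M + e)"
    proof (rule poly_span_sum)
      fix b assume "b \<in> B"
      then show "ev (p b) x * (ev \<delta> x * (z * b)) \<in> poly_span x B (M + e)"
        using deg by (intro poly_span_mult[OF \<delta>(2)]) (auto simp: e_def)
    qed
    finally show ?thesis .
  qed
  have powers: "ev \<delta> x ^ L * (z ^ i * y) \<in> poly_span x B (M + e * L)"
    if "y \<in> poly_span x B M" "i \<le> L" for y M i L
    using that(2)
  proof (induction L arbitrary: i)
    case 0
    then show ?case using that by simp
  next
    case (Suc L)
    show ?case
    proof (cases "i = Suc L")
      case True
      then show ?thesis
        using mult[OF Suc.IH[of L]] by (simp add: algebra_simps)
    next
      case False
      then have "ev \<delta> x ^ L * (z ^ i * y) \<in> poly_span x B (M + e * L)"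
        using Suc by simp
      then have "ev \<delta> x * (ev \<delta> x ^ L * (z ^ i * y)) \<in> poly_span x B (M + e * Suc L)"
        by (rule poly_span_mult) (simp add: e_def)
      then show ?thesis by (simp add: mult_ac)
    qed
  qed
  have "n \<le> e * card B" if indep: "poly_indep z u {..<n}" for u :: "nat \<Rightarrow> 'f" and n
  proof (rule ccontr)
    assume n: "\<not> n \<le> e * card B"
    obtain \<epsilon> M where \<epsilon>: "\<epsilon> \<noteq> 0" "\<And>y. y \<in> u ` {..<n} \<Longrightarrow> ev \<epsilon> x * y \<in> poly_span x B M"
      using common_denominator[OF x span B] by (metis finite_imageI finite_lessThan)
    \<comment> \<open>With this value \<open>(e * card B + 1) * (L + 1)\<close> exceeds
      \<open>(M + e * L + 1) * card B\<close>, which bounds the size of the spanning set.\<close>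
    define L where "L = (M + 1) * card B"
    define d where "d = ev \<epsilon> x * ev \<delta> x ^ L"
    have "d \<noteq> 0"
      using x \<delta>(1) \<epsilon>(1) by (auto simp: d_def transcendental_over_iff)
    define f where "f = (\<lambda>(i, k). d * (z ^ k * u i))"
    have lin: "lin_indep_family f ({..<n} \<times> {..<Suc L})"
      unfolding lin_indep_family_def
    proof (intro allI impI)
      fix c assume "(\<Sum>i\<in>{..<n} \<times> {..<Suc L}. emb (c i) * f i) = 0"
      moreover have "(\<Sum>i\<in>{..<n} \<times> {..<Suc L}. emb (c i) * f i) =
          d * (\<Sum>i\<in>{..<n} \<times> {..<Suc L}. emb (c i) * (case i of (i, k) \<Rightarrow> z ^ k * u i))"
        unfolding sum_distrib_left by (intro sum.cong) (auto simp: f_def)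
      ultimately show "\<forall>i\<in>{..<n} \<times> {..<Suc L}. c i = 0"
        using lin_indep_family_powers[OF _ indep, of "Suc L"] \<open>d \<noteq> 0\<close>
        by (simp add: lin_indep_family_def)
    qed
    have sub: "f ` ({..<n} \<times> {..<Suc L}) \<subseteq> poly_span x B (M + e * L)"
    proof
      fix y assume "y \<in> f ` ({..<n} \<times> {..<Suc L})"
      then obtain i k where ik: "i < n" "k \<le> L" and y: "y = f (i, k)"
        by (force simp: less_Suc_eq_le)
      then have "ev \<delta> x ^ L * (z ^ k * (ev \<epsilon> x * u i)) \<in> poly_span x B (M + e * L)"
        using \<epsilon>(2) by (intro powers) auto
      then show "y \<in> poly_span x B (M + e * L)"
        by (simp add: y f_def d_def mult_ac)
    qed
    have "card ({..<n} \<times> {..<Suc L}) \<le>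
        card ((\<lambda>(i, b). x ^ i * b) ` ({..M + e * L} \<times> B))"
      by (rule lin_indep_family_card_le[OF _ lin order.trans[OF sub poly_span_subset_span]]) (use B in auto)
    also have "\<dots> \<le> card ({..M + e * L} \<times> B)"
      using B by (intro card_image_le) auto
    finally have "n * (L + 1) \<le> (M + e * L + 1) * card B"
      by (simp add: card_cartesian_product)
    moreover have "(e * card B + 1) * (L + 1) \<le> n * (L + 1)"
      using n by (intro mult_right_mono) auto
    ultimately show False
      by (simp add: L_def algebra_simps)
  qed
  then show ?thesis by blast
qed

lemma poly_indep_bound:
  obtains c where "\<And>(u :: 'i \<Rightarrow> 'f) I. finite I \<Longrightarrow> poly_indep z u I \<Longrightarrow> card I \<le> c"
proof -
  obtain c where c: "\<And>(u :: nat \<Rightarrow> 'f) n. poly_indep z u {..<n} \<Longrightarrow> n \<le> c"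
    using poly_indep_bound_nat by blast
  have "card I \<le> c" if fin: "finite I" and indep: "poly_indep z u I" for u :: "'i \<Rightarrow> 'f" and I
  proof -
    obtain h where "bij_betw h {..<card I} I"
      using ex_bij_betw_nat_finite[OF fin] by (auto simp: atLeast0LessThan)
    then show ?thesis
      using c poly_indep_reindex[OF _ indep] by blast
  qed
  then show thesis using that by blast
qed

subsection \<open>Places as discrete valuations\<close>

text \<open>A valuation ring is local, and this is its only maximal ideal. Zero is listed separately
  because \<open>inverse 0 = 0\<close> belongs to \<open>R\<close>.\<close>

definition nonunits :: "'f set \<Rightarrow> 'f set" where
  "nonunits R = {z \<in> R. z = 0 \<or> inverse z \<notin> R}"

lemma valuation_ringD:
  assumes "valuation_ring R"
  shows valuation_ring_diff: "x \<in> R \<Longrightarrow> y \<in> R \<Longrightarrow> x - y \<in> R"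
    and valuation_ring_mult: "x \<in> R \<Longrightarrow> y \<in> R \<Longrightarrow> x * y \<in> R"
    and valuation_ring_emb: "emb a \<in> R"
    and valuation_ring_0: "0 \<in> R"
    and valuation_ring_1: "1 \<in> R"
    and valuation_ring_cases: "z \<notin> R \<Longrightarrow> inverse z \<in> R"
proof -
  show emb: "emb a \<in> R" for a
    using assms unfolding valuation_ring_def by (meson psubset_imp_subset rangeI subsetD)
  show "0 \<in> R" "1 \<in> R"
    using emb[of 0] emb[of 1] by auto
  show "x - y \<in> R" "x * y \<in> R" if "x \<in> R" "y \<in> R"
    using assms that unfolding valuation_ring_def by blast+
  show "inverse z \<in> R" if "z \<notin> R"
    using assms that unfolding valuation_ring_def by blast
qed

lemma valuation_ring_add: "valuation_ring R \<Longrightarrow> x \<in> R \<Longrightarrow> y \<in> R \<Longrightarrow> x + y \<in> R"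
  using valuation_ring_diff[of R x "0 - y"] valuation_ring_diff[of R 0 y] valuation_ring_0 by simp

text \<open>Of two nonzero elements one divides the other in \<open>R\<close>, so a sum of two
  nonunits is an \<open>R\<close>-multiple of one of them.\<close>

lemma ideal_of_nonunits:
  assumes R: "valuation_ring R"
  shows "ideal_of R (nonunits R)"
proof -
  have mult: "r * x \<in> nonunits R" if "r \<in> R" "x \<in> nonunits R" for r x
  proof -
    have "inverse x \<in> R" if "r * x \<noteq> 0" "inverse (r * x) \<in> R"
      using valuation_ring_mult[OF R \<open>r \<in> R\<close> that(2)] that(1) by (simp add: field_simps)
    then show ?thesis
      using that valuation_ring_mult[OF R] by (auto simp: nonunits_def)
  qed
  have add_wlog: "x + y \<in> nonunits R"
    if xy: "x \<in> nonunits R" "y \<in> nonunits R" "y \<noteq> 0" "x / y \<in> R" for x y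
  proof -
    have "(x / y + 1) * y \<in> nonunits R"
      using xy R by (intro mult valuation_ring_add valuation_ring_1) auto
    moreover have "(x / y + 1) * y = x + y"
      using xy by (simp add: distrib_right)
    ultimately show ?thesis by simp
  qed
  have "x + y \<in> nonunits R" if xy: "x \<in> nonunits R" "y \<in> nonunits R" for x y
  proof (cases "x = 0 \<or> y = 0")
    case False
    then have "x / y \<in> R \<or> y / x \<in> R"
      using valuation_ring_cases[OF R, of "x / y"] by (auto simp: divide_simps)
    then show ?thesis
      using add_wlog[of x y] add_wlog[of y x] xy False by (auto simp: add.commute)
  qed (use xy in auto)
  then show ?thesis
    using mult valuation_ring_0[OF R] by (auto simp: ideal_of_def nonunits_def)
qed

lemma ideal_of_subset_nonunits:
  assumes R: "valuation_ring R" and I: "ideal_of R I" "I \<noteq> R"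
  shows "I \<subseteq> nonunits R"
proof (rule ccontr)
  assume "\<not> I \<subseteq> nonunits R"
  then obtain z where "z \<in> I" "z \<noteq> 0" "inverse z \<in> R"
    using I(1) by (auto simp: nonunits_def ideal_of_def)
  then have "inverse z * z \<in> I"
    using I(1) unfolding ideal_of_def by blast
  then have "1 \<in> I"
    using \<open>z \<noteq> 0\<close> by simp
  then have "r * 1 \<in> I" if "r \<in> R" for r
    using I(1) that unfolding ideal_of_def by blast
  then have "R \<subseteq> I" by auto
  then show False
    using I by (auto simp: ideal_of_def)
qed

lemma maximal_ideal_of_iff:
  assumes R: "valuation_ring R"
  shows "maximal_ideal_of R P \<longleftrightarrow> P = nonunits R"
proof -
  have "1 \<notin> nonunits R"
    using valuation_ring_1[OF R] by (simp add: nonunits_def)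
  then have neq: "nonunits R \<noteq> R"
    using valuation_ring_1[OF R] by blast
  show ?thesis
    using neq ideal_of_nonunits[OF R] ideal_of_subset_nonunits[OF R]
    unfolding maximal_ideal_of_def by (metis subset_antisym)
qed

lemma place_ring_nonunits:
  assumes R: "valuation_ring R"
  shows "place_ring (nonunits R) = R"
  using valuation_ring_cases[OF R] valuation_ring_0[OF R]
  by (auto simp: place_ring_def nonunits_def)

lemma places_iff: "P \<in> places \<longleftrightarrow> (\<exists>R. valuation_ring R \<and> P = nonunits R)"
  using maximal_ideal_of_iff by (auto simp: places_def)

lemma valuation_ring_place_ring: "P \<in> places \<Longrightarrow> valuation_ring (place_ring P)"
  and place_eq_nonunits: "P \<in> places \<Longrightarrow> P = nonunits (place_ring P)"
  using place_ring_nonunits by (auto simp: places_iff)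

lemmas place_ring_add = valuation_ring_add[OF valuation_ring_place_ring]
  and place_ring_diff = valuation_ring_diff[OF valuation_ring_place_ring]
  and place_ring_mult = valuation_ring_mult[OF valuation_ring_place_ring]
  and place_ring_emb = valuation_ring_emb[OF valuation_ring_place_ring]
  and place_ring_0 = valuation_ring_0[OF valuation_ring_place_ring]
  and place_ring_1 = valuation_ring_1[OF valuation_ring_place_ring]
  and place_ring_cases = valuation_ring_cases[OF valuation_ring_place_ring]

lemma ideal_of_place: "P \<in> places \<Longrightarrow> ideal_of (place_ring P) P"
  using ideal_of_nonunits place_eq_nonunits valuation_ring_place_ring by metis

lemma place_add: "P \<in> places \<Longrightarrow> x \<in> P \<Longrightarrow> y \<in> P \<Longrightarrow> x + y \<in> P"
  and place_mult: "P \<in> places \<Longrightarrow> r \<in> place_ring P \<Longrightarrow> x \<in> P \<Longrightarrow> r * x \<in> P"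
  and place_subset: "P \<in> places \<Longrightarrow> x \<in> P \<Longrightarrow> x \<in> place_ring P"
  and place_0: "P \<in> places \<Longrightarrow> 0 \<in> P"
  using ideal_of_place[of P] by (auto simp: ideal_of_def)

lemma place_mult': "P \<in> places \<Longrightarrow> x \<in> P \<Longrightarrow> r \<in> place_ring P \<Longrightarrow> x * r \<in> P"
  using place_mult[of P r x] by (simp add: mult.commute)

lemma place_sum: "P \<in> places \<Longrightarrow> (\<And>i. i \<in> I \<Longrightarrow> f i \<in> P) \<Longrightarrow> sum f I \<in> P"
  by (induction I rule: infinite_finite_induct) (auto intro: place_add place_0)

lemma place_minus: "P \<in> places \<Longrightarrow> x \<in> P \<Longrightarrow> - x \<in> P"
  using place_mult[of P "emb (- 1)" x] place_ring_emb[of P "- 1"] by (simp add: emb_minus)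

lemma place_ring_power: "P \<in> places \<Longrightarrow> x \<in> place_ring P \<Longrightarrow> x ^ n \<in> place_ring P"
  by (induction n) (auto intro: place_ring_mult place_ring_1)

lemma place_iff: "P \<in> places \<Longrightarrow> z \<in> P \<longleftrightarrow> z = 0 \<or> z \<in> place_ring P \<and> inverse z \<notin> place_ring P"
  using place_eq_nonunits place_ring_0 by (auto simp: nonunits_def)

lemma one_notin_place: "P \<in> places \<Longrightarrow> 1 \<notin> P"
  by (simp add: place_iff place_ring_1)

lemma emb_in_place_iff: "P \<in> places \<Longrightarrow> emb a \<in> P \<longleftrightarrow> a = 0"
  by (auto simp: place_iff place_ring_emb simp flip: emb_inverse)

lemma inverse_in_place: "P \<in> places \<Longrightarrow> z \<notin> place_ring P \<Longrightarrow> inverse z \<in> P"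
  using place_ring_cases[of P z] by (simp add: place_iff)

lemma place_nonzero: "P \<in> places \<Longrightarrow> \<exists>x\<in>P. x \<noteq> 0"
proof -
  assume P: "P \<in> places"
  then obtain z where "z \<notin> place_ring P"
    using valuation_ring_place_ring[OF P] by (auto simp: valuation_ring_def)
  then show ?thesis
    using inverse_in_place[OF P] place_ring_0[OF P] by (metis inverse_nonzero_iff_nonzero)
qed

lemma ev_in_place_ring: "P \<in> places \<Longrightarrow> z \<in> place_ring P \<Longrightarrow> ev p z \<in> place_ring P"
  by (induction p) (auto intro: place_ring_0 place_ring_add place_ring_mult place_ring_emb)

lemma ev_coeff_0: "ev p z = emb (coeff p 0) + z * ev (poly_shift 1 p) z"
proof -
  have "p = pCons (coeff p 0) (poly_shift 1 p)"
    by (intro poly_eqI) (auto simp: coeff_poly_shift coeff_pCons split: nat.splits)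
  then show ?thesis by (metis ev_pCons)
qed

section \<open>Chains of principal ideals and uniformizers\<close>

definition place_chain :: "'f set \<Rightarrow> 'f \<Rightarrow> (nat \<Rightarrow> 'f) \<Rightarrow> nat \<Rightarrow> bool" where
  "place_chain P x y n \<longleftrightarrow> y 0 = x \<and> (\<forall>i<n. y i \<noteq> 0 \<and> y i \<in> P) \<and>
     (\<forall>i. Suc i < n \<longrightarrow> y i / y (Suc i) \<in> P)"

text \<open>In a strictly increasing chain of principal ideals starting from \<open>x\<close>, the generators are
  independent over \<open>K[x]\<close>; so the chain has bounded length.\<close>

lemma place_chain_bound:
  assumes P: "P \<in> places"
  shows "\<exists>c. \<forall>y n. place_chain P x y n \<longrightarrow> n \<le> c"
proof -
  obtain c where c: "\<And>(u :: nat \<Rightarrow> 'f) I. finite I \<Longrightarrow> poly_indep x u I \<Longrightarrow> card I \<le> c"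
    using poly_indep_bound[where z = x] by blast
  have "n \<le> c" if ch: "place_chain P x y n" for y n
  proof (cases "n = 0")
    case False
    have nz: "y i \<noteq> 0" and yP: "y i \<in> P" if "i < n" for i
      using ch that by (auto simp: place_chain_def)
    have x: "y 0 = x"
      using ch by (simp add: place_chain_def)
    have quot: "y i / y j \<in> P" if "i < j" "j < n" for i j
      using that
    proof (induction j)
      case (Suc j)
      have step: "y j / y (Suc j) \<in> P"
        using ch Suc.prems by (auto simp: place_chain_def)
      show ?case
      proof (cases "i = j")
        case False
        then have "y i / y j \<in> place_ring P"
          using Suc place_subset[OF P] by simp
        then have "(y i / y j) * (y j / y (Suc j)) \<in> P"
          using step place_mult[OF P] by blast
        then show ?thesis
          using nz[of j] Suc.prems by simp
      qed (use step in simp)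
    qed simp
    have "poly_indep x y {..<n}"
    proof (rule poly_indepI)
      show "x \<noteq> 0"
        using nz[of 0] False x by simp
      fix p i assume i: "i \<in> {..<n}" and sum: "(\<Sum>i<n. ev (p i) x * y i) = 0"
      show "coeff (p i) 0 = 0"
      proof (rule ccontr)
        assume "coeff (p i) 0 \<noteq> 0"
        \<comment> \<open>Divide the relation by \<open>y j\<close>, where \<open>j\<close> is the
          last index with a nonzero constant coefficient. Earlier terms then lie in \<open>P\<close>
          by the chain property; later ones do because their coefficients are divisible by
          \<open>x\<close> and \<open>x / y j\<close> lies in the ring. What remains puts the
          nonzero constant \<open>emb (coeff (p j) 0)\<close> into \<open>P\<close>.\<close>
        define J where "J = {j. j < n \<and> coeff (p j) 0 \<noteq> 0}"
        define j where "j = Max J"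
        have "finite J" "J \<noteq> {}"
          using i \<open>coeff (p i) 0 \<noteq> 0\<close> by (auto simp: J_def)
        then have "j \<in> J" and max: "\<And>k. k \<in> J \<Longrightarrow> k \<le> j"
          by (auto simp: j_def)
        then have j: "j < n" "coeff (p j) 0 \<noteq> 0" by (auto simp: J_def)
        have term_in: "ev (p k) x * y k / y j \<in> P" if "k \<in> {..<n} - {j}" for k
        proof (cases "k < j")
          case True
          have "x \<in> place_ring P"
            using x yP[of 0] False place_subset[OF P] by simp
          then have "ev (p k) x * (y k / y j) \<in> P"
            by (intro place_mult[OF P] ev_in_place_ring[OF P] quot True j)
          then show ?thesis by simp
        next
          case False
          with that have k: "j < k" "k < n" by auto
          then have "coeff (p k) 0 = 0"
            using max[of k] by (auto simp: J_def)
          then have "ev (p k) x = x * ev (poly_shift 1 (p k)) x"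
            by (simp add: ev_coeff_0[of "p k"])
          moreover have "x / y j \<in> place_ring P"
            using quot[of 0 j] j x nz[of j] place_subset[OF P] place_ring_1[OF P]
            by (cases "j = 0") auto
          moreover have "x \<in> place_ring P"
            using x yP[of 0] \<open>n \<noteq> 0\<close> place_subset[OF P] by simp
          ultimately have "ev (poly_shift 1 (p k)) x * ((x / y j) * y k) \<in> P"
            by (intro place_mult[OF P] ev_in_place_ring[OF P] yP k)
          then show ?thesis
            using \<open>ev (p k) x = _\<close> by (simp add: mult_ac)
        qed
        have "0 = (\<Sum>k<n. ev (p k) x * y k) / y j"
          using sum by simp
        also have "\<dots> = (\<Sum>k<n. ev (p k) x * y k / y j)"
          by (simp add: sum_divide_distrib)
        also have "\<dots> = ev (p j) x + (\<Sum>k\<in>{..<n} - {j}. ev (p k) x * y k / y j)"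
          using j nz[of j] by (subst sum.remove[of _ j]) auto
        finally have "ev (p j) x = - (\<Sum>k\<in>{..<n} - {j}. ev (p k) x * y k / y j)"
          by (simp add: eq_neg_iff_add_eq_0)
        also have "\<dots> \<in> P"
          by (intro place_minus[OF P] place_sum[OF P] term_in)
        finally have "ev (p j) x \<in> P" .
        moreover have "x * ev (poly_shift 1 (p j)) x \<in> P"
          using x yP[of 0] False place_subset[OF P]
          by (intro place_mult'[OF P] ev_in_place_ring[OF P]) auto
        ultimately have "ev (p j) x + - (x * ev (poly_shift 1 (p j)) x) \<in> P"
          by (intro place_add[OF P] place_minus[OF P])
        then have "emb (coeff (p j) 0) \<in> P"
          by (simp add: ev_coeff_0[of "p j"])
        then show False
          using j emb_in_place_iff[OF P] by simp
      qed
    qed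
    then show ?thesis
      using c[of "{..<n}" y] by simp
  qed simp
  then show ?thesis by blast
qed

definition uniformizer :: "'f set \<Rightarrow> 'f \<Rightarrow> bool" where
  "uniformizer P t \<longleftrightarrow> P = {t * y | y. y \<in> place_ring P}"

text \<open>The last member of a longest chain starting from some nonzero element of
  \<open>P\<close> divides all of \<open>P\<close>: an element that it does not divide would prolong
  the chain.\<close>

lemma uniformizer_exists:
  assumes P: "P \<in> places"
  shows "\<exists>t. uniformizer P t"
proof -
  obtain x where x: "x \<in> P" "x \<noteq> 0"
    using place_nonzero[OF P] by blast
  define Q where "Q n \<longleftrightarrow> (\<exists>y. place_chain P x y (Suc n))" for n
  obtain c where c: "\<And>y n. place_chain P x y n \<Longrightarrow> n \<le> c"
    using place_chain_bound[OF P] by blast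
  have "Q 0"
    using x by (auto simp: Q_def place_chain_def intro: exI[of _ "\<lambda>_. x"])
  moreover have "n \<le> c" if "Q n" for n
    using c that by (force simp: Q_def)
  ultimately obtain n where n: "Q n" "\<And>m. Q m \<Longrightarrow> m \<le> n"
    using GreatestI_nat[of Q 0 c] Greatest_le_nat[of Q _ c] by blast
  then obtain y where y: "place_chain P x y (Suc n)"
    by (auto simp: Q_def)
  define t where "t = y n"
  have t: "t \<in> P" "t \<noteq> 0"
    using y by (auto simp: place_chain_def t_def)
  have "w / t \<in> place_ring P" if w: "w \<in> P" for w
  proof (rule ccontr)
    assume not: "w / t \<notin> place_ring P"
    then have "w \<noteq> 0"
      using place_ring_0[OF P] by auto
    moreover have "t / w \<in> P"
      using inverse_in_place[OF P not] by simp
    ultimately have "place_chain P x (y(Suc n := w)) (Suc (Suc n))"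
      using y w by (auto simp: place_chain_def t_def less_Suc_eq)
    then show False
      using n(2)[of "Suc n"] by (auto simp: Q_def)
  qed
  then have "uniformizer P t"
    unfolding uniformizer_def using t place_mult'[OF P t(1)]
    by (auto intro!: exI[of _ "_ / t"])
  then show ?thesis by blast
qed

lemma uniformizerD:
  assumes "P \<in> places" "uniformizer P t"
  shows "t \<in> P" "t \<noteq> 0" "z \<in> P \<longleftrightarrow> z / t \<in> place_ring P"
proof -
  have eq: "P = {t * y | y. y \<in> place_ring P}"
    using assms(2) by (simp add: uniformizer_def)
  show "t \<in> P"
    by (subst eq) (use place_ring_1[OF assms(1)] in \<open>auto intro: exI[of _ 1]\<close>)
  show "t \<noteq> 0"
    using place_nonzero[OF assms(1)] by (subst (asm) eq) auto
  then show "z \<in> P \<longleftrightarrow> z / t \<in> place_ring P"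
    by (subst eq) (auto intro!: exI[of _ "z / t"])
qed

section \<open>Units and the normalised valuation\<close>

definition place_unit :: "'f set \<Rightarrow> 'f \<Rightarrow> bool" where
  "place_unit P u \<longleftrightarrow> u \<noteq> 0 \<and> u \<in> place_ring P \<and> inverse u \<in> place_ring P"

lemma place_unit_mult: "P \<in> places \<Longrightarrow> place_unit P u \<Longrightarrow> place_unit P w \<Longrightarrow> place_unit P (u * w)"
  by (auto simp: place_unit_def place_ring_mult)

lemma place_unit_inverse: "place_unit P u \<Longrightarrow> place_unit P (inverse u)"
  by (simp add: place_unit_def)

lemma place_unit_1: "P \<in> places \<Longrightarrow> place_unit P 1"
  by (simp add: place_unit_def place_ring_1)

lemma place_unit_power: "P \<in> places \<Longrightarrow> place_unit P u \<Longrightarrow> place_unit P (u ^ n)"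
  by (induction n) (auto intro: place_unit_mult place_unit_1)

lemma place_unit_powi: "P \<in> places \<Longrightarrow> place_unit P u \<Longrightarrow> place_unit P (u powi n)"
  by (auto simp: power_int_def intro: place_unit_power place_unit_inverse)

lemma place_unit_iff: "P \<in> places \<Longrightarrow> place_unit P u \<longleftrightarrow> u \<in> place_ring P \<and> u \<notin> P"
  by (auto simp: place_unit_def place_iff)

text \<open>Division by \<open>t\<close> has to leave the ring after finitely many steps, since
  otherwise the powers of \<open>t\<close> would form chains from \<open>z\<close> of any length.
  The last quotient inside the ring is the unit. Elements outside the ring are treated through their
  inverses.\<close>

lemma uniformizer_factor:
  assumes P: "P \<in> places" and t: "uniformizer P t" and "z \<noteq> 0"
  shows "\<exists>n u. place_unit P u \<and> z = t powi n * u"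
proof -
  note tD = uniformizerD[OF P t]
  have ring: "\<exists>n u. place_unit P u \<and> z = t ^ n * u" if z: "z \<in> place_ring P" "z \<noteq> 0" for z
  proof (cases "z \<in> P")
    case False
    then show ?thesis
      using z place_unit_iff[OF P, of z] by (intro exI[of _ 0] exI[of _ z]) simp
  next
    case True
    have "\<exists>n. z / t ^ n \<notin> place_ring P"
    proof (rule ccontr)
      assume "\<not> ?thesis"
      then have all: "z / t ^ n \<in> place_ring P" for n by blast
      obtain c where c: "\<And>y n. place_chain P z y n \<Longrightarrow> n \<le> c"
        using place_chain_bound[OF P] by blast
      \<comment> \<open>The chain z, t^c, t^(c-1), ..., t has \<open>c + 1\<close> members, one more
        than the bound \<open>c\<close> allows. Its first step uses that \<open>z\<close> is
        divisible by t^(c+1).\<close>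
      define y where "y = (\<lambda>i. if i = 0 then z else t ^ (Suc c - i))"
      have pow: "t ^ k \<in> P" if "k > 0" for k
      proof -
        have "t * t ^ (k - 1) \<in> P"
          by (intro place_mult'[OF P] place_ring_power[OF P] place_subset[OF P] tD)
        then show ?thesis
          using that by (simp add: power_eq_if)
      qed
      have "place_chain P z y (Suc c)"
        unfolding place_chain_def
      proof (intro conjI allI impI)
        fix i assume "i < Suc c"
        then show "y i \<noteq> 0" "y i \<in> P"
          using z tD(2) True pow[of "Suc c - i"] unfolding y_def by simp_all
      next
        fix i assume i: "Suc i < Suc c"
        show "y i / y (Suc i) \<in> P"
        proof (cases "i = 0")
          case True
          have "t * (z / t ^ Suc c) \<in> P"
            by (rule place_mult'[OF P tD(1) all])
          moreover have "y i / y (Suc i) = t * (z / t ^ Suc c)"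
            using True tD(2) by (simp add: y_def)
          ultimately show ?thesis by simp
        next
          case False
          have "Suc c - i = Suc (c - i)"
            using i by simp
          then have "y i / y (Suc i) = t"
            using tD(2) False by (simp add: y_def)
          then show ?thesis
            using tD(1) by simp
        qed
      qed (simp add: y_def)
      then show False
        using c[of y "Suc c"] by simp
    qed
    then obtain n where n: "z / t ^ n \<notin> place_ring P" and least: "\<And>m. m < n \<Longrightarrow> z / t ^ m \<in> place_ring P"
      using exists_least_iff[of "\<lambda>n. z / t ^ n \<notin> place_ring P"] by blast
    have "n \<noteq> 0"
      using n z by (cases n) auto
    then obtain m where m: "n = Suc m" by (cases n) auto
    define u where "u = z / t ^ m"
    have "u \<in> place_ring P" "u \<notin> P"
      using least[of m] n by (auto simp: u_def m tD(3) mult.commute)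
    then show ?thesis
      using tD by (intro exI[of _ m] exI[of _ u]) (auto simp: place_unit_iff[OF P] u_def)
  qed
  show ?thesis
  proof (cases "z \<in> place_ring P")
    case True
    then obtain n u where "place_unit P u" "z = t ^ n * u"
      using ring assms(3) by blast
    then show ?thesis
      by (intro exI[of _ "int n"] exI[of _ u]) auto
  next
    case False
    then obtain n u where "place_unit P u" "inverse z = t ^ n * u"
      using ring[of "inverse z"] place_ring_cases[OF P] assms(3) by auto
    then have "z = inverse (t ^ n * u)"
      by (metis inverse_inverse_eq)
    then have "z = t powi (- int n) * inverse u"
      by (simp add: power_int_minus)
    then show ?thesis
      using \<open>place_unit P u\<close> place_unit_inverse by blast
  qed
qed

lemma uniformizer_power_unit:
  assumes P: "P \<in> places" and t: "uniformizer P t" and "place_unit P (t powi n)"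
  shows "n = 0"
proof -
  note tD = uniformizerD[OF P t]
  have pos: "\<not> place_unit P (t powi n)" if "n > 0" for n
  proof -
    have "t powi n = t * t ^ (nat (n - 1))"
      using that tD(2) by (simp add: power_int_def flip: power_Suc) (simp add: Suc_nat_eq_nat_zadd1)
    also have "\<dots> \<in> P"
      by (intro place_mult'[OF P] place_ring_power[OF P] place_subset[OF P] tD)
    finally show ?thesis
      by (simp add: place_unit_iff[OF P])
  qed
  have "\<not> n > 0"
    using pos assms(3) by blast
  moreover have "\<not> n < 0"
    using pos[of "- n"] place_unit_inverse[OF assms(3)] by (auto simp: power_int_minus)
  ultimately show ?thesis by simp
qed

text \<open>The definite description ranges over all uniformizers, so uniqueness also has to compare
  two of them: their quotient is a unit and does not affect the exponent.\<close>

lemma valuation_eqI: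
  assumes P: "P \<in> places" and t: "uniformizer P t" and u: "place_unit P u" and z: "z = t powi n * u"
  shows "valuation P z = n"
  unfolding valuation_def
proof (rule the_equality)
  show "\<exists>t u. P = {t * y |y. y \<in> place_ring P} \<and> u \<noteq> 0 \<and> u \<in> place_ring P \<and>
      inverse u \<in> place_ring P \<and> z = t powi n * u"
    using assms by (auto simp: uniformizer_def place_unit_def)
next
  fix m assume "\<exists>t u. P = {t * y |y. y \<in> place_ring P} \<and> u \<noteq> 0 \<and> u \<in> place_ring P \<and>
      inverse u \<in> place_ring P \<and> z = t powi m * u"
  then obtain t' u' where t': "uniformizer P t'" and u': "place_unit P u'" and z': "z = t' powi m * u'"
    by (auto simp: uniformizer_def place_unit_def)
  note tD = uniformizerD[OF P t] and tD' = uniformizerD[OF P t']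
  define a where "a = t' / t"
  have a: "place_unit P a"
    using tD(3)[of t'] tD'(3)[of t] tD(1,2) tD'(1,2) by (auto simp: place_unit_def a_def)
  have "t powi n * u = t powi m * (a powi m * u')"
    using z z' tD by (simp add: a_def power_int_divide_distrib)
  then have "t powi (n - m) = a powi m * u' * inverse u"
    using u tD by (simp add: place_unit_def power_int_diff field_simps)
  moreover have "place_unit P (a powi m * u' * inverse u)"
    by (intro place_unit_mult place_unit_powi place_unit_inverse P a u u')
  ultimately show "m = n"
    using uniformizer_power_unit[OF P t, of "n - m"] by simp
qed

lemma valuation_factor:
  assumes P: "P \<in> places" and t: "uniformizer P t" and "z \<noteq> 0"
  obtains u where "place_unit P u" "z = t powi (valuation P z) * u"
  using uniformizer_factor[OF assms] valuation_eqI[OF P t] by metis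

lemma valuation_mult:
  assumes P: "P \<in> places" and "z \<noteq> 0" "w \<noteq> 0"
  shows "valuation P (z * w) = valuation P z + valuation P w"
proof -
  obtain t where t: "uniformizer P t"
    using uniformizer_exists[OF P] by blast
  obtain u where u: "place_unit P u" "z = t powi (valuation P z) * u"
    using valuation_factor[OF P t assms(2)] .
  obtain u' where u': "place_unit P u'" "w = t powi (valuation P w) * u'"
    using valuation_factor[OF P t assms(3)] .
  have "z * w = (t powi (valuation P z) * u) * (t powi (valuation P w) * u')"
    using u(2) u'(2) by simp
  also have "\<dots> = t powi (valuation P z + valuation P w) * (u * u')"
    using uniformizerD(2)[OF P t] by (simp add: power_int_add)
  finally show ?thesis
    by (rule valuation_eqI[OF P t place_unit_mult[OF P u(1) u'(1)]])
qed

lemma valuation_unit: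
  assumes P: "P \<in> places" and "place_unit P u"
  shows "valuation P u = 0"
  using valuation_eqI[OF P _ assms(2), of _ u 0] uniformizer_exists[OF P] by auto

lemma valuation_1 [simp]: "P \<in> places \<Longrightarrow> valuation P 1 = 0"
  by (simp add: valuation_unit place_unit_1)

lemma valuation_uniformizer:
  assumes P: "P \<in> places" and "uniformizer P t"
  shows "valuation P t = 1"
  by (rule valuation_eqI[OF assms place_unit_1[OF P]]) simp

lemma valuation_emb:
  assumes P: "P \<in> places" "a \<noteq> 0"
  shows "valuation P (emb a) = 0"
  using assms by (intro valuation_unit) (auto simp: place_unit_def place_ring_emb simp flip: emb_inverse)

lemma valuation_inverse:
  assumes P: "P \<in> places" and "z \<noteq> 0"
  shows "valuation P (inverse z) = - valuation P z"
  using valuation_mult[OF P, of z "inverse z"] assms by simp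

lemma valuation_divide:
  assumes P: "P \<in> places" and "z \<noteq> 0" "w \<noteq> 0"
  shows "valuation P (z / w) = valuation P z - valuation P w"
  using assms by (simp add: divide_inverse valuation_mult valuation_inverse)

lemma valuation_power:
  assumes P: "P \<in> places" and "z \<noteq> 0"
  shows "valuation P (z ^ n) = int n * valuation P z"
  using assms by (induction n) (auto simp: valuation_mult algebra_simps)

lemma valuation_ge_0_iff:
  assumes P: "P \<in> places" and "z \<noteq> 0"
  shows "valuation P z \<ge> 0 \<longleftrightarrow> z \<in> place_ring P"
    and "valuation P z > 0 \<longleftrightarrow> z \<in> P"
proof -
  obtain t where t: "uniformizer P t"
    using uniformizer_exists[OF P] by blast
  note tD = uniformizerD[OF P t]
  have ge: "z \<in> place_ring P" if "valuation P z \<ge> 0" "z \<noteq> 0" for z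
  proof -
    obtain u where "place_unit P u" "z = t powi (valuation P z) * u"
      using valuation_factor[OF P t] \<open>z \<noteq> 0\<close> by metis
    then have "z = t ^ nat (valuation P z) * u" "place_unit P u"
      using that by (auto simp: power_int_def)
    then show ?thesis
      using place_ring_mult[OF P place_ring_power[OF P place_subset[OF P tD(1)]]]
      by (metis place_unit_def)
  qed
  have gt: "z \<in> P" if "valuation P z > 0" "z \<noteq> 0" for z
    using ge[of z] ge[of "inverse z"] that valuation_unit[OF P, of z]
    by (auto simp: place_iff[OF P] place_unit_def)
  show "valuation P z \<ge> 0 \<longleftrightarrow> z \<in> place_ring P"
    using ge[of z] gt[of "inverse z"] assms valuation_inverse[OF P, of z] place_iff[OF P, of "inverse z"]
    by (cases "valuation P z \<ge> 0") auto
  show "valuation P z > 0 \<longleftrightarrow> z \<in> P"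
    using gt[of z] ge[of "inverse z"] assms valuation_inverse[OF P, of z] place_iff[OF P, of z]
    by (cases "valuation P z > 0") auto
qed

text \<open>The fractional ideal P^n. Including \<open>0\<close> by hand gives it the infinite value
  that \<open>valuation\<close> leaves unspecified, and makes these sets closed under
  addition.\<close>

definition val_ge :: "'f set \<Rightarrow> int \<Rightarrow> 'f set" where
  "val_ge P n = {z. z = 0 \<or> valuation P z \<ge> n}"

lemma val_ge_0 [simp]: "0 \<in> val_ge P n"
  by (simp add: val_ge_def)

lemma val_ge_iff: "z \<noteq> 0 \<Longrightarrow> z \<in> val_ge P n \<longleftrightarrow> valuation P z \<ge> n"
  by (simp add: val_ge_def)

lemma val_ge_mono: "n \<le> m \<Longrightarrow> val_ge P m \<subseteq> val_ge P n"
  by (auto simp: val_ge_def)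

lemma val_ge_mult:
  "P \<in> places \<Longrightarrow> z \<in> val_ge P n \<Longrightarrow> w \<in> val_ge P m \<Longrightarrow> z * w \<in> val_ge P (n + m)"
  by (cases "z = 0 \<or> w = 0") (auto simp: val_ge_def valuation_mult)

lemma val_ge_mult_iff:
  "P \<in> places \<Longrightarrow> w \<noteq> 0 \<Longrightarrow> z * w \<in> val_ge P n \<longleftrightarrow> z \<in> val_ge P (n - valuation P w)"
  by (cases "z = 0") (auto simp: val_ge_def valuation_mult)

lemma val_ge_0_eq: "P \<in> places \<Longrightarrow> val_ge P 0 = place_ring P"
  and val_ge_1_eq: "P \<in> places \<Longrightarrow> val_ge P 1 = P"
proof -
  assume P: "P \<in> places"
  show "val_ge P 0 = place_ring P"
  proof (rule Set.set_eqI)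
    fix z show "z \<in> val_ge P 0 \<longleftrightarrow> z \<in> place_ring P"
      by (cases "z = 0") (simp_all add: val_ge_iff valuation_ge_0_iff place_ring_0 P)
  qed
  show "val_ge P 1 = P"
  proof (rule Set.set_eqI)
    fix z show "z \<in> val_ge P 1 \<longleftrightarrow> z \<in> P"
      by (cases "z = 0") (simp_all add: val_ge_iff place_0 P int_one_le_iff_zero_less flip: valuation_ge_0_iff(2))
  qed
qed

lemma val_ge_add:
  assumes P: "P \<in> places" and "z \<in> val_ge P n" "w \<in> val_ge P n"
  shows "z + w \<in> val_ge P n"
proof -
  obtain t where t: "uniformizer P t"
    using uniformizer_exists[OF P] by blast
  note tD = uniformizerD[OF P t]
  have v: "valuation P (t powi k) = k" for k
    by (rule valuation_eqI[OF P t place_unit_1[OF P]]) simp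
  have iff: "y \<in> val_ge P n \<longleftrightarrow> y * t powi (- n) \<in> place_ring P" for y
    using tD by (subst val_ge_0_eq[symmetric, OF P], subst val_ge_mult_iff[OF P]) (auto simp: v)
  show ?thesis
    using place_ring_add[OF P] assms(2,3) by (simp add: iff distrib_right)
qed

lemma val_ge_minus: "P \<in> places \<Longrightarrow> z \<in> val_ge P n \<Longrightarrow> - z \<in> val_ge P n"
  using val_ge_mult[of P "emb (- 1)" 0 z n] place_ring_emb[of P "- 1"]
  by (simp add: val_ge_0_eq emb_minus)

lemma val_ge_emb: "P \<in> places \<Longrightarrow> z \<in> val_ge P n \<Longrightarrow> emb a * z \<in> val_ge P n"
  using val_ge_mult[of P "emb a" 0 z n] place_ring_emb[of P a] by (simp add: val_ge_0_eq)

lemma val_ge_sum: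
  "P \<in> places \<Longrightarrow> (\<And>i. i \<in> I \<Longrightarrow> f i \<in> val_ge P n) \<Longrightarrow> sum f I \<in> val_ge P n"
  by (induction I rule: infinite_finite_induct) (auto intro: val_ge_add)

lemma valuation_eq_iff:
  "z \<noteq> 0 \<Longrightarrow> valuation P z = n \<longleftrightarrow> z \<in> val_ge P n \<and> z \<notin> val_ge P (n + 1)"
  by (auto simp: val_ge_def)

text \<open>The ultrametric principle behind the independence proofs below: a term of strictly least
  valuation cannot be cancelled by the others.\<close>

lemma sum_dominant_nonzero:
  assumes P: "P \<in> places" and "finite I" "i \<in> I" "f i \<noteq> 0"
    and "\<And>j. j \<in> I - {i} \<Longrightarrow> f j \<in> val_ge P (valuation P (f i) + 1)"
  shows "sum f I \<noteq> 0"
proof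
  assume "sum f I = 0"
  then have "f i = - sum f (I - {i})"
    using assms(2,3) by (simp add: sum.remove eq_neg_iff_add_eq_0)
  also have "\<dots> \<in> val_ge P (valuation P (f i) + 1)"
    by (intro val_ge_minus[OF P] val_ge_sum[OF P] assms(5))
  finally show False
    using assms(4) by (simp add: val_ge_iff)
qed

lemma valuation_add_less:
  assumes P: "P \<in> places" and "z \<noteq> 0" "w \<in> val_ge P (valuation P z + 1)"
  shows "z + w \<noteq> 0" "valuation P (z + w) = valuation P z"
proof -
  have "z \<noteq> - w"
    using val_ge_minus[OF P assms(3)] assms(2) by (auto simp: val_ge_iff)
  then show nz: "z + w \<noteq> 0"
    by (simp add: eq_neg_iff_add_eq_0)
  have "z + w \<in> val_ge P (valuation P z)"
    using assms val_ge_mono[of "valuation P z" "valuation P z + 1" P]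
    by (intro val_ge_add[OF P]) (auto simp: val_ge_iff)
  moreover have "z + w \<notin> val_ge P (valuation P z + 1)"
    using val_ge_add[OF P _ val_ge_minus[OF P assms(3)], of "z + w"] assms(2) by (auto simp: val_ge_iff)
  ultimately show "valuation P (z + w) = valuation P z"
    by (simp add: valuation_eq_iff nz)
qed

end

subsection \<open>Existence of places\<close>

text \<open>For \<open>I = y M\<close> with \<open>M\<close> a maximal subring not containing \<open>1 / y\<close>, the two relations express that
  neither \<open>z\<close> nor \<open>1 / z\<close> lies in \<open>M\<close>. They could be combined into one of smaller degree.\<close>

lemma no_unit_relations:
  fixes z :: "'a::field"
  assumes M: "1 \<in> M" "\<And>x y. x \<in> M \<Longrightarrow> y \<in> M \<Longrightarrow> x - y \<in> M"
    and I: "I \<subseteq> M" "0 \<in> I" "\<And>x y. x \<in> I \<Longrightarrow> y \<in> I \<Longrightarrow> x + y \<in> I"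
      "\<And>r x. r \<in> M \<Longrightarrow> x \<in> I \<Longrightarrow> r * x \<in> I" "1 \<notin> I"
  assumes "z \<noteq> 0" "\<And>i. coeff f i \<in> I" "\<And>i. coeff g i \<in> I" "poly f z = 1" "poly g (inverse z) = 1"
  shows False
  using assms(8-)
proof (induction "degree f + degree g" arbitrary: f g z rule: less_induct)
  case (less f g z)
  have reduce: "\<exists>h. (\<forall>i. coeff h i \<in> I) \<and> poly h z = 1 \<and> degree h < degree f"
    if "z \<noteq> 0" and f: "\<And>i. coeff f i \<in> I" "poly f z = 1"
      and g: "\<And>i. coeff g i \<in> I" "poly g (inverse z) = 1" and deg: "degree g \<le> degree f"
    for f g :: "'a poly" and z
  proof -
    define n where "n = degree f"
    define m where "m = degree g"
    define a where "a = coeff f n"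
    define b where "b = coeff g"
    have "m \<le> n"
      using deg by (simp add: n_def m_def)
    have "n > 0"
    proof (rule ccontr)
      assume "\<not> n > 0"
      then obtain c where "f = [:c:]"
        using degree_eq_zeroE[of f] by (auto simp: n_def)
      then show False
        using f(1)[of 0] f(2) I(5) by simp
    qed
    define f0 where "f0 = f - monom a n"
    \<comment> \<open>The relation for \<open>g\<close>, multiplied by z^n, expresses
      \<open>(1 - b 0) * z ^ n\<close> by lower powers of z. Multiply the relation for
      \<open>f\<close> by \<open>1 - b 0\<close>, replace its leading term accordingly, and add
      \<open>b 0\<close> so that the total is again 1.\<close>
    define h where "h = [:b 0:] + smult (1 - b 0) f0 + (\<Sum>j=1..m. monom (a * b j) (n - j))"
    have sum_in: "sum s A \<in> I" if "\<And>j. j \<in> A \<Longrightarrow> s j \<in> I" for s :: "nat \<Rightarrow> 'a" and A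
      using that by (induction A rule: infinite_finite_induct) (auto intro: I)
    have f0: "coeff f0 i \<in> I" for i
      using f(1) I(2) by (auto simp: f0_def a_def coeff_monom)
    have ab: "a * b j \<in> I" for j
      using I(4)[of a "b j"] I(1) f(1)[of n] g(1)[of j] by (auto simp: a_def b_def)
    have "coeff h i \<in> I" for i
      unfolding h_def coeff_add coeff_smult coeff_sum coeff_monom coeff_pCons
      using I(1,2) M(2)[OF M(1)] g(1)
      by (intro I(3,4) sum_in f0) (auto split: nat.splits intro: ab[unfolded b_def] simp: b_def)
    moreover have "poly h z = 1"
    proof -
      have z_power: "z ^ n * inverse z ^ j = z ^ (n - j)" if "j \<le> n" for j
        using that \<open>z \<noteq> 0\<close> by (simp add: power_diff power_inverse divide_inverse)
      have "poly g (inverse z) = b 0 + (\<Sum>j=1..m. b j * inverse z ^ j)"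
        unfolding poly_altdef b_def m_def
        by (simp add: sum.atMost_shift sum.atLeast1_atMost_eq)
      then have "1 - b 0 = (\<Sum>j=1..m. b j * inverse z ^ j)"
        using g(2) by (simp add: algebra_simps)
      then have "(1 - b 0) * z ^ n = z ^ n * (\<Sum>j=1..m. b j * inverse z ^ j)"
        by simp
      also have "\<dots> = (\<Sum>j=1..m. b j * z ^ (n - j))"
        unfolding sum_distrib_left using \<open>m \<le> n\<close>
        by (intro sum.cong) (simp_all add: mult.left_commute[of "z ^ n"] z_power)
      finally have eq: "(1 - b 0) * z ^ n = (\<Sum>j=1..m. b j * z ^ (n - j))" .
      have "poly h z = b 0 + (1 - b 0) * poly f0 z + a * (\<Sum>j=1..m. b j * z ^ (n - j))"
        by (simp add: h_def poly_sum poly_monom sum_distrib_left mult.assoc)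
      also have "\<dots> = b 0 + (1 - b 0) * (poly f0 z + a * z ^ n)"
        unfolding eq[symmetric] by (simp add: algebra_simps)
      also have "poly f0 z + a * z ^ n = 1"
        using f(2) by (simp add: f0_def poly_monom)
      finally show ?thesis by simp
    qed
    moreover have "degree h < degree f"
    proof -
      have "coeff h i = 0" if "i \<ge> n" for i
      proof -
        have "coeff f0 i = 0"
          using that by (auto simp: f0_def a_def coeff_monom n_def coeff_eq_0)
        moreover have "(\<Sum>j=1..m. coeff (monom (a * b j) (n - j)) i) = 0"
          using that \<open>n > 0\<close> by (intro sum.neutral) (auto simp: coeff_monom)
        ultimately show ?thesis
          using that \<open>n > 0\<close> by (auto simp: h_def coeff_sum coeff_pCons split: nat.splits)
      qed
      then have "degree h \<le> n - 1"
        by (intro degree_le) auto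
      then show ?thesis
        using \<open>n > 0\<close> by (simp add: n_def)
    qed
    ultimately show ?thesis by blast
  qed
  show ?case
  proof (cases "degree g \<le> degree f")
    case True
    then show ?thesis
      using reduce[of z f g] less by (metis add_less_mono1)
  next
    case False
    then obtain h where "\<And>i. coeff h i \<in> I" "poly h (inverse z) = 1" "degree h < degree g"
      using reduce[of "inverse z" g f] less.prems by auto
    then show ?thesis
      using less.hyps[of f h z] less.prems by auto
  qed
qed

context function_field
begin

text \<open>Chevalley's argument: a subring maximal among those that contain K[y] but not
  \<open>inverse y\<close> is a valuation ring, and \<open>y\<close> is a nonunit of it.
  Transcendence of \<open>y\<close> keeps \<open>inverse y\<close> out of K[y], so Zorn's lemma has
  a starting point.\<close>

lemma place_containing:
  assumes y: "y \<notin> range emb" and transc: "\<And>p. p \<noteq> 0 \<Longrightarrow> ev p y \<noteq> 0"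
  shows "\<exists>P\<in>places. y \<in> P"
proof -
  have "y \<noteq> 0"
    using y emb_0 by (metis rangeI)
  define A where "A = range (\<lambda>p. ev p y)"
  define \<S> where "\<S> = {S. A \<subseteq> S \<and> (\<forall>u\<in>S. \<forall>w\<in>S. u - w \<in> S \<and> u * w \<in> S) \<and> inverse y \<notin> S}"
  have "inverse y \<noteq> ev p y" for p
  proof
    assume "inverse y = ev p y"
    then have "ev (pCons (- 1) p) y = 0"
      using \<open>y \<noteq> 0\<close> by (simp add: emb_minus flip: \<open>inverse y = ev p y\<close>)
    then show False
      using transc[of "pCons (- 1) p"] by simp
  qed
  then have "A \<in> \<S>"
    unfolding \<S>_def A_def by (auto simp flip: ev_diff ev_mult)
  have "\<exists>M\<in>\<S>. \<forall>N\<in>\<S>. M \<subseteq> N \<longrightarrow> N = M"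
  proof (rule subset_Zorn_nonempty)
    show "\<S> \<noteq> {}"
      using \<open>A \<in> \<S>\<close> by blast
  next
    fix \<C> assume C: "\<C> \<noteq> {}" "subset.chain \<S> \<C>"
    have closed: "u - w \<in> \<Union>\<C> \<and> u * w \<in> \<Union>\<C>" if "u \<in> \<Union>\<C>" "w \<in> \<Union>\<C>" for u w
    proof -
      obtain U W where UW: "u \<in> U" "w \<in> W" "U \<in> \<C>" "W \<in> \<C>"
        using \<open>u \<in> \<Union>\<C>\<close> \<open>w \<in> \<Union>\<C>\<close> by auto
      then have "U \<subseteq> W \<or> W \<subseteq> U"
        using C(2) by (metis subset_chain_def)
      then obtain V where "u \<in> V" "w \<in> V" "V \<in> \<C>"
        using UW by blast
      moreover from this have "V \<in> \<S>"
        using C(2) by (auto simp: subset_chain_def)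
      ultimately show ?thesis
        unfolding \<S>_def by blast
    qed
    have "\<C> \<subseteq> \<S>"
      using C(2) by (auto simp: subset_chain_def)
    then show "\<Union>\<C> \<in> \<S>"
      using closed C(1) unfolding \<S>_def by blast
  qed
  then obtain M where M: "M \<in> \<S>" and max: "\<And>N. N \<in> \<S> \<Longrightarrow> M \<subseteq> N \<Longrightarrow> N = M" by blast
  have A: "A \<subseteq> M" and diff: "\<And>u w. u \<in> M \<Longrightarrow> w \<in> M \<Longrightarrow> u - w \<in> M"
    and mult: "\<And>u w. u \<in> M \<Longrightarrow> w \<in> M \<Longrightarrow> u * w \<in> M" and inv: "inverse y \<notin> M"
    using M unfolding \<S>_def by blast+
  have emb: "emb a \<in> M" for a
    using A by (auto simp: A_def image_subset_iff dest: spec[of _ "[:a:]"])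
  have "y \<in> M"
    using A by (auto simp: A_def image_subset_iff dest: spec[of _ "[:0, 1:]"])
  have 01: "0 \<in> M" "1 \<in> M"
    using emb[of 0] emb[of 1] by auto
  have add: "u + w \<in> M" if "u \<in> M" "w \<in> M" for u w
    using diff[of u "0 - w"] diff[of 0 w] 01 that by simp
  have sum_in: "sum s J \<in> M" if "\<And>j. j \<in> J \<Longrightarrow> s j \<in> M" for s :: "nat \<Rightarrow> 'f" and J
    using that by (induction J rule: infinite_finite_induct) (auto intro: add 01)
  define yM where "yM = (\<lambda>u. y * u) ` M"
  \<comment> \<open>By maximality, adjoining \<open>z\<close> to \<open>M\<close> captures
    \<open>inverse y\<close>. Multiplying that expression by \<open>y\<close> yields a relation with
    value 1 and coefficients in \<open>yM\<close>.\<close>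
  have relation: "\<exists>f. (\<forall>i. coeff f i \<in> yM) \<and> poly f z = 1" if "z \<notin> M" for z
  proof -
    define N where "N = {poly f z | f. \<forall>i. coeff f i \<in> M}"
    have "M \<subseteq> N"
    proof
      fix u assume "u \<in> M"
      then show "u \<in> N"
        using 01 by (auto simp: N_def coeff_pCons intro!: exI[of _ "[:u:]"] split: nat.splits)
    qed
    have "z \<in> N"
      using 01 by (auto simp: N_def coeff_pCons intro!: exI[of _ "[:0, 1:]"] split: nat.splits)
    have closed: "u - w \<in> N \<and> u * w \<in> N" if uw: "u \<in> N" "w \<in> N" for u w
    proof -
      obtain f g where fg: "\<And>i. coeff f i \<in> M" "\<And>i. coeff g i \<in> M" "u = poly f z" "w = poly g z"
        using uw by (auto simp: N_def)
      have "\<forall>i. coeff (f - g) i \<in> M"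
        using fg diff by simp
      moreover have "\<forall>i. coeff (f * g) i \<in> M"
        unfolding coeff_mult using fg by (intro allI sum_in mult) auto
      moreover have "u - w = poly (f - g) z" "u * w = poly (f * g) z"
        using fg by simp_all
      ultimately show ?thesis
        unfolding N_def by blast
    qed
    have "N \<noteq> M"
      using \<open>z \<in> N\<close> \<open>z \<notin> M\<close> by blast
    then have "N \<notin> \<S>"
      using max \<open>M \<subseteq> N\<close> by blast
    then have "inverse y \<in> N"
      using \<open>M \<subseteq> N\<close> A closed unfolding \<S>_def by blast
    then obtain f where f: "\<And>i. coeff f i \<in> M" "inverse y = poly f z"
      by (auto simp: N_def)
    have "poly (smult y f) z = 1"
      using \<open>y \<noteq> 0\<close> by (simp flip: f(2))
    moreover have "\<forall>i. coeff (smult y f) i \<in> yM"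
      using f(1) by (auto simp: yM_def)
    ultimately show ?thesis by blast
  qed
  have "valuation_ring M"
    unfolding valuation_ring_def
  proof (intro conjI)
    show "range emb \<subset> M"
      using emb \<open>y \<in> M\<close> y by blast
    show "M \<subset> UNIV"
      using inv by blast
    show "\<forall>z. z \<in> M \<or> inverse z \<in> M"
    proof (rule ccontr)
      assume "\<not> ?thesis"
      then obtain z where z: "z \<notin> M" "inverse z \<notin> M" by blast
      obtain f where f: "\<forall>i. coeff f i \<in> yM" "poly f z = 1"
        using relation[OF z(1)] by (elim exE conjE)
      obtain g where g: "\<forall>i. coeff g i \<in> yM" "poly g (inverse z) = 1"
        using relation[OF z(2)] by (elim exE conjE)
      show False
      proof (rule no_unit_relations[of M "yM" z f g])
        show "yM \<subseteq> M" "0 \<in> yM"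
          using mult \<open>y \<in> M\<close> 01 by (auto simp: yM_def image_iff intro!: bexI[of _ 0])
        show "u + w \<in> yM" if "u \<in> yM" "w \<in> yM" for u w
          using that add by (auto simp: yM_def simp flip: distrib_left)
        show "r * u \<in> yM" if "r \<in> M" "u \<in> yM" for r u
          using that mult by (auto simp: yM_def image_iff mult.left_commute)
        show "1 \<notin> yM"
        proof
          assume "1 \<in> yM"
          then obtain w where "w \<in> M" "1 = y * w" by (auto simp: yM_def)
          then show False
            using inv by (metis inverse_unique)
        qed
        show "z \<noteq> 0"
          using z 01 by auto
      qed (use f g 01 diff in auto)
    qed
  qed (use diff mult in auto)
  moreover have "y \<in> nonunits M"
    using \<open>y \<in> M\<close> inv by (simp add: nonunits_def)
  ultimately show ?thesis
    using places_iff by blast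
qed

subsection \<open>Weak approximation\<close>

text \<open>Discreteness makes these rings maximal: under a proper inclusion \<open>Q\<close> would
  be contained in \<open>P\<close>, yet a suitable product of powers would have positive value at
  \<open>Q\<close> and value zero at \<open>P\<close>.\<close>

lemma place_ring_incomparable:
  assumes P: "P \<in> places" and Q: "Q \<in> places" and "P \<noteq> Q"
  obtains z where "z \<noteq> 0" "valuation P z \<ge> 0" "valuation Q z < 0"
proof -
  have "\<not> place_ring P \<subseteq> place_ring Q"
  proof
    assume sub: "place_ring P \<subseteq> place_ring Q"
    have "Q \<subseteq> P"
    proof
      fix z assume "z \<in> Q"
      then have "z = 0 \<or> inverse z \<notin> place_ring P"
        using sub place_iff[OF Q] by blast
      then show "z \<in> P"
        using inverse_in_place[OF P, of "inverse z"] place_0[OF P] by auto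
    qed
    have "place_ring Q \<subseteq> place_ring P"
    proof (rule ccontr)
      assume "\<not> ?thesis"
      then obtain z where z: "z \<in> place_ring Q" "z \<notin> place_ring P" by blast
      then have "z \<noteq> 0"
        using place_ring_0[OF P] by auto
      obtain t where t: "t \<in> Q" "t \<noteq> 0"
        using place_nonzero[OF Q] by blast
      \<comment> \<open>The exponents are crossed so that the values of z^m and t^k at
        \<open>P\<close> cancel, whereas at \<open>Q\<close> the value is positive.\<close>
      define k where "k = nat (- valuation P z)"
      define m where "m = nat (valuation P t)"
      have "valuation P z < 0" "valuation Q z \<ge> 0" "valuation Q t > 0" "valuation P t > 0"
        using z t \<open>z \<noteq> 0\<close> \<open>Q \<subseteq> P\<close> valuation_ge_0_iff[OF P] valuation_ge_0_iff[OF Q] by (auto simp: not_le[symmetric])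
      then have km: "int k = - valuation P z" "int m = valuation P t" "k > 0"
        by (auto simp: k_def m_def)
      have "valuation Q (z ^ m * t ^ k) > 0"
      proof -
        have "0 \<le> int m * valuation Q z" "0 < int k * valuation Q t"
          using \<open>k > 0\<close> \<open>valuation Q z \<ge> 0\<close> \<open>valuation Q t > 0\<close> by simp_all
        then show ?thesis
          using \<open>z \<noteq> 0\<close> t by (simp add: valuation_mult[OF Q] valuation_power[OF Q])
      qed
      then have "valuation P (z ^ m * t ^ k) > 0"
        using \<open>Q \<subseteq> P\<close> \<open>z \<noteq> 0\<close> t by (auto simp: valuation_ge_0_iff(2)[OF P] valuation_ge_0_iff(2)[OF Q])
      moreover have "valuation P (z ^ m * t ^ k) = 0"
        using \<open>z \<noteq> 0\<close> t km by (simp add: valuation_mult[OF P] valuation_power[OF P])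
      ultimately show False by simp
    qed
    then have "place_ring P = place_ring Q"
      using sub by blast
    then show False
      using place_eq_nonunits[OF P] place_eq_nonunits[OF Q] \<open>P \<noteq> Q\<close> by metis
  qed
  then obtain z where z: "z \<in> place_ring P" "z \<notin> place_ring Q" by blast
  then have "z \<noteq> 0"
    using place_ring_0[OF Q] by auto
  then show thesis
    using that[of z] z valuation_ge_0_iff(1)[OF P, of z] valuation_ge_0_iff(1)[OF Q, of z] by auto
qed

text \<open>To add a place \<open>Q\<close>, take \<open>z\<close> with a zero at \<open>P\<close>
  and a pole at \<open>Q\<close> and pass from \<open>y\<close> to \<open>y + z ^ m\<close>. A large
  \<open>m\<close> avoids ties between the two summands at the old places, where the smaller value
  therefore wins and is negative.\<close>

lemma approximation_neg:
  assumes P: "P \<in> places" and "finite S" "S \<subseteq> places" "P \<notin> S"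
  shows "\<exists>w. w \<noteq> 0 \<and> valuation P w > 0 \<and> (\<forall>Q\<in>S. valuation Q w < 0)"
  using assms(2-)
proof (induction S)
  case empty
  obtain x where "x \<in> P" "x \<noteq> 0"
    using place_nonzero[OF P] by blast
  then show ?case
    using valuation_ge_0_iff(2)[OF P] by auto
next
  case (insert Q S)
  then obtain y where y: "y \<noteq> 0" "valuation P y > 0" "\<And>R. R \<in> S \<Longrightarrow> valuation R y < 0" by auto
  have Q: "Q \<in> places" "P \<noteq> Q"
    using insert.prems by auto
  show ?case
  proof (cases "valuation Q y < 0")
    case True
    then show ?thesis using y by auto
  next
    case False
    obtain a where a: "a \<noteq> 0" "valuation P a \<ge> 0" "valuation Q a < 0"
      using place_ring_incomparable[OF P Q] .
    obtain b where b: "b \<noteq> 0" "valuation Q b \<ge> 0" "valuation P b < 0"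
      using place_ring_incomparable[OF Q(1) P] Q(2) by metis
    define z where "z = a / b"
    have z: "z \<noteq> 0" "valuation P z > 0" "valuation Q z < 0"
      using a b by (auto simp: z_def valuation_divide[OF P] valuation_divide[OF Q(1)])
    \<comment> \<open>Larger than every \<bar>valuation R y\<bar>, so
      \<open>int m * valuation R z\<close> can equal the nonzero number \<open>valuation R y\<close>
      for no old place \<open>R\<close>.\<close>
    define m where "m = Suc (\<Sum>R\<in>S. nat \<bar>valuation R y\<bar>)"
    have m: "int m > \<bar>valuation R y\<bar>" if "R \<in> S" for R
      using member_le_sum[OF that, of "\<lambda>R. nat \<bar>valuation R y\<bar>"] insert.hyps unfolding m_def
      by linarith
    have zm: "z ^ m \<noteq> 0" "valuation R (z ^ m) = int m * valuation R z" if "R \<in> places" for R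
      using z that by (auto simp: valuation_power)
    have m0: "int m > 0"
      by (simp only: m_def of_nat_0_less_iff zero_less_Suc)
    define w where "w = y + z ^ m"
    have "valuation Q (z ^ m) < 0"
      using z m0 by (simp add: zm Q mult_pos_neg)
    then have wQ: "w \<noteq> 0" "valuation Q w = valuation Q (z ^ m)"
      using valuation_add_less[OF Q(1), of "z ^ m" y] False y z
      by (auto simp: w_def val_ge_iff add.commute)
    have "w \<in> val_ge P 1"
      unfolding w_def using y z m0
      by (intro val_ge_add[OF P]) (auto simp: val_ge_iff zm P int_one_le_iff_zero_less)
    moreover have "valuation R w < 0" if "R \<in> S" for R
    proof -
      have R: "R \<in> places"
        using that insert.prems by auto
      have "int m * valuation R z \<noteq> valuation R y"
      proof
        assume eq: "int m * valuation R z = valuation R y"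
        then have "valuation R z \<noteq> 0"
          using y(3)[OF that] by auto
        then have "int m * 1 \<le> int m * \<bar>valuation R z\<bar>"
          by (intro mult_left_mono) auto
        also have "\<dots> = \<bar>valuation R y\<bar>"
          unfolding eq[symmetric] abs_mult by simp
        finally show False
          using m[OF that] by simp
      qed
      then consider "valuation R (z ^ m) < valuation R y" | "valuation R y < valuation R (z ^ m)"
        using zm(2)[OF R] by linarith
      then show ?thesis
      proof cases
        case 1
        then have "valuation R w = valuation R (z ^ m)"
          using valuation_add_less(2)[OF R, of "z ^ m" y] z y by (auto simp: w_def val_ge_iff add.commute)
        then show ?thesis
          using 1 y(3)[OF that] by simp
      next
        case 2
        then have "valuation R w = valuation R y"
          using valuation_add_less(2)[OF R, of y "z ^ m"] z y by (auto simp: w_def val_ge_iff)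
        then show ?thesis
          using y(3)[OF that] by simp
      qed
    qed
    ultimately show ?thesis
      using wQ \<open>valuation Q (z ^ m) < 0\<close> by (intro exI[of _ w]) (auto simp: val_ge_iff)
  qed
qed

lemma approximation:
  assumes S: "finite S" "S \<subseteq> places" and P: "P \<in> S"
  shows "\<exists>u. u \<noteq> 0 \<and> valuation P u = int k \<and> (\<forall>Q\<in>S - {P}. valuation Q u \<ge> e)"
proof -
  have P': "P \<in> places"
    using P S by auto
  have "finite (S - {P})" "S - {P} \<subseteq> places"
    using S by auto
  then obtain w0 where w0: "w0 \<noteq> 0" "valuation P w0 > 0" "\<And>Q. Q \<in> S - {P} \<Longrightarrow> valuation Q w0 < 0"
    using approximation_neg[OF P', of "S - {P}"] by blast
  \<comment> \<open>A unit at \<open>P\<close> and a zero at the other places of \<open>S\<close>: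
    powers of \<open>w\<close> raise the values there without disturbing the one at
    \<open>P\<close>.\<close>
  define w where "w = inverse (1 + w0)"
  have w_P: "1 + w0 \<noteq> 0" "valuation P (1 + w0) = 0"
    using valuation_add_less[OF P', of 1 w0] w0(1,2) P' by (auto simp: val_ge_iff)
  then have w: "w \<noteq> 0" "valuation P w = 0"
    using valuation_inverse[OF P'] by (auto simp: w_def)
  have w_Q: "valuation Q w \<ge> 1" if "Q \<in> S - {P}" for Q
  proof -
    have Q: "Q \<in> places"
      using that S by auto
    have "valuation Q (w0 + 1) = valuation Q w0"
      using valuation_add_less(2)[OF Q, of w0 1] w0(1) w0(3)[OF that] Q by (auto simp: val_ge_iff)
    then show ?thesis
      using w_P(1) w0(3)[OF that] by (simp add: w_def valuation_inverse[OF Q] add.commute)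
  qed
  obtain t where t: "uniformizer P t"
    using uniformizer_exists[OF P'] by blast
  have t0: "t \<noteq> 0" and t1: "valuation P t = 1"
    using uniformizerD(2)[OF P' t] valuation_uniformizer[OF P' t] by auto
  define m where "m = nat \<bar>e\<bar> + (\<Sum>Q\<in>S. nat \<bar>int k * valuation Q t\<bar>)"
  define u where "u = t ^ k * w ^ m"
  have "valuation Q u \<ge> e" if "Q \<in> S - {P}" for Q
  proof -
    have Q: "Q \<in> places"
      using that S by auto
    have "nat \<bar>int k * valuation Q t\<bar> \<le> (\<Sum>Q\<in>S. nat \<bar>int k * valuation Q t\<bar>)"
      using that S by (intro member_le_sum) auto
    then have "int m \<ge> e - int k * valuation Q t"
      unfolding m_def by linarith
    moreover have "int m * 1 \<le> int m * valuation Q w"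
      using w_Q[OF that] by (intro mult_left_mono) auto
    ultimately show ?thesis
      using t0 w by (simp add: u_def valuation_mult[OF Q] valuation_power[OF Q])
  qed
  moreover have "u \<noteq> 0" "valuation P u = int k"
    using t0 t1 w by (auto simp: u_def valuation_mult[OF P'] valuation_power[OF P'])
  ultimately show ?thesis by blast
qed

lemma valuation_ev:
  assumes P: "P \<in> places" and "z \<in> P" "coeff p 0 \<noteq> 0"
  shows "ev p z \<noteq> 0" "valuation P (ev p z) = 0"
proof -
  have "z * ev (poly_shift 1 p) z \<in> P"
    using assms by (intro place_mult'[OF P] ev_in_place_ring[OF P] place_subset[OF P])
  then have "z * ev (poly_shift 1 p) z \<in> val_ge P (valuation P (emb (coeff p 0)) + 1)"
    using assms by (simp add: valuation_emb val_ge_1_eq)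
  then show "ev p z \<noteq> 0" "valuation P (ev p z) = 0"
    using valuation_add_less[OF P, of "emb (coeff p 0)"] assms ev_coeff_0[of p z]
    by (auto simp: valuation_emb)
qed

text \<open>Take \<open>u (P, k)\<close> of value \<open>k\<close> at \<open>P\<close> and of value
  at least \<open>e\<close>, the total number of zeros, at the other places. In a relation look at
  \<open>P\<close> and the least \<open>k\<close> with nonzero constant coefficient. Terms from
  other places have value at least \<open>e > k\<close>, those with larger index have value above
  \<open>k\<close>, and those with smaller index carry a factor z, whose value at \<open>P\<close>
  exceeds \<open>k\<close>. So the term at \<open>k\<close> dominates.\<close>

lemma zeros_poly_indep:
  assumes S: "finite S" "S \<subseteq> places" and z: "z \<noteq> 0" "\<And>P. P \<in> S \<Longrightarrow> valuation P z > 0"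
  shows "\<exists>u. poly_indep z u (SIGMA P:S. {..<nat (valuation P z)})"
proof -
  define e where "e = (\<Sum>P\<in>S. valuation P z)"
  have e: "valuation P z \<le> e" if "P \<in> S" for P
    unfolding e_def using z(2) S(1) that by (intro member_le_sum) (auto intro: less_imp_le)
  have "\<exists>u. u \<noteq> 0 \<and> valuation P u = int k \<and> (\<forall>Q\<in>S - {P}. valuation Q u \<ge> e)" if "P \<in> S" for P k
    using approximation[OF S that] .
  then obtain u0 where u0: "\<And>P k. P \<in> S \<Longrightarrow> u0 P k \<noteq> 0 \<and> valuation P (u0 P k) = int k \<and>
      (\<forall>Q\<in>S - {P}. valuation Q (u0 P k) \<ge> e)"
    by metis
  define u where "u = (\<lambda>(P, k). u0 P k)"
  define I where "I = (SIGMA P:S. {..<nat (valuation P z)})"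
  have "finite I"
    using S by (auto simp: I_def)
  have "poly_indep z u I"
  proof (rule poly_indepI)
    fix p i assume i: "i \<in> I" and sum: "(\<Sum>i\<in>I. ev (p i) z * u i) = 0"
    obtain P k0 where Pk0: "i = (P, k0)" by (cases i)
    have PS: "P \<in> S" and k0: "k0 < nat (valuation P z)"
      using i by (auto simp: I_def Pk0)
    have P: "P \<in> places"
      using PS S by auto
    have zP: "z \<in> P"
      using z PS valuation_ge_0_iff(2)[OF P] by blast
    show "coeff (p i) 0 = 0"
    proof (rule ccontr)
      assume "coeff (p i) 0 \<noteq> 0"
      then have ex: "\<exists>k. coeff (p (P, k)) 0 \<noteq> 0"
        using Pk0 by auto
      define k where "k = (LEAST k. coeff (p (P, k)) 0 \<noteq> 0)"
      have k: "coeff (p (P, k)) 0 \<noteq> 0"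
        using LeastI_ex[OF ex] by (simp add: k_def)
      have less_k: "coeff (p (P, j)) 0 = 0" if "j < k" for j
        using not_less_Least[of j "\<lambda>k. coeff (p (P, k)) 0 \<noteq> 0"] that by (auto simp: k_def)
      have "k \<le> k0"
        using \<open>coeff (p i) 0 \<noteq> 0\<close> Pk0 by (auto simp: k_def intro: Least_le)
      then have kz: "int k + 1 \<le> valuation P z"
        using k0 by linarith
      have kI: "(P, k) \<in> I"
        using kz PS by (auto simp: I_def)
      define f where "f = (\<lambda>i. ev (p i) z * u i)"
      have fk: "f (P, k) \<noteq> 0" "valuation P (f (P, k)) = int k"
        using valuation_ev[OF P zP k] u0[OF PS, of k] by (auto simp: f_def u_def valuation_mult[OF P])
      have "sum f I \<noteq> 0"
      proof (rule sum_dominant_nonzero[of P I "(P, k)" f, OF P \<open>finite I\<close> kI fk(1)])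
        fix j assume j: "j \<in> I - {(P, k)}"
        obtain Q l where Ql: "j = (Q, l)" by (cases j)
        have QS: "Q \<in> S" and Q: "Q \<in> places"
          using j S by (auto simp: Ql I_def)
        have ev_ring: "ev q z \<in> val_ge P 0" for q
          unfolding val_ge_0_eq[OF P] by (intro ev_in_place_ring[OF P] place_subset[OF P] zP)
        have mult: "ev q z * u j \<in> val_ge P (int k + 1)" if "valuation P (u j) \<ge> int k + 1" for q
          using val_ge_mult[OF P ev_ring, of "u j" "int k + 1" q] u0[OF QS, of l] that
          by (simp add: val_ge_iff Ql u_def)
        have "Q \<noteq> P \<or> l \<noteq> k"
          using j by (auto simp: Ql)
        then consider "Q \<noteq> P" | "Q = P" "l > k" | "Q = P" "l < k"
          using less_linear[of l k] by blast
        then have "f j \<in> val_ge P (int k + 1)"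
        proof cases
          case 1
          then have "valuation P (u j) \<ge> e"
            using u0[OF QS, of l] PS by (auto simp: Ql u_def)
          then show ?thesis
            unfolding f_def using e[OF PS] kz by (intro mult) auto
        next
          case 2
          then show ?thesis
            unfolding f_def using u0[OF QS, of l] by (intro mult) (auto simp: Ql u_def)
        next
          case 3
          then have "ev (p j) z = ev (poly_shift 1 (p j)) z * z"
            using less_k[of l] ev_coeff_0[of "p j" z] by (simp add: Ql)
          moreover have "z * u j \<in> val_ge P (int k + 1)"
            using 3 kz z u0[OF QS, of l] by (simp add: val_ge_def valuation_mult[OF P] Ql u_def)
          ultimately show ?thesis
            using val_ge_mult[OF P ev_ring, of "z * u j" "int k + 1"] by (simp add: f_def mult.assoc)
        qed
        then show "f j \<in> val_ge P (valuation P (f (P, k)) + 1)"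
          using fk by simp
      qed
      then show False
        using sum by (simp add: f_def)
    qed
  qed (use z in auto)
  then show ?thesis
    unfolding I_def by blast
qed

lemma finite_zeros:
  assumes "z \<noteq> 0"
  shows "finite {P \<in> places. valuation P z > 0}"
proof (rule ccontr)
  assume inf: "infinite {P \<in> places. valuation P z > 0}"
  obtain c where c: "\<And>(u :: 'f set \<times> nat \<Rightarrow> 'f) I. finite I \<Longrightarrow> poly_indep z u I \<Longrightarrow> card I \<le> c"
    using poly_indep_bound[where z = z] by blast
  obtain S where S: "finite S" "card S = Suc c" "S \<subseteq> {P \<in> places. valuation P z > 0}"
    using infinite_arbitrarily_large[OF inf] by blast
  define I where "I = (SIGMA P:S. {..<nat (valuation P z)})"
  obtain u where "poly_indep z u I"
    using zeros_poly_indep[of S z] S assms unfolding I_def by auto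
  moreover have "finite I"
    using S(1) by (simp add: I_def)
  ultimately have "card I \<le> c"
    using c by blast
  moreover have "card I = (\<Sum>P\<in>S. nat (valuation P z))"
    using S(1) by (simp add: I_def card_SigmaI)
  moreover have "(\<Sum>P\<in>S. nat (valuation P z)) \<ge> (\<Sum>P\<in>S. 1)"
    using S by (intro sum_mono) (auto simp: Suc_le_eq)
  ultimately show False
    using S(2) by simp
qed

lemma finite_valuation_support:
  assumes "z \<noteq> 0"
  shows "finite {P \<in> places. valuation P z \<noteq> 0}"
proof -
  have "{P \<in> places. valuation P z \<noteq> 0} \<subseteq>
      {P \<in> places. valuation P z > 0} \<union> {P \<in> places. valuation P (inverse z) > 0}"
    using assms by (auto simp: valuation_inverse)
  then show ?thesis
    using finite_zeros[of z] finite_zeros[of "inverse z"] assms by (auto intro: finite_subset)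
qed

end

subsection \<open>Algebraically closed constant fields\<close>

locale alg_closed_function_field = function_field emb
  for emb :: "'k::alg_closed_field \<Rightarrow> 'f::field"
begin

text \<open>Every nonconstant function is transcendental: over an algebraically closed field a
  polynomial splits into linear factors, and none of them vanishes at a nonconstant element.\<close>

lemma ev_nonzero:
  assumes "z \<notin> range emb" "p \<noteq> 0"
  shows "ev p z \<noteq> 0"
  using assms(2)
proof (induction "degree p" arbitrary: p)
  case 0
  then obtain a where "p = [:a:]" "a \<noteq> 0"
    by (metis degree_eq_zeroE pCons_0_0)
  then show ?case by simp
next
  case (Suc n)
  then obtain a where "poly p a = 0"
    using alg_closed_imp_poly_has_root[of p] by auto
  then obtain q where q: "p = [:- a, 1:] * q"
    by (metis poly_eq_0_iff_dvd dvdE)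
  then have "q \<noteq> 0"
    using Suc.prems by auto
  then have "degree p = 1 + degree q"
    unfolding q by (subst degree_mult_eq) auto
  then have "ev q z \<noteq> 0"
    using Suc.hyps \<open>q \<noteq> 0\<close> by simp
  moreover have "ev [:- a, 1:] z \<noteq> 0"
    using assms(1) by (auto simp: emb_minus)
  ultimately show ?case
    unfolding q ev_mult by simp
qed

text \<open>The residue field is K. If no \<open>z - emb a\<close> were in \<open>P\<close>, every
  nonzero polynomial in \<open>z\<close> would be a unit at \<open>P\<close>; then powers of a
  uniformizer, having distinct values, would be independent over K[z] in any number.\<close>

lemma residue:
  assumes P: "P \<in> places" and z: "z \<in> place_ring P"
  obtains a where "z - emb a \<in> P"
proof (rule ccontr)
  assume no: "\<not> thesis"
  then have no: "z - emb a \<notin> P" for a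
    using that by blast
  have unit: "place_unit P (ev p z)" if "p \<noteq> 0" for p
    using that
  proof (induction "degree p" arbitrary: p)
    case 0
    then obtain a where "p = [:a:]" "a \<noteq> 0"
      by (metis degree_eq_zeroE pCons_0_0)
    then show ?case
      by (simp add: place_unit_iff[OF P] place_ring_emb[OF P] emb_in_place_iff[OF P])
  next
    case (Suc n)
    then obtain a where "poly p a = 0"
      using alg_closed_imp_poly_has_root[of p] by auto
    then obtain q where q: "p = [:- a, 1:] * q"
      by (metis poly_eq_0_iff_dvd dvdE)
    then have "q \<noteq> 0"
      using Suc.prems by auto
    then have "degree p = 1 + degree q"
      unfolding q by (subst degree_mult_eq) auto
    then have "place_unit P (ev q z)"
      using Suc \<open>q \<noteq> 0\<close> by auto
    moreover have "place_unit P (ev [:- a, 1:] z)"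
      using no[of a] place_ring_diff[OF P z place_ring_emb[OF P, of a]]
      by (simp add: place_unit_iff[OF P] emb_minus)
    ultimately show ?case
      unfolding q ev_mult by (intro place_unit_mult[OF P])
  qed
  obtain t where t: "uniformizer P t"
    using uniformizer_exists[OF P] by blast
  have t0: "t \<noteq> 0" and t1: "valuation P t = 1"
    using uniformizerD(2)[OF P t] valuation_uniformizer[OF P t] by auto
  have indep: "poly_indep z (\<lambda>i. t ^ i) {..<n}" for n
    unfolding poly_indep_def
  proof (intro allI impI ballI, rule ccontr)
    fix p i assume sum: "(\<Sum>i<n. ev (p i) z * t ^ i) = 0" and i: "i \<in> {..<n}" "p i \<noteq> 0"
    define k where "k = (LEAST k. p k \<noteq> 0)"
    have k: "p k \<noteq> 0" "k \<le> i"
      using LeastI[of "\<lambda>k. p k \<noteq> 0" i] Least_le[of "\<lambda>k. p k \<noteq> 0" i] i by (auto simp: k_def)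
    have less: "p j = 0" if "j < k" for j
      using not_less_Least[of j "\<lambda>k. p k \<noteq> 0"] that by (auto simp: k_def)
    have val: "valuation P (ev (p j) z * t ^ j) = int j" "ev (p j) z * t ^ j \<noteq> 0" if "p j \<noteq> 0" for j
      using unit[OF that] t0 t1
      by (auto simp: valuation_mult[OF P] valuation_power[OF P] valuation_unit[OF P] place_unit_def)
    have "(\<Sum>j<n. ev (p j) z * t ^ j) \<noteq> 0"
    proof (rule sum_dominant_nonzero[OF P])
      show "k \<in> {..<n}" using k i by auto
      show "ev (p k) z * t ^ k \<noteq> 0" using val k by blast
      fix j assume "j \<in> {..<n} - {k}"
      then show "ev (p j) z * t ^ j \<in> val_ge P (valuation P (ev (p k) z * t ^ k) + 1)"
        using val[of k] val[of j] k less[of j]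
        by (cases "p j = 0"; cases "j < k") (auto simp: val_ge_iff)
    qed auto
    then show False using sum by simp
  qed
  obtain c where "\<And>(u :: nat \<Rightarrow> 'f) I. finite I \<Longrightarrow> poly_indep z u I \<Longrightarrow> card I \<le> c"
    using poly_indep_bound[where z = z] by blast
  then have "Suc c \<le> c"
    using indep[of "Suc c"] by (metis card_lessThan finite_lessThan)
  then show False by simp
qed

text \<open>By \<open>residue\<close> the element 1 represents a basis. The definite description
  also requires every other basis to have one element, which is why the second half starts from an
  arbitrary \<open>B\<close>.\<close>

lemma place_degree_eq_1:
  assumes P: "P \<in> places"
  shows "place_degree P = 1"
  unfolding place_degree_def
proof (rule the_equality)
  have ex1: "\<exists>!c. (\<forall>b. b \<notin> {1} \<longrightarrow> c b = 0) \<and> z - (\<Sum>b\<in>{1}. emb (c b) * b) \<in> P"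
    if z: "z \<in> place_ring P" for z
  proof -
    obtain a where a: "z - emb a \<in> P"
      using residue[OF P z] .
    have uniq: "a' = a" if "z - emb a' \<in> P" for a'
    proof -
      have "(z - emb a') + - (z - emb a) \<in> P"
        using that a by (intro place_add[OF P] place_minus[OF P])
      then have "emb (a - a') \<in> P"
        by (simp add: emb_diff)
      then show ?thesis
        by (simp add: emb_in_place_iff[OF P])
    qed
    show ?thesis
    proof (rule ex1I[of _ "\<lambda>b. if b = 1 then a else 0"])
      fix c assume "(\<forall>b. b \<notin> {1} \<longrightarrow> c b = 0) \<and> z - (\<Sum>b\<in>{1}. emb (c b) * b) \<in> P"
      then show "c = (\<lambda>b. if b = 1 then a else 0)"
        using uniq[of "c 1"] by (intro ext) simp
    qed (use a in simp)
  qed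
  show "\<exists>B. finite B \<and> card B = 1 \<and> B \<subseteq> place_ring P \<and>
      (\<forall>z\<in>place_ring P. \<exists>!c. (\<forall>b. b \<notin> B \<longrightarrow> c b = 0) \<and> z - (\<Sum>b\<in>B. emb (c b) * b) \<in> P)"
  proof (intro exI[of _ "{1}"] conjI ballI)
    show "{1} \<subseteq> place_ring P"
      using place_ring_1[OF P] by simp
  qed (simp, simp, rule ex1)
next
  fix n assume "\<exists>B. finite B \<and> card B = n \<and> B \<subseteq> place_ring P \<and>
      (\<forall>z\<in>place_ring P. \<exists>!c. (\<forall>b. b \<notin> B \<longrightarrow> c b = 0) \<and> z - (\<Sum>b\<in>B. emb (c b) * b) \<in> P)"
  then obtain B where B: "finite B" "card B = n" "B \<subseteq> place_ring P"
    and unique: "\<forall>z\<in>place_ring P.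
      \<exists>!c. (\<forall>b. b \<notin> B \<longrightarrow> c b = 0) \<and> z - (\<Sum>b\<in>B. emb (c b) * b) \<in> P"
    by (elim exE conjE) (rule that; assumption)
  have trivial: "c b = 0" if "\<And>b. b \<notin> B \<Longrightarrow> c b = 0" "(\<Sum>b\<in>B. emb (c b) * b) \<in> P" for c b
  proof -
    obtain d where d: "\<And>c. (\<forall>b. b \<notin> B \<longrightarrow> c b = 0) \<and> 0 - (\<Sum>b\<in>B. emb (c b) * b) \<in> P \<Longrightarrow> c = d"
      using bspec[OF unique place_ring_0[OF P]] by (elim ex1E) blast
    have "c = d"
      using that place_minus[OF P that(2)] by (intro d) simp
    moreover have "(\<lambda>_. 0) = d"
      using place_0[OF P] by (intro d) simp
    ultimately show ?thesis by metis
  qed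
  have nonzero: "b \<notin> P" if "b \<in> B" for b
  proof
    assume "b \<in> P"
    define c where "c = (\<lambda>b'. if b' = b then 1 else 0 :: 'k)"
    have "(\<Sum>b'\<in>B. emb (c b') * b') = (\<Sum>b'\<in>B. if b' = b then b' else 0)"
      by (intro sum.cong) (auto simp: c_def)
    then have sum: "(\<Sum>b'\<in>B. emb (c b') * b') \<in> P"
      using B(1) \<open>b \<in> B\<close> \<open>b \<in> P\<close> by simp
    have "c b = 0"
      by (rule trivial[of c b, OF _ sum]) (use \<open>b \<in> B\<close> in \<open>auto simp: c_def\<close>)
    then show False by (simp add: c_def)
  qed
  have "b = b'" if "b \<in> B" "b' \<in> B" for b b'
  proof (rule ccontr)
    assume "b \<noteq> b'"
    obtain a where a: "b - emb a \<in> P"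
      using residue[OF P] B(3) \<open>b \<in> B\<close> by blast
    obtain a' where a': "b' - emb a' \<in> P"
      using residue[OF P] B(3) \<open>b' \<in> B\<close> by blast
    \<comment> \<open>With residues \<open>a\<close> and \<open>a'\<close> of \<open>b\<close> and
      \<open>b'\<close>, the combination \<open>emb a' * b - emb a * b'\<close> vanishes modulo
      \<open>P\<close>; it is nontrivial because \<open>b'\<close> is not in
      \<open>P\<close>.\<close>
    define c where "c = (\<lambda>x. if x = b then a' else if x = b' then - a else 0)"
    have "(\<Sum>x\<in>B. emb (c x) * x) = (\<Sum>x\<in>{b, b'}. emb (c x) * x)"
      using B(1) \<open>b \<in> B\<close> \<open>b' \<in> B\<close> by (intro sum.mono_neutral_right) (auto simp: c_def)
    also have "\<dots> = emb a' * (b - emb a) + - (emb a * (b' - emb a'))"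
      using \<open>b \<noteq> b'\<close> by (simp add: c_def emb_minus algebra_simps)
    also have "\<dots> \<in> P"
      by (intro place_add[OF P] place_minus[OF P] place_mult[OF P] place_ring_emb[OF P] a a')
    finally have sum: "(\<Sum>x\<in>B. emb (c x) * x) \<in> P" .
    have "c b = 0"
      by (rule trivial[of c b, OF _ sum]) (use \<open>b \<in> B\<close> \<open>b' \<in> B\<close> in \<open>auto simp: c_def\<close>)
    then have "a' = 0" by (simp add: c_def)
    then show False
      using a' nonzero[OF \<open>b' \<in> B\<close>] by simp
  qed
  moreover have "B \<noteq> {}"
  proof
    assume "B = {}"
    then have "1 \<in> P"
      using bspec[OF unique place_ring_1[OF P]] by auto
    then show False
      using one_notin_place[OF P] by blast
  qed
  ultimately obtain b where "B = {b}" by blast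
  then show "n = 1"
    using B(2) by simp
qed

lemma exists_zero:
  assumes "z \<notin> range emb"
  shows "\<exists>P\<in>places. valuation P z > 0"
proof -
  have "z \<noteq> 0"
    using assms emb_0 by (metis rangeI)
  then show ?thesis
    using place_containing[OF assms ev_nonzero[OF assms]] valuation_ge_0_iff(2) by blast
qed

lemma inverse_notin_range:
  assumes "z \<notin> range emb"
  shows "inverse z \<notin> range emb"
proof
  assume "inverse z \<in> range emb"
  then obtain a where "inverse z = emb a" by auto
  then have "z = emb (inverse a)"
    by (simp add: emb_inverse flip: \<open>inverse z = emb a\<close>)
  then show False
    using assms by simp
qed

lemma exists_pole:
  assumes "z \<notin> range emb"
  shows "\<exists>P\<in>places. valuation P z < 0"
proof -
  have "z \<noteq> 0"
    using assms emb_0 by (metis rangeI)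
  then show ?thesis
    using exists_zero[OF inverse_notin_range[OF assms]] valuation_inverse by fastforce
qed

end

context function_field
begin

subsection \<open>Finite-dimensional subspaces\<close>

text \<open>\<open>dim\<close> is a cardinality in the natural numbers and is 0 when the bases are
  infinite, so monotonicity of \<open>dim\<close> has to be accompanied by this condition.\<close>

definition fin_dim :: "'f set \<Rightarrow> bool" where
  "fin_dim V \<longleftrightarrow> (\<exists>T. finite T \<and> V \<subseteq> span T)"

lemma fin_dim_subset: "fin_dim W \<Longrightarrow> V \<subseteq> W \<Longrightarrow> fin_dim V"
  by (auto simp: fin_dim_def)

lemma fin_dim_basis:
  assumes "fin_dim V"
  obtains B where "finite B" "B \<subseteq> V" "independent B" "V \<subseteq> span B" "card B = dim V"
proof -
  obtain T where T: "finite T" "V \<subseteq> span T"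
    using assms by (auto simp: fin_dim_def)
  obtain B where B: "B \<subseteq> V" "independent B" "V \<subseteq> span B" "card B = dim V"
    using basis_exists by blast
  then have "finite B"
    using independent_span_bound[OF T(1) B(2)] T(2) by blast
  then show thesis using B that by blast
qed

lemma dim_mono_fin_dim:
  assumes "fin_dim W" "V \<subseteq> W"
  shows "dim V \<le> dim W"
proof -
  obtain B where "finite B" "W \<subseteq> span B" "card B = dim W"
    using fin_dim_basis[OF assms(1)] by metis
  then show ?thesis
    using dim_le_card[of V B] assms(2) by auto
qed

lemma fin_dim_insert:
  assumes "fin_dim W" "V \<subseteq> span (insert u W)"
  shows "fin_dim V" "dim V \<le> dim W + 1"
proof -
  obtain B where B: "finite B" "W \<subseteq> span B" "card B = dim W"
    using fin_dim_basis[OF assms(1)] by metis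
  have "insert u W \<subseteq> span (insert u B)"
    using B(2) span_mono[of B "insert u B"] span_base[of u "insert u B"] by blast
  then have V: "V \<subseteq> span (insert u B)"
    using assms(2) span_minimal[OF _ subspace_span] by blast
  then show "fin_dim V"
    using B(1) by (auto simp: fin_dim_def)
  have "dim V \<le> card (insert u B)"
    using V B(1) by (intro dim_le_card) auto
  also have "\<dots> \<le> card B + 1"
    by (rule card_insert_le_m1) auto
  finally show "dim V \<le> dim W + 1"
    using B by simp
qed

lemma card_le_dim:
  assumes "fin_dim V" "finite I" "lin_indep_family f I" "f ` I \<subseteq> V"
  shows "card I \<le> dim V"
proof -
  obtain B where "finite B" "V \<subseteq> span B" "card B = dim V"
    using fin_dim_basis[OF assms(1)] by metis
  then show ?thesis
    using lin_indep_family_card_le[OF assms(2,3), of B] assms(4) by auto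
qed

lemma dim_strict_mono:
  assumes "fin_dim V" "subspace W" "W \<subseteq> V" "u \<in> V" "u \<notin> W"
  shows "dim W < dim V"
proof -
  obtain C where C: "finite C" "V \<subseteq> span C" "card C = dim V"
    using fin_dim_basis[OF assms(1)] by metis
  obtain B where B: "finite B" "B \<subseteq> W" "independent B" "W \<subseteq> span B" "card B = dim W"
    using fin_dim_basis[OF fin_dim_subset[OF assms(1,3)]] by metis
  have "span B \<subseteq> W"
    using span_minimal[OF B(2) assms(2)] .
  then have u: "u \<notin> span B"
    using assms(5) by blast
  then have "independent (insert u B)"
    using B(3) by (rule independent_insertI)
  moreover have "insert u B \<subseteq> span C"
    using B(2) assms C(2) by blast
  ultimately have "card (insert u B) \<le> card C"
    using independent_span_bound[OF C(1)] by blast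
  moreover have "u \<notin> B"
    using u span_base by blast
  ultimately show ?thesis
    using B(1,5) C(3) by simp
qed

lemma dim_mult_le:
  assumes "fin_dim V"
  shows "dim ((\<lambda>y. z * y) ` V) \<le> dim V"
proof -
  obtain B where B: "finite B" "V \<subseteq> span B" "card B = dim V"
    using fin_dim_basis[OF assms] by metis
  have "z * y \<in> span ((\<lambda>y. z * y) ` B)" if "y \<in> span B" for y
    using that
  proof (induction rule: span_induct_alt)
    case base
    then show ?case by (simp add: span_zero)
  next
    case (step c x y)
    have "z * x \<in> span ((\<lambda>y. z * y) ` B)"
      using step(1) by (intro span_base) auto
    then have "emb c * (z * x) + z * y \<in> span ((\<lambda>y. z * y) ` B)"
      using step by (intro span_add span_scale)
    then show ?case by (simp add: algebra_simps)
  qed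
  then have "dim ((\<lambda>y. z * y) ` V) \<le> card ((\<lambda>y. z * y) ` B)"
    using B by (intro dim_le_card) auto
  also have "\<dots> \<le> card B"
    using B(1) by (rule card_image_le)
  finally show ?thesis
    using B(3) by simp
qed

subsection \<open>Divisors\<close>

abbreviation lookup :: "('f set \<Rightarrow>\<^sub>0 int) \<Rightarrow> 'f set \<Rightarrow> int" where
  "lookup \<equiv> Poly_Mapping.lookup"

lemma riemann_roch_space_iff:
  "z \<in> riemann_roch_space D \<longleftrightarrow> (\<forall>P\<in>places. z \<in> val_ge P (- lookup D P))"
  by (auto simp: riemann_roch_space_def val_ge_def)

lemma riemann_roch_space_mono:
  "(\<And>P. P \<in> places \<Longrightarrow> lookup D P \<le> lookup A P) \<Longrightarrow>
    riemann_roch_space D \<subseteq> riemann_roch_space A"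
  by (fastforce simp: riemann_roch_space_iff val_ge_def)

lemma subspace_riemann_roch_space: "subspace (riemann_roch_space D)"
  by (auto simp: subspace_def riemann_roch_space_iff val_ge_add val_ge_emb)

lemma divisors_0: "0 \<in> divisors"
  and divisors_add: "D \<in> divisors \<Longrightarrow> D' \<in> divisors \<Longrightarrow> D + D' \<in> divisors"
  and divisors_diff: "D \<in> divisors \<Longrightarrow> D' \<in> divisors \<Longrightarrow> D - D' \<in> divisors"
  and divisors_frag_of: "P \<in> places \<Longrightarrow> frag_of P \<in> divisors"
  and divisors_cmul: "D \<in> divisors \<Longrightarrow> frag_cmul k D \<in> divisors"
  using keys_add[of D D'] keys_diff[of D D'] keys_cmul[of k D]
  by (auto simp: divisors_def keys_frag_of)

lemma lookup_outside: "D \<in> divisors \<Longrightarrow> P \<notin> places \<Longrightarrow> lookup D P = 0"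
  by (auto simp: divisors_def in_keys_iff)

text \<open>\<open>Abs_poly_mapping\<close> is meaningful only for functions of finite support, so
  each use comes with a finiteness proof.\<close>

definition divisor_of :: "('f set \<Rightarrow> int) \<Rightarrow> 'f set \<Rightarrow>\<^sub>0 int" where
  "divisor_of f = Abs_poly_mapping (\<lambda>P. if P \<in> places then f P else 0)"

lemma divisor_of:
  assumes "finite {P \<in> places. f P \<noteq> 0}"
  shows lookup_divisor_of: "lookup (divisor_of f) P = (if P \<in> places then f P else 0)"
    and divisor_of_in_divisors: "divisor_of f \<in> divisors"
proof -
  have "{P. (if P \<in> places then f P else 0) \<noteq> 0} = {P \<in> places. f P \<noteq> 0}" by auto
  then show lookup: "lookup (divisor_of f) P = (if P \<in> places then f P else 0)" for P
    using assms by (simp add: divisor_of_def lookup_Abs_poly_mapping)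
  show "divisor_of f \<in> divisors"
    by (auto simp: divisors_def in_keys_iff lookup split: if_splits)
qed

end

context alg_closed_function_field
begin

section \<open>Degrees of divisors and dimensions of Riemann-Roch spaces\<close>

lemma divisor_degree_eq:
  assumes "D \<in> divisors" "finite A" "Poly_Mapping.keys D \<subseteq> A"
  shows "divisor_degree D = (\<Sum>P\<in>A. lookup D P)"
proof -
  have "divisor_degree D = (\<Sum>P\<in>Poly_Mapping.keys D. lookup D P)"
    unfolding divisor_degree_def using assms(1)
    by (intro sum.cong) (auto simp: divisors_def place_degree_eq_1)
  also have "\<dots> = (\<Sum>P\<in>A. lookup D P)"
    using assms by (intro sum.mono_neutral_left) (auto simp: in_keys_iff)
  finally show ?thesis .
qed

lemma divisor_degree_0 [simp]: "divisor_degree 0 = 0"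
  by (simp add: divisor_degree_def)

lemma divisor_degree_add:
  assumes "D \<in> divisors" "D' \<in> divisors"
  shows "divisor_degree (D + D') = divisor_degree D + divisor_degree D'"
proof -
  define A where "A = Poly_Mapping.keys D \<union> Poly_Mapping.keys D'"
  have "finite A" "Poly_Mapping.keys (D + D') \<subseteq> A"
    using keys_add[of D D'] by (auto simp: A_def)
  then show ?thesis
    using assms divisors_add[OF assms]
    by (simp add: divisor_degree_eq[of _ A] A_def lookup_add sum.distrib)
qed

lemma divisor_degree_cmul:
  assumes "D \<in> divisors"
  shows "divisor_degree (frag_cmul k D) = k * divisor_degree D"
  using assms divisors_cmul[OF assms] keys_cmul[of k D]
  by (simp add: divisor_degree_eq[of _ "Poly_Mapping.keys D"] sum_distrib_left)

lemma divisor_degree_diff: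
  assumes "D \<in> divisors" "D' \<in> divisors"
  shows "divisor_degree (D - D') = divisor_degree D - divisor_degree D'"
  using divisor_degree_add[OF divisors_diff[OF assms] assms(2)] by simp

lemma divisor_degree_frag_of:
  assumes "P \<in> places"
  shows "divisor_degree (frag_of P) = 1"
  using divisor_degree_eq[OF divisors_frag_of[OF assms], of "{P}"] by (simp add: keys_frag_of)

lemma divisor_degree_mono:
  assumes "D \<in> divisors" "D' \<in> divisors" "\<And>P. P \<in> places \<Longrightarrow> lookup D P \<le> lookup D' P"
  shows "divisor_degree D \<le> divisor_degree D'"
proof -
  define A where "A = Poly_Mapping.keys D \<union> Poly_Mapping.keys D'"
  have "P \<in> places" if "P \<in> A" for P
    using assms(1,2) that by (auto simp: divisors_def A_def)
  then have "(\<Sum>P\<in>A. lookup D P) \<le> (\<Sum>P\<in>A. lookup D' P)"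
    using assms(3) by (intro sum_mono) auto
  then show ?thesis
    using assms(1,2) by (simp add: divisor_degree_eq[of _ A] A_def)
qed

lemma divisor_degree_divisor_of:
  assumes "finite {P \<in> places. f P \<noteq> 0}"
  shows "divisor_degree (divisor_of f) = (\<Sum>P | P \<in> places \<and> f P \<noteq> 0. f P)"
proof -
  have "divisor_degree (divisor_of f) = (\<Sum>P | P \<in> places \<and> f P \<noteq> 0. lookup (divisor_of f) P)"
    using assms divisor_of_in_divisors[OF assms]
    by (intro divisor_degree_eq) (auto simp: in_keys_iff lookup_divisor_of[OF assms] split: if_splits)
  also have "\<dots> = (\<Sum>P | P \<in> places \<and> f P \<noteq> 0. f P)"
    by (intro sum.cong) (auto simp: lookup_divisor_of[OF assms])
  finally show ?thesis .
qed

text \<open>Pick \<open>u\<close> with the one additional pole order at \<open>P\<close>. For any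
  other \<open>y\<close> the quotient \<open>y / u\<close> is regular at \<open>P\<close> and has a
  constant residue \<open>a\<close>; subtracting \<open>emb a * u\<close> brings \<open>y\<close>
  back into the smaller space.\<close>

lemma riemann_roch_space_step:
  assumes "P \<in> places"
  shows "\<exists>u. riemann_roch_space (D + frag_of P) \<subseteq> span (insert u (riemann_roch_space D))"
proof (cases "riemann_roch_space (D + frag_of P) \<subseteq> riemann_roch_space D")
  case True
  then show ?thesis
    using span_superset[of "insert 0 (riemann_roch_space D)"] by blast
next
  case False
  note P = assms
  have val_other: "y \<in> val_ge Q (- lookup D Q)"
    if "y \<in> riemann_roch_space (D + frag_of P)" "Q \<in> places" "Q \<noteq> P" for y Q
  proof -
    have "y \<in> val_ge Q (- lookup (D + frag_of P) Q)"
      using that(1,2) unfolding riemann_roch_space_iff by blast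
    then show ?thesis
      using that(3) by (simp add: lookup_add)
  qed
  have val_P: "y \<in> val_ge P (- lookup D P - 1)" if "y \<in> riemann_roch_space (D + frag_of P)" for y
  proof -
    have "y \<in> val_ge P (- lookup (D + frag_of P) P)"
      using that P unfolding riemann_roch_space_iff by blast
    then show ?thesis by (simp add: lookup_add)
  qed
  obtain u where u: "u \<in> riemann_roch_space (D + frag_of P)" "u \<notin> riemann_roch_space D"
    using False by blast
  then have u_val: "u \<notin> val_ge P (- lookup D P)"
    using val_other[OF u(1)] by (auto simp: riemann_roch_space_iff)
  then have "u \<noteq> 0" by auto
  then have v: "valuation P u = - lookup D P - 1"
    using u_val val_P[OF u(1)] by (simp add: valuation_eq_iff)
  have "y \<in> span (insert u (riemann_roch_space D))"
    if y: "y \<in> riemann_roch_space (D + frag_of P)" for y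
  proof -
    have "(y / u) * u \<in> val_ge P (- lookup D P - 1)"
      using val_P[OF y] \<open>u \<noteq> 0\<close> by simp
    then have "y / u \<in> place_ring P"
      unfolding val_ge_mult_iff[OF P \<open>u \<noteq> 0\<close>] by (simp add: v val_ge_0_eq[OF P])
    then obtain a where "y / u - emb a \<in> P"
      using residue[OF P] by blast
    then have "(y / u - emb a) * u \<in> val_ge P (- lookup D P)"
      unfolding val_ge_mult_iff[OF P \<open>u \<noteq> 0\<close>] by (simp add: v val_ge_1_eq[OF P])
    moreover have eq: "(y / u - emb a) * u = y - emb a * u"
      using \<open>u \<noteq> 0\<close> by (simp add: algebra_simps)
    ultimately have "y - emb a * u \<in> val_ge P (- lookup D P)" by simp
    moreover have "y - emb a * u \<in> riemann_roch_space (D + frag_of P)"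
      using subspace_riemann_roch_space y u(1) by (intro subspace_diff subspace_scale)
    ultimately have "y - emb a * u \<in> riemann_roch_space D"
      using val_other by (auto simp: riemann_roch_space_iff)
    then have "(y - emb a * u) + emb a * u \<in> span (insert u (riemann_roch_space D))"
      by (intro span_add span_scale span_base) auto
    then show ?thesis by simp
  qed
  then show ?thesis by blast
qed

text \<open>Climb from \<open>D\<close> to \<open>A\<close> one place at a time; each place has
  degree 1 and adds at most one dimension. Finite dimension is carried along because the dimension
  bound depends on it.\<close>

lemma riemann_roch_space_le:
  assumes "D \<in> divisors" "A \<in> divisors" "\<And>P. P \<in> places \<Longrightarrow> lookup D P \<le> lookup A P"
    and "fin_dim (riemann_roch_space D)"
  shows "fin_dim (riemann_roch_space A) \<and> int (ell A) \<le> int (ell D) + divisor_degree A - divisor_degree D"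
  using assms
proof (induction "nat (divisor_degree A - divisor_degree D)" arbitrary: D rule: less_induct)
  case (less D)
  show ?case
  proof (cases "D = A")
    case False
    have "\<exists>P. lookup D P \<noteq> lookup A P"
      using False by (auto intro: poly_mapping_eqI)
    then obtain P where P: "lookup D P \<noteq> lookup A P" by blast
    then have "P \<in> places"
      using lookup_outside less.prems(1,2) by metis
    then have P_less: "lookup D P < lookup A P"
      using P less.prems(3) by force
    define D' where "D' = D + frag_of P"
    have D': "D' \<in> divisors"
      using less.prems(1) \<open>P \<in> places\<close> by (simp add: D'_def divisors_add divisors_frag_of)
    have le: "lookup D' Q \<le> lookup A Q" if "Q \<in> places" for Q
      using less.prems(3)[OF that] P_less by (auto simp: D'_def lookup_add)
    have deg: "divisor_degree D' = divisor_degree D + 1"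
      using less.prems(1) \<open>P \<in> places\<close>
      by (simp add: D'_def divisor_degree_add divisor_degree_frag_of divisors_frag_of)
    moreover have "divisor_degree D' \<le> divisor_degree A"
      using divisor_degree_mono[OF D' less.prems(2) le] .
    ultimately have smaller: "nat (divisor_degree A - divisor_degree D') < nat (divisor_degree A - divisor_degree D)"
      by linarith
    obtain u where "riemann_roch_space D' \<subseteq> span (insert u (riemann_roch_space D))"
      using riemann_roch_space_step[OF \<open>P \<in> places\<close>] unfolding D'_def by blast
    then have "fin_dim (riemann_roch_space D')" "ell D' \<le> ell D + 1"
      using fin_dim_insert[OF less.prems(4)] by (auto simp: ell_def)
    then show ?thesis
      using less.hyps[OF smaller D' less.prems(2) le] deg by linarith
  qed (use less.prems in simp)
qed

lemma riemann_roch_space_0: "riemann_roch_space 0 = range emb"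
proof
  show "range emb \<subseteq> riemann_roch_space 0"
    by (auto simp: riemann_roch_space_iff val_ge_0_eq place_ring_emb)
  show "riemann_roch_space 0 \<subseteq> range emb"
  proof
    fix z assume z: "z \<in> riemann_roch_space 0"
    show "z \<in> range emb"
    proof (rule ccontr)
      assume "z \<notin> range emb"
      then obtain P where "P \<in> places" "valuation P z < 0"
        using exists_pole by blast
      moreover from this have "z \<in> val_ge P 0"
        using z by (auto simp: riemann_roch_space_iff)
      moreover have "z \<noteq> 0"
        using \<open>z \<notin> range emb\<close> emb_0 by (metis rangeI)
      ultimately show False
        by (simp add: val_ge_iff)
    qed
  qed
qed

lemma range_emb_eq_span: "range emb = span {1}"
  by (auto simp: span_singleton)

lemma fin_dim_riemann_roch_space_0: "fin_dim (riemann_roch_space 0)"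
  unfolding riemann_roch_space_0 range_emb_eq_span fin_dim_def by blast

lemma ell_0: "ell 0 = 1"
proof -
  have "independent {1}"
    by (intro independent_insertI independent_empty) simp
  then show ?thesis
    unfolding ell_def riemann_roch_space_0 range_emb_eq_span
    using dim_span_eq_card_independent by fastforce
qed

definition positive_part :: "('f set \<Rightarrow>\<^sub>0 int) \<Rightarrow> ('f set \<Rightarrow>\<^sub>0 int)" where
  "positive_part D = divisor_of (\<lambda>P. max 0 (lookup D P))"

lemma positive_part:
  assumes "D \<in> divisors"
  shows "positive_part D \<in> divisors" "P \<in> places \<Longrightarrow> lookup (positive_part D) P = max 0 (lookup D P)"
proof -
  have "finite {P \<in> places. max 0 (lookup D P) \<noteq> 0}"
    by (rule finite_subset[OF _ finite_keys[of D]]) (auto simp: in_keys_iff)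
  then show "positive_part D \<in> divisors" "P \<in> places \<Longrightarrow> lookup (positive_part D) P = max 0 (lookup D P)"
    by (auto simp: positive_part_def divisor_of)
qed

lemma effective_bound:
  assumes "A \<in> divisors" "\<And>P. P \<in> places \<Longrightarrow> 0 \<le> lookup A P"
  shows "fin_dim (riemann_roch_space A)" "int (ell A) \<le> divisor_degree A + 1"
  using riemann_roch_space_le[OF divisors_0 assms(1) _ fin_dim_riemann_roch_space_0] assms(2)
  by (auto simp: ell_0)

lemma fin_dim_riemann_roch_space:
  assumes "D \<in> divisors"
  shows "fin_dim (riemann_roch_space D)"
  using positive_part[OF assms] effective_bound(1)[of "positive_part D"]
    riemann_roch_space_mono[of D "positive_part D"] fin_dim_subset
  by auto

lemma ell_le:
  assumes "D \<in> divisors" "A \<in> divisors" "\<And>P. P \<in> places \<Longrightarrow> lookup D P \<le> lookup A P"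
  shows "int (ell A) \<le> int (ell D) + divisor_degree A - divisor_degree D"
  using riemann_roch_space_le[OF assms fin_dim_riemann_roch_space[OF assms(1)]] by blast

lemma ell_strict_mono:
  assumes "A \<in> divisors" "\<And>P. P \<in> places \<Longrightarrow> lookup D P \<le> lookup A P"
    and "f \<in> riemann_roch_space A" "f \<notin> riemann_roch_space D"
  shows "ell D < ell A"
  unfolding ell_def using assms
  by (intro dim_strict_mono[of _ _ f] fin_dim_riemann_roch_space riemann_roch_space_mono
      subspace_riemann_roch_space)

lemma ell_pos_obtain:
  assumes "0 < ell D"
  obtains f where "f \<noteq> 0" "f \<in> riemann_roch_space D"
proof (rule ccontr)
  assume "\<not> thesis"
  then have "riemann_roch_space D \<subseteq> span {}"
    using that by (auto simp: span_empty)
  then have "ell D \<le> card ({} :: 'f set)"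
    unfolding ell_def by (rule dim_le_card) simp
  then show False
    using assms by simp
qed

lemma mult_riemann_roch_space_iff:
  assumes "z \<noteq> 0" "\<And>P. P \<in> places \<Longrightarrow> lookup D' P = lookup D P - valuation P z"
  shows "w * z \<in> riemann_roch_space D' \<longleftrightarrow> w \<in> riemann_roch_space D"
  unfolding riemann_roch_space_iff using assms by (auto simp: val_ge_mult_iff)

lemma ell_equivalent:
  assumes "D \<in> divisors" "D' \<in> divisors" "z \<noteq> 0"
    and "\<And>P. P \<in> places \<Longrightarrow> lookup D' P = lookup D P - valuation P z"
  shows "ell D' = ell D"
proof -
  have le: "ell D' \<le> ell D"
    if "D \<in> divisors" "z \<noteq> 0" "\<And>P. P \<in> places \<Longrightarrow> lookup D' P = lookup D P - valuation P z"
    for D D' z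
  proof -
    have "riemann_roch_space D' \<subseteq> (\<lambda>y. z * y) ` riemann_roch_space D"
    proof
      fix y assume "y \<in> riemann_roch_space D'"
      then have "y / z \<in> riemann_roch_space D"
        using mult_riemann_roch_space_iff[OF that(2,3), of "y / z"] that(2) by simp
      then show "y \<in> (\<lambda>y. z * y) ` riemann_roch_space D"
        using that(2) by (intro image_eqI[of _ _ "y / z"]) auto
    qed
    moreover have "(\<lambda>y. z * y) ` riemann_roch_space D \<subseteq> riemann_roch_space D'"
      using mult_riemann_roch_space_iff[OF that(2,3)] by (auto simp: mult.commute)
    ultimately have "riemann_roch_space D' = (\<lambda>y. z * y) ` riemann_roch_space D" by blast
    then show ?thesis
      unfolding ell_def using dim_mult_le[OF fin_dim_riemann_roch_space[OF that(1)]] by simp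
  qed
  show ?thesis
    using le[of D z D'] le[of D' "inverse z" D] assms by (auto simp: valuation_inverse intro!: antisym)
qed

subsection \<open>Principal divisors have degree zero\<close>

text \<open>The pole divisor; the zero divisor of \<open>z\<close> appears as
  \<open>poles (inverse z)\<close>.\<close>

definition poles :: "'f \<Rightarrow> ('f set \<Rightarrow>\<^sub>0 int)" where
  "poles z = divisor_of (\<lambda>P. max 0 (- valuation P z))"

lemma poles:
  assumes "z \<noteq> 0"
  shows poles_in_divisors: "poles z \<in> divisors"
    and lookup_poles: "P \<in> places \<Longrightarrow> lookup (poles z) P = max 0 (- valuation P z)"
proof -
  have "finite {P \<in> places. max 0 (- valuation P z) \<noteq> 0}"
    by (rule finite_subset[OF _ finite_valuation_support[OF assms]]) auto
  then show "poles z \<in> divisors" "P \<in> places \<Longrightarrow> lookup (poles z) P = max 0 (- valuation P z)"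
    by (auto simp: poles_def divisor_of)
qed

lemma poly_indep_nonzero:
  assumes "poly_indep z u I" "finite I" "i \<in> I"
  shows "u i \<noteq> 0"
proof
  assume "u i = 0"
  define p where "p = (\<lambda>j. if j = i then 1 else 0 :: 'k poly)"
  have "(\<Sum>j\<in>I. ev (p j) z * u j) = 0"
    using \<open>u i = 0\<close> by (intro sum.neutral) (auto simp: p_def)
  then have "p i = 0"
    using assms unfolding poly_indep_def by blast
  then show False by (simp add: p_def)
qed

text \<open>\<open>C\<close> collects the poles of all the \<open>u i\<close>, so that
  \<open>z ^ k * u i\<close> has poles bounded by \<open>L\<close> times those of \<open>z\<close>
  plus \<open>C\<close> for all \<open>k \<le> L\<close>. That \<open>C\<close> does not depend on
  \<open>L\<close> is what later makes it negligible.\<close>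

lemma poly_indep_ell:
  assumes "z \<noteq> 0" "finite I" "poly_indep z u I"
  obtains C where "C \<in> divisors" "\<And>P. P \<in> places \<Longrightarrow> 0 \<le> lookup C P"
    "\<And>L. card I * (L + 1) \<le> ell (frag_cmul (int L) (poles z) + C)"
proof -
  note u = poly_indep_nonzero[OF assms(3,2)]
  define C where "C = (\<Sum>i\<in>I. poles (u i))"
  have C: "C \<in> divisors"
    unfolding C_def using assms(2) u
    by (induction I rule: infinite_finite_induct) (auto intro: divisors_0 divisors_add poles_in_divisors)
  have lookup_C: "lookup C P = (\<Sum>i\<in>I. max 0 (- valuation P (u i)))" if "P \<in> places" for P
    unfolding C_def lookup_sum using u that by (intro sum.cong) (auto simp: lookup_poles)
  have C_nonneg: "0 \<le> lookup C P" if "P \<in> places" for P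
    using lookup_C[OF that] by (simp add: sum_nonneg)
  have C_ge: "- valuation P (u i) \<le> lookup C P" if "i \<in> I" "P \<in> places" for i P
  proof -
    have "max 0 (- valuation P (u i)) \<le> lookup C P"
      unfolding lookup_C[OF that(2)] using assms(2) that(1)
      by (intro member_le_sum[of i I "\<lambda>i. max 0 (- valuation P (u i))"]) auto
    then show ?thesis by linarith
  qed
  have bound: "card I * (L + 1) \<le> ell (frag_cmul (int L) (poles z) + C)" for L
  proof -
    define D where "D = frag_cmul (int L) (poles z) + C"
    have D: "D \<in> divisors"
      using C poles_in_divisors[OF assms(1)] by (simp add: D_def divisors_add divisors_cmul)
    have mem: "z ^ k * u i \<in> riemann_roch_space D" if ki: "i \<in> I" "k \<le> L" for i k
      unfolding riemann_roch_space_iff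
    proof
      fix P assume P: "P \<in> places"
      have "int k * - valuation P z \<le> int k * max 0 (- valuation P z)"
        by (intro mult_left_mono) auto
      also have "\<dots> \<le> int L * max 0 (- valuation P z)"
        using ki by (intro mult_right_mono) auto
      finally have "- (int L * max 0 (- valuation P z)) \<le> int k * valuation P z" by simp
      then show "z ^ k * u i \<in> val_ge P (- lookup D P)"
        using C_ge[OF ki(1) P] u[OF ki(1)] assms(1) P
        by (simp add: val_ge_iff valuation_mult valuation_power D_def lookup_add lookup_poles)
    qed
    have "card (I \<times> {..<Suc L}) \<le> dim (riemann_roch_space D)"
    proof (rule card_le_dim[OF fin_dim_riemann_roch_space[OF D]])
      show "(\<lambda>(i, k). z ^ k * u i) ` (I \<times> {..<Suc L}) \<subseteq> riemann_roch_space D"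
        using mem by (auto simp: less_Suc_eq_le)
    qed (use assms lin_indep_family_powers in auto)
    then show ?thesis
      by (simp add: D_def ell_def card_cartesian_product)
  qed
  show thesis
    using that[OF C C_nonneg bound] .
qed

lemma zeros_poly_indep_card:
  assumes "z \<noteq> 0"
  obtains u :: "'f set \<times> nat \<Rightarrow> 'f" and I where "finite I" "poly_indep z u I"
    "int (card I) = divisor_degree (poles (inverse z))"
proof -
  define S where "S = {P \<in> places. valuation P z > 0}"
  define I where "I = (SIGMA P:S. {..<nat (valuation P z)})"
  have S: "finite S"
    using finite_zeros[OF assms] by (simp add: S_def)
  have "\<exists>u. poly_indep z u I"
    unfolding I_def using S assms by (intro zeros_poly_indep) (auto simp: S_def)
  then obtain u where u: "poly_indep z u I" by blast
  have fin: "finite {P \<in> places. max 0 (- valuation P (inverse z)) \<noteq> 0}"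
    by (rule finite_subset[OF _ finite_valuation_support[OF assms]]) (auto simp: valuation_inverse assms)
  have "divisor_degree (poles (inverse z)) =
      (\<Sum>P | P \<in> places \<and> max 0 (- valuation P (inverse z)) \<noteq> 0. max 0 (- valuation P (inverse z)))"
    unfolding poles_def by (rule divisor_degree_divisor_of[OF fin])
  also have "\<dots> = (\<Sum>P\<in>S. valuation P z)"
    using assms by (intro sum.cong) (auto simp: S_def valuation_inverse max_def split: if_splits)
  also have "\<dots> = int (card I)"
    using S by (simp add: I_def card_SigmaI S_def)
  finally show thesis
    using that[of I u] S u by (auto simp: I_def)
qed

text \<open>The spaces of \<open>L\<close> times the pole divisor plus \<open>C\<close> have
  dimension at least the number of zeros times \<open>L + 1\<close>, but at most their degree plus
  one. Both bounds are linear in \<open>L\<close>, so their slopes compare. This replaces the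
  identification of both degrees with the degree of F over K(z).\<close>

lemma degree_zeros_le_degree_poles:
  assumes "z \<noteq> 0"
  shows "divisor_degree (poles (inverse z)) \<le> divisor_degree (poles z)"
proof -
  obtain u :: "'f set \<times> nat \<Rightarrow> 'f" and I where I: "finite I" "poly_indep z u I"
    "int (card I) = divisor_degree (poles (inverse z))"
    using zeros_poly_indep_card[OF assms] .
  obtain C where C: "C \<in> divisors" "\<And>P. P \<in> places \<Longrightarrow> 0 \<le> lookup C P"
    "\<And>L. card I * (L + 1) \<le> ell (frag_cmul (int L) (poles z) + C)"
    using poly_indep_ell[OF assms I(1,2)] by blast
  have "int (card I) * (int L + 1) \<le> int L * divisor_degree (poles z) + (divisor_degree C + 1)" for L
  proof -
    define D where "D = frag_cmul (int L) (poles z) + C"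
    have D: "D \<in> divisors"
      using C poles_in_divisors[OF assms(1)] by (simp add: D_def divisors_add divisors_cmul)
    have "int (card I * (L + 1)) \<le> int (ell D)"
      using C(3)[of L] unfolding D_def by (simp only: of_nat_le_iff)
    also have "\<dots> \<le> divisor_degree D + 1"
      using D C(2) assms by (intro effective_bound) (auto simp: D_def lookup_add lookup_poles)
    also have "divisor_degree D = int L * divisor_degree (poles z) + divisor_degree C"
      using C(1) poles_in_divisors[OF assms(1)]
      by (simp add: D_def divisor_degree_add divisor_degree_cmul divisors_cmul)
    finally show ?thesis
      by (simp add: algebra_simps)
  qed
  then show ?thesis
    unfolding I(3)[symmetric] by (rule linear_growth)
qed

lemma degree_zeros_eq_degree_poles:
  assumes "z \<noteq> 0"
  shows "divisor_degree (poles (inverse z)) = divisor_degree (poles z)"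
  using degree_zeros_le_degree_poles[of z] degree_zeros_le_degree_poles[of "inverse z"] assms by simp

definition principal :: "'f \<Rightarrow> ('f set \<Rightarrow>\<^sub>0 int)" where
  "principal z = divisor_of (\<lambda>P. valuation P z)"

lemma principal:
  assumes "z \<noteq> 0"
  shows principal_in_divisors: "principal z \<in> divisors"
    and lookup_principal: "P \<in> places \<Longrightarrow> lookup (principal z) P = valuation P z"
  using divisor_of[OF finite_valuation_support[OF assms]] by (auto simp: principal_def)

lemma divisor_degree_principal:
  assumes "z \<noteq> 0"
  shows "divisor_degree (principal z) = 0"
proof -
  have "principal z = poles (inverse z) - poles z"
  proof (rule poly_mapping_eqI)
    fix P
    show "lookup (principal z) P = lookup (poles (inverse z) - poles z) P"
      using principal[OF assms] poles[OF assms] poles[of "inverse z"] assms lookup_outside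
      by (cases "P \<in> places") (auto simp: lookup_minus valuation_inverse)
  qed
  then show ?thesis
    using degree_zeros_eq_degree_poles[OF assms] poles_in_divisors assms
    by (simp add: divisor_degree_diff)
qed

subsection \<open>Riemann's inequality\<close>

lemma exists_nonconstant: "\<exists>x. x \<notin> range emb"
proof -
  obtain x where "transcendental_over emb x"
    using finite_over_rational by blast
  then have "ev [:- a, 1:] x \<noteq> 0" for a
    unfolding transcendental_over_iff by (metis pCons_eq_0_iff one_neq_zero)
  then have "x \<noteq> emb a" for a
    by (metis emb_minus ev_0 ev_1 ev_pCons add.left_inverse mult.right_neutral one_pCons)
  then show ?thesis by blast
qed

text \<open>By \<open>ell_le\<close> the defect \<open>divisor_degree D - int (ell D)\<close> can
  only grow with \<open>D\<close>. It is bounded along the multiples of one pole divisor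
  \<open>p\<close>, and every \<open>D\<close> lies below an effective divisor that is equivalent to
  one below such a multiple.\<close>

lemma riemann_bound: "\<exists>\<gamma>. \<forall>D\<in>divisors. divisor_degree D - int (ell D) \<le> \<gamma>"
proof -
  obtain z where nonconst: "z \<notin> range emb"
    using exists_nonconstant by blast
  then have z: "z \<noteq> 0"
    using emb_0 by (metis rangeI)
  define p where "p = poles z"
  define n where "n = divisor_degree p"
  have p: "p \<in> divisors" "\<And>P. P \<in> places \<Longrightarrow> 0 \<le> lookup p P"
    using poles[OF z] by (auto simp: p_def)
  obtain u :: "'f set \<times> nat \<Rightarrow> 'f" and I where I: "finite I" "poly_indep z u I" "int (card I) = n"
    using zeros_poly_indep_card[OF z] degree_zeros_eq_degree_poles[OF z] unfolding n_def p_def by metis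
  obtain C where C: "C \<in> divisors" "\<And>P. P \<in> places \<Longrightarrow> 0 \<le> lookup C P"
    "\<And>L. card I * (L + 1) \<le> ell (frag_cmul (int L) p + C)"
    using poly_indep_ell[OF z I(1,2)] unfolding p_def by blast
  define c where "c = divisor_degree C"
  have n: "n \<ge> 1"
  proof -
    obtain P where P: "P \<in> places" "valuation P z < 0"
      using exists_pole[OF nonconst] by blast
    have "divisor_degree (frag_of P) \<le> n"
      unfolding n_def using P z p
      by (intro divisor_degree_mono) (auto simp: divisors_frag_of p_def lookup_poles)
    then show ?thesis
      using divisor_degree_frag_of[OF P(1)] by simp
  qed
  have ell_p: "n * (int L + 1) - c \<le> int (ell (frag_cmul (int L) p))" for L
  proof -
    have "int (ell (frag_cmul (int L) p + C)) \<le> int (ell (frag_cmul (int L) p)) +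
        divisor_degree (frag_cmul (int L) p + C) - divisor_degree (frag_cmul (int L) p)"
      using p C by (intro ell_le) (auto simp: divisors_add divisors_cmul lookup_add)
    also have "\<dots> = int (ell (frag_cmul (int L) p)) + c"
      using p C by (simp add: divisor_degree_add divisors_cmul c_def)
    finally have "int (card I * (L + 1)) \<le> int (ell (frag_cmul (int L) p)) + c"
      using C(3)[of L] by linarith
    then show ?thesis
      by (simp add: I(3)[symmetric] algebra_simps)
  qed
  have "divisor_degree D - int (ell D) \<le> c - n" if D: "D \<in> divisors" for D
  proof -
    define A where "A = positive_part D"
    have A: "A \<in> divisors" "\<And>P. P \<in> places \<Longrightarrow> 0 \<le> lookup A P"
        "\<And>P. P \<in> places \<Longrightarrow> lookup D P \<le> lookup A P"
      by (simp_all add: A_def positive_part[OF D])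
    \<comment> \<open>Passing from \<open>B\<close> to \<open>B - A\<close> loses at most
      \<open>divisor_degree A\<close> dimensions; this \<open>L\<close> leaves at least one.\<close>
    define L where "L = nat (c + divisor_degree A + 1)"
    define B where "B = frag_cmul (int L) p"
    have B: "B \<in> divisors"
      using p by (simp add: B_def divisors_cmul)
    have "int (ell B) \<le> int (ell (B - A)) + divisor_degree B - divisor_degree (B - A)"
      using A B by (intro ell_le) (auto simp: divisors_diff lookup_minus)
    then have "int (ell B) \<le> int (ell (B - A)) + divisor_degree A"
      using A B by (simp add: divisor_degree_diff)
    moreover have "int L * 1 \<le> int L * n"
      using n by (intro mult_left_mono) auto
    moreover have ell_B: "n + int L * n - c \<le> int (ell B)"
      using ell_p[of L] by (simp add: B_def algebra_simps)
    moreover have "c + divisor_degree A + 1 \<le> int L"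
      by (simp add: L_def)
    ultimately have "0 < ell (B - A)"
      using n by linarith
    then obtain f where f: "f \<noteq> 0" "f \<in> riemann_roch_space (B - A)"
      using ell_pos_obtain by blast
    \<comment> \<open>A divisor equivalent to \<open>A\<close> that lies below \<open>B\<close>:
      same degree and same dimension as \<open>A\<close>, so the bound for \<open>B\<close> carries
      over.\<close>
    define A' where "A' = A - principal f"
    have A': "A' \<in> divisors"
      using A principal_in_divisors[OF f(1)] by (simp add: A'_def divisors_diff)
    have "lookup A' P \<le> lookup B P" if P: "P \<in> places" for P
    proof -
      have "f \<in> val_ge P (- lookup (B - A) P)"
        using f(2) P unfolding riemann_roch_space_iff by blast
      then show ?thesis
        using f(1) P by (simp add: val_ge_iff A'_def lookup_minus lookup_principal)
    qed
    then have "int (ell B) \<le> int (ell A') + divisor_degree B - divisor_degree A'"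
      using A' B by (intro ell_le)
    moreover have "ell A' = ell A"
      using A A' f(1) by (intro ell_equivalent[of _ _ f]) (auto simp: A'_def lookup_minus lookup_principal)
    moreover have "divisor_degree A' = divisor_degree A"
      using A f(1) by (simp add: A'_def divisor_degree_diff principal_in_divisors divisor_degree_principal)
    moreover have "int (ell A) \<le> int (ell D) + divisor_degree A - divisor_degree D"
      using A D by (intro ell_le)
    moreover have "divisor_degree B = int L * n"
      using p by (simp add: B_def divisor_degree_cmul n_def)
    ultimately show ?thesis
      using ell_B by linarith
  qed
  then show ?thesis by blast
qed

lemma riemann_inequality:
  assumes "D \<in> divisors"
  shows "divisor_degree D + 1 - genus \<le> int (ell D)"
proof -
  obtain \<gamma> where \<gamma>: "\<And>D. D \<in> divisors \<Longrightarrow> divisor_degree D - int (ell D) \<le> \<gamma>"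
    using riemann_bound by blast
  have "divisor_degree D - int (ell D) + 1 \<le> genus"
    unfolding genus_def
  proof (rule Greatest_int_ge)
    show "\<exists>E\<in>divisors. divisor_degree D - int (ell D) + 1 = divisor_degree E - int (ell E) + 1"
      using assms by blast
    fix x assume "\<exists>E\<in>divisors. x = divisor_degree E - int (ell E) + 1"
    then show "x \<le> \<gamma> + 1"
      using \<gamma> by fastforce
  qed
  then show ?thesis by simp
qed

lemma genus_nonneg: "0 \<le> genus"
  using riemann_inequality[OF divisors_0] by (simp add: ell_0)

subsection \<open>Gaps\<close>

text \<open>Membership in the Weierstrass semigroup at \<open>P\<close>; the gaps are the other
  natural numbers.\<close>

definition pole_number :: "'f set \<Rightarrow> nat \<Rightarrow> bool" where
  "pole_number P a \<longleftrightarrow> (\<exists>f. f \<noteq> 0 \<and> valuation P f = - int a \<and>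
     (\<forall>Q\<in>places - {P}. 0 \<le> valuation Q f))"

lemma pole_number_0: "P \<in> places \<Longrightarrow> pole_number P 0"
  unfolding pole_number_def by (intro exI[of _ 1]) auto

lemma pole_number_add:
  assumes "P \<in> places" "pole_number P a" "pole_number P b"
  shows "pole_number P (a + b)"
proof -
  obtain f h where "f \<noteq> 0" "valuation P f = - int a" "\<forall>Q\<in>places - {P}. 0 \<le> valuation Q f"
    "h \<noteq> 0" "valuation P h = - int b" "\<forall>Q\<in>places - {P}. 0 \<le> valuation Q h"
    using assms(2,3) by (auto simp: pole_number_def)
  then show ?thesis
    using assms(1) unfolding pole_number_def
    by (intro exI[of _ "f * h"]) (auto simp: valuation_mult)
qed

text \<open>The dimension can increase from \<open>n\<close> to \<open>n + 1\<close> only if some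
  function has a pole of exactly that order, and then by one. The initial 1 accounts for the
  constants.\<close>

lemma ell_multiple_le:
  assumes P: "P \<in> places"
  shows "ell (frag_cmul (int n) (frag_of P)) \<le> 1 + card {k \<in> {1..n}. pole_number P k}"
proof (induction n)
  case 0
  then show ?case by (simp add: ell_0)
next
  case (Suc n)
  define D where "D = (\<lambda>n. frag_cmul (int n) (frag_of P))"
  have D: "D n \<in> divisors" for n
    using P by (simp add: D_def divisors_cmul divisors_frag_of)
  have deg: "divisor_degree (D n) = int n" for n
    using P by (simp add: D_def divisor_degree_cmul divisors_frag_of divisor_degree_frag_of)
  have lookup_D: "lookup (D n) Q = (if Q = P then int n else 0)" for n Q
    by (simp add: D_def)
  have IH: "ell (D n) \<le> 1 + card {k \<in> {1..n}. pole_number P k}"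
    using Suc by (simp add: D_def)
  have "ell (D (Suc n)) \<le> 1 + card {k \<in> {1..Suc n}. pole_number P k}"
  proof (cases "pole_number P (Suc n)")
    case True
    then have "{k \<in> {1..Suc n}. pole_number P k} = insert (Suc n) {k \<in> {1..n}. pole_number P k}"
      by (auto simp: le_Suc_eq)
    then have "card {k \<in> {1..Suc n}. pole_number P k} = Suc (card {k \<in> {1..n}. pole_number P k})"
      by simp
    moreover have "int (ell (D (Suc n))) \<le> int (ell (D n)) + divisor_degree (D (Suc n)) - divisor_degree (D n)"
      by (intro ell_le D) (auto simp: lookup_D)
    ultimately show ?thesis
      using IH by (simp add: deg)
  next
    case False
    have "riemann_roch_space (D (Suc n)) \<subseteq> riemann_roch_space (D n)"
    proof
      fix f assume f: "f \<in> riemann_roch_space (D (Suc n))"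
      show "f \<in> riemann_roch_space (D n)"
      proof (cases "f = 0")
        case True
        then show ?thesis by (simp add: riemann_roch_space_def)
      next
        case f0: False
        have v: "- lookup (D (Suc n)) Q \<le> valuation Q f" if "Q \<in> places" for Q
          using f f0 that by (auto simp: riemann_roch_space_def)
        have "valuation P f \<noteq> - int (Suc n)"
        proof
          assume "valuation P f = - int (Suc n)"
          moreover have "0 \<le> valuation Q f" if "Q \<in> places - {P}" for Q
            using v[of Q] that by (simp add: lookup_D)
          ultimately have "pole_number P (Suc n)"
            unfolding pole_number_def using f0 by blast
          then show False using False by blast
        qed
        then have "- int n \<le> valuation P f"
          using v[OF P] by (simp add: lookup_D)
        then have "- lookup (D n) Q \<le> valuation Q f" if "Q \<in> places" for Q
          using v[OF that] by (cases "Q = P") (simp_all add: lookup_D)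
        then show ?thesis
          by (simp add: riemann_roch_space_def)
      qed
    qed
    then have "ell (D (Suc n)) \<le> ell (D n)"
      unfolding ell_def by (intro dim_mono_fin_dim fin_dim_riemann_roch_space D)
    moreover have "{k \<in> {1..Suc n}. pole_number P k} = {k \<in> {1..n}. pole_number P k}"
      using False by (auto simp: le_Suc_eq)
    ultimately show ?thesis
      using IH by simp
  qed
  then show ?case by (simp add: D_def)
qed

text \<open>If \<open>n\<close> is a gap, then one of \<open>a\<close> and \<open>n - a\<close> is a gap for each \<open>a\<close>; so \<open>n \<ge> 2g\<close> would give
  more than \<open>g\<close> gaps.\<close>

lemma gap_le:
  assumes P: "P \<in> places" and gap: "\<not> pole_number P n"
  shows "int n \<le> 2 * genus - 1"
proof -
  define H where "H = {k \<in> {1..n}. pole_number P k}"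
  define G where "G = {k \<in> {1..n}. \<not> pole_number P k}"
  have n: "n \<ge> 1"
    using gap pole_number_0[OF P] by (cases n) auto
  have "G \<union> H = {1..n}" "G \<inter> H = {}"
    by (auto simp: G_def H_def)
  then have sum: "card G + card H = n"
    using card_Un_disjoint[of G H] by (simp add: G_def H_def)
  \<comment> \<open>The gap \<open>n\<close> is itself never of the form \<open>n - a\<close> with
    \<open>a \<ge> 1\<close>; leaving it out produces the \<open>- 1\<close> in the final
    bound.\<close>
  have "(\<lambda>a. n - a) ` H \<subseteq> G - {n}"
  proof
    fix b assume "b \<in> (\<lambda>a. n - a) ` H"
    then obtain a where a: "a \<in> {1..n}" "pole_number P a" "b = n - a"
      by (auto simp: H_def)
    have "a \<noteq> n"
      using a gap by blast
    moreover have "\<not> pole_number P b"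
      using pole_number_add[OF P a(2), of b] a gap by auto
    ultimately show "b \<in> G - {n}"
      using a by (auto simp: G_def)
  qed
  moreover have "inj_on (\<lambda>a. n - a) H"
    by (auto simp: H_def inj_on_def)
  ultimately have "card H \<le> card (G - {n})"
    by (intro card_inj_on_le[of "\<lambda>a. n - a"]) (auto simp: G_def)
  moreover have "card (G - {n}) = card G - 1" "card G > 0"
    using n gap by (auto simp: G_def card_gt_0_iff)
  ultimately have "int n \<le> 2 * int (card G) - 1"
    using sum by linarith
  moreover have "int (card G) \<le> genus"
  proof -
    have D: "frag_cmul (int n) (frag_of P) \<in> divisors"
      using P by (simp add: divisors_cmul divisors_frag_of)
    have "int n + 1 - genus \<le> int (ell (frag_cmul (int n) (frag_of P)))"
      using riemann_inequality[OF D] P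
      by (simp add: divisor_degree_cmul divisors_frag_of divisor_degree_frag_of)
    also have "\<dots> \<le> 1 + int (card H)"
      using ell_multiple_le[OF P, of n] unfolding H_def by linarith
    finally show ?thesis
      using sum by linarith
  qed
  ultimately show ?thesis by linarith
qed

lemma pure_gaps_coordinates:
  assumes P: "P1 \<in> places" "P2 \<in> places" "P1 \<noteq> P2" and s: "(s1, s2) \<in> pure_gaps P1 P2"
  shows "1 \<le> s1" "s1 \<le> 2 * genus - 1" "1 \<le> s2" "s2 \<le> 2 * genus - 1"
proof -
  define D where "D = frag_cmul s1 (frag_of P1) + frag_cmul s2 (frag_of P2)"
  have D: "D \<in> divisors"
    using P by (simp add: D_def divisors_add divisors_cmul divisors_frag_of)
  have s_nonneg: "0 \<le> s1" "0 \<le> s2" and ell_eq: "\<And>P. P \<in> {P1, P2} \<Longrightarrow> ell D = ell (D - frag_of P)"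
    using s by (auto simp: pure_gaps_def D_def)
  have lookup_D: "lookup D Q = (if Q = P1 then s1 else 0) + (if Q = P2 then s2 else 0)" for Q
    by (simp add: D_def lookup_add)
  have gap: "\<not> pole_number P (nat (lookup D P))" if "P \<in> {P1, P2}" for P
  proof
    assume "pole_number P (nat (lookup D P))"
    moreover have nonneg: "0 \<le> lookup D Q" for Q
      using s_nonneg by (simp add: lookup_D)
    ultimately obtain f where f: "f \<noteq> 0" "valuation P f = - lookup D P"
      "\<And>Q. Q \<in> places \<Longrightarrow> Q \<noteq> P \<Longrightarrow> 0 \<le> valuation Q f"
      by (auto simp: pole_number_def)
    have "P \<in> places"
      using that P by auto
    have "- lookup D Q \<le> valuation Q f" if "Q \<in> places" for Q
      using f(2) f(3)[OF that] nonneg[of Q] by (cases "Q = P") auto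
    then have "f \<in> riemann_roch_space D"
      by (simp add: riemann_roch_space_def)
    moreover have "f \<notin> riemann_roch_space (D - frag_of P)"
      using f \<open>P \<in> places\<close> by (auto simp: riemann_roch_space_def lookup_minus)
    ultimately have "ell (D - frag_of P) < ell D"
      by (intro ell_strict_mono[OF D]) (auto simp: lookup_minus)
    then show False
      using ell_eq[OF that] by simp
  qed
  \<comment> \<open>Since 0 is a pole number, neither coordinate is 0. Hence the boxes, open at
    their lower ends, miss no pure gap.\<close>
  have "\<not> pole_number P1 (nat s1)" "\<not> pole_number P2 (nat s2)"
    using gap[of P1] gap[of P2] P(3) by (auto simp: lookup_D)
  then show "1 \<le> s1" "s1 \<le> 2 * genus - 1" "1 \<le> s2" "s2 \<le> 2 * genus - 1"
    using gap_le[OF P(1), of "nat s1"] gap_le[OF P(2), of "nat s2"] s_nonneg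
      pole_number_0[OF P(1)] pole_number_0[OF P(2)]
    by (force simp: int_one_le_iff_zero_less order_less_le)+
qed

lemma finite_pure_gaps:
  assumes "P1 \<in> places" "P2 \<in> places" "P1 \<noteq> P2"
  shows "finite (pure_gaps P1 P2)"
proof (rule finite_subset)
  show "pure_gaps P1 P2 \<subseteq> {1..2 * genus - 1} \<times> {1..2 * genus - 1}"
  proof
    fix s assume "s \<in> pure_gaps P1 P2"
    then show "s \<in> {1..2 * genus - 1} \<times> {1..2 * genus - 1}"
      using pure_gaps_coordinates[OF assms, of "fst s" "snd s"] by (cases s) simp
  qed
qed simp

subsection \<open>Translating and counting the boxes\<close>

text \<open>One function, \<open>z ^ j\<close>, shifts the divisor and its two reductions by a place
  at the same time, so the equalities of dimensions are transported. As \<open>m\<close> may be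
  negative, this serves both inclusions between the boxes.\<close>

lemma pure_gaps_translate:
  assumes P: "P1 \<in> places" "P2 \<in> places"
    and principal: "principal_divisor (frag_cmul m (frag_of P1 - frag_of P2))"
    and s: "(s1, s2) \<in> pure_gaps P1 P2" "0 \<le> s1 - m * int j" "0 \<le> s2 + m * int j"
  shows "(s1 - m * int j, s2 + m * int j) \<in> pure_gaps P1 P2"
proof -
  obtain z where z: "z \<noteq> 0"
    "\<And>Q. Q \<in> places \<Longrightarrow> lookup (frag_cmul m (frag_of P1 - frag_of P2)) Q = valuation Q z"
    using principal by (auto simp: principal_divisor_def)
  define D where "D s t = frag_cmul s (frag_of P1) + frag_cmul t (frag_of P2)" for s t
  have D: "D s t \<in> divisors" for s t
    using P by (simp add: D_def divisors_add divisors_cmul divisors_frag_of)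
  have val: "lookup (D (s1 - m * int j) (s2 + m * int j)) Q = lookup (D s1 s2) Q - valuation Q (z ^ j)"
    if Q: "Q \<in> places" for Q
    using Q z(1) by (simp add: D_def lookup_add lookup_minus valuation_power z(2)[OF Q, symmetric] algebra_simps)
  have "ell (D (s1 - m * int j) (s2 + m * int j) - E) = ell (D s1 s2 - E)" if "E \<in> divisors" for E
    using that z(1) val by (intro ell_equivalent[of _ _ "z ^ j"] divisors_diff D) (auto simp: lookup_minus)
  from this[of 0] this[of "frag_of P1"] this[of "frag_of P2"] show ?thesis
    using s P unfolding pure_gaps_def D_def by (auto simp: divisors_0 divisors_frag_of)
qed

lemma pure_gaps_box_translate:
  assumes P: "P1 \<in> places" "P2 \<in> places"
    and principal: "principal_divisor (frag_cmul (int (period P1 P2)) (frag_of P1 - frag_of P2))"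
  shows "pure_gaps_box P1 P2 i j =
    (\<lambda>s. s + shift_vector P1 P2 j) ` pure_gaps_box P1 P2 (i + j) 0"
proof -
  define m where "m = int (period P1 P2)"
  have principal': "principal_divisor (frag_cmul (- m) (frag_of P1 - frag_of P2))"
  proof -
    obtain z where z: "z \<noteq> 0"
      "\<And>Q. Q \<in> places \<Longrightarrow> lookup (frag_cmul m (frag_of P1 - frag_of P2)) Q = valuation Q z"
      using principal by (auto simp: principal_divisor_def m_def)
    have "frag_cmul (- m) (frag_of P1 - frag_of P2) \<in> divisors"
      using P by (simp add: divisors_cmul divisors_diff divisors_frag_of del: minus_frag_cmul)
    then show ?thesis
      unfolding principal_divisor_def using z
      by (intro conjI exI[of _ "inverse z"]) (auto simp: valuation_inverse simp flip: z(2))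
  qed
  have m: "0 \<le> m" by (simp add: m_def)
  have box: "(a, b) \<in> pure_gaps_box P1 P2 k l \<longleftrightarrow> (a, b) \<in> pure_gaps P1 P2 \<and>
      m * int k < a \<and> a \<le> m * int k + m \<and> m * int l < b \<and> b \<le> m * int l + m" for a b k l
    by (auto simp: pure_gaps_box_def m_def algebra_simps)
  have shift: "(a, b) + shift_vector P1 P2 j = (a - m * int j, b + m * int j)" for a b
    by (simp add: shift_vector_def m_def algebra_simps)
  have mj: "0 \<le> m * int i" "0 \<le> m * int j"
    using m by simp_all
  show ?thesis
  proof (intro Set.set_eqI iffI)
    fix s assume s: "s \<in> pure_gaps_box P1 P2 i j"
    obtain a b where ab: "s = (a, b)" by (cases s)
    have "(a, b) \<in> pure_gaps P1 P2" "m * int i < a" "m * int j < b"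
      using s by (auto simp: ab box)
    moreover from this have "0 \<le> a - - m * int j" "0 \<le> b + - m * int j"
      using mj by (simp_all del: of_nat_0_le_iff zero_le_mult_iff mult_nonneg_nonneg)
    ultimately have "(a + m * int j, b - m * int j) \<in> pure_gaps P1 P2"
      using pure_gaps_translate[OF P principal', of a b j] by simp
    then have "(a + m * int j, b - m * int j) \<in> pure_gaps_box P1 P2 (i + j) 0"
      using s by (auto simp: ab box algebra_simps)
    then show "s \<in> (\<lambda>s. s + shift_vector P1 P2 j) ` pure_gaps_box P1 P2 (i + j) 0"
      by (rule rev_image_eqI) (simp add: ab shift)
  next
    fix s assume "s \<in> (\<lambda>s. s + shift_vector P1 P2 j) ` pure_gaps_box P1 P2 (i + j) 0"
    then obtain a b where ab: "(a, b) \<in> pure_gaps_box P1 P2 (i + j) 0"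
      "s = (a - m * int j, b + m * int j)"
      using shift by auto
    have "(a, b) \<in> pure_gaps P1 P2" "m * int (i + j) < a" "0 < b"
      using ab(1) by (auto simp: box)
    moreover from this have "0 \<le> a - m * int j" "0 \<le> b + m * int j"
      using mj by (simp_all add: distrib_left del: of_nat_0_le_iff zero_le_mult_iff mult_nonneg_nonneg)
    ultimately have "(a - m * int j, b + m * int j) \<in> pure_gaps P1 P2"
      using pure_gaps_translate[OF P principal[folded m_def], of a b j] by simp
    then show "s \<in> pure_gaps_box P1 P2 i j"
      using ab by (auto simp: box algebra_simps)
  qed
qed

text \<open>Sort the boxes by antidiagonals: the \<open>k + 1\<close> boxes with
  \<open>i + j = k\<close> are translates of the one at \<open>(k, 0)\<close>. From
  \<open>k = M\<close> on that box is empty, because its first coordinates would exceed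
  \<open>2 * genus - 1\<close>.\<close>

lemma card_pure_gaps:
  assumes P: "P1 \<in> places" "P2 \<in> places" "P1 \<noteq> P2"
    and principal: "principal_divisor (frag_cmul (int (period P1 P2)) (frag_of P1 - frag_of P2))"
    and pos: "0 < period P1 P2"
  shows "card (pure_gaps P1 P2) =
    (\<Sum>k\<in>{k::nat. int k \<le> \<lceil>(2 * real_of_int genus - 1) / real (period P1 P2)\<rceil> - 1}.
       (k + 1) * card (pure_gaps_box P1 P2 k 0))"
proof -
  define m where "m = period P1 P2"
  \<comment> \<open>In genus 0 the ceiling is not positive; \<open>nat\<close> then yields an empty
    range, in agreement with the index set of the sum.\<close>
  define M where "M = nat \<lceil>(2 * real_of_int genus - 1) / real m\<rceil>"
  define B where "B = pure_gaps_box P1 P2"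
  have B: "(a, b) \<in> B i j \<longleftrightarrow> (a, b) \<in> pure_gaps P1 P2 \<and> int (i * m) < a \<and> a \<le> int ((i + 1) * m) \<and>
      int (j * m) < b \<and> b \<le> int ((j + 1) * m)" for a b i j
    by (auto simp: B_def pure_gaps_box_def m_def)
  have translate: "B i j = (\<lambda>s. s + shift_vector P1 P2 j) ` B (i + j) 0" for i j
    unfolding B_def by (rule pure_gaps_box_translate[OF P(1,2) principal])
  have card_B: "card (B i j) = card (B (i + j) 0)" for i j
    unfolding translate[of i j] by (rule card_image) (auto simp: inj_on_def)
  have empty: "B k 0 = {}" if "M \<le> k" for k
  proof (rule ccontr)
    assume "B k 0 \<noteq> {}"
    then obtain a b where ab: "(a, b) \<in> B k 0" by auto
    then have "int (k * m) < a" "a \<le> 2 * genus - 1"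
      using pure_gaps_coordinates[OF P, of a b] by (auto simp: B)
    then have less: "real (k * m) < 2 * real_of_int genus - 1" by linarith
    have "(2 * real_of_int genus - 1) / real m \<le> real k"
      using that unfolding M_def by linarith
    then show False
      using less pos by (simp add: m_def field_simps)
  qed
  define S where "S = (SIGMA k:{..<M}. {..k})"
  have "pure_gaps P1 P2 = (\<Union>(k, j)\<in>S. B (k - j) j)"
  proof (intro Set.set_eqI iffI)
    fix s assume s: "s \<in> pure_gaps P1 P2"
    obtain a b where ab: "s = (a, b)" by (cases s)
    obtain i where i: "int (i * m) < a" "a \<le> int ((i + 1) * m)"
      using interval_index_exists[of a m] pure_gaps_coordinates[OF P, of a b] s pos by (auto simp: ab m_def)
    obtain j where j: "int (j * m) < b" "b \<le> int ((j + 1) * m)"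
      using interval_index_exists[of b m] pure_gaps_coordinates[OF P, of a b] s pos by (auto simp: ab m_def)
    have "s \<in> B i j"
      using s i j by (simp add: ab B)
    then have "B (i + j) 0 \<noteq> {}"
      using translate[of i j] by auto
    then have "i + j < M"
      using empty[of "i + j"] by (meson not_le)
    then have "(i + j, j) \<in> S"
      by (simp add: S_def)
    then show "s \<in> (\<Union>(k, j)\<in>S. B (k - j) j)"
      using \<open>s \<in> B i j\<close> by (intro UN_I[of "(i + j, j)"]) auto
  next
    fix s assume "s \<in> (\<Union>(k, j)\<in>S. B (k - j) j)"
    then show "s \<in> pure_gaps P1 P2"
      by (auto simp: B_def pure_gaps_box_def)
  qed
  then have "card (pure_gaps P1 P2) = card (\<Union>x\<in>S. case x of (k, j) \<Rightarrow> B (k - j) j)"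
    by simp
  also have "\<dots> = (\<Sum>x\<in>S. card (case x of (k, j) \<Rightarrow> B (k - j) j))"
  proof (rule card_UN_disjoint)
    show "finite S"
      by (auto simp: S_def)
    show "\<forall>x\<in>S. finite (case x of (k, j) \<Rightarrow> B (k - j) j)"
      using finite_pure_gaps[OF P] by (auto simp: B_def pure_gaps_box_def)
    show "\<forall>x\<in>S. \<forall>y\<in>S. x \<noteq> y \<longrightarrow>
        (case x of (k, j) \<Rightarrow> B (k - j) j) \<inter> (case y of (k, j) \<Rightarrow> B (k - j) j) = {}"
    proof (intro ballI impI)
      fix x y assume xy: "x \<in> S" "y \<in> S" "x \<noteq> y"
      obtain k j k' j' where kj: "x = (k, j)" "y = (k', j')" by (cases x; cases y)
      have "k - j = k' - j' \<and> j = j'" if "(a, b) \<in> B (k - j) j" "(a, b) \<in> B (k' - j') j'" for a b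
        using that interval_index_unique[of "k - j" m a "k' - j'"] interval_index_unique[of j m b j']
        unfolding B by blast
      then show "(case x of (k, j) \<Rightarrow> B (k - j) j) \<inter> (case y of (k, j) \<Rightarrow> B (k - j) j) = {}"
        using xy unfolding kj S_def by fastforce
    qed
  qed
  also have "\<dots> = (\<Sum>k<M. \<Sum>j\<le>k. card (B (k - j) j))"
    unfolding S_def by (subst sum.Sigma) (auto intro!: sum.cong)
  also have "\<dots> = (\<Sum>k<M. \<Sum>j\<le>k. card (B k 0))"
    by (intro sum.cong refl) (subst card_B, simp)
  also have "\<dots> = (\<Sum>k<M. (k + 1) * card (B k 0))"
    by simp
  also have "{..<M} = {k::nat. int k \<le> \<lceil>(2 * real_of_int genus - 1) / real m\<rceil> - 1}"
    by (auto simp: M_def zless_nat_eq_int_zless)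
  finally show ?thesis
    by (simp only: B_def m_def)
qed

end

subsection \<open>Extending the Frobenius map to the function field\<close>

text \<open>The algebraic closure of a finite field enters through two facts: a power map is
  additive, and every constant is periodic under it, that is, lies in a finite subfield.\<close>

locale frobenius_function_field = alg_closed_function_field emb
  for emb :: "'k::alg_closed_field \<Rightarrow> 'f::field" +
  fixes q :: nat
  assumes q_ge_2: "2 \<le> q"
    and power_q_add: "\<And>a b :: 'k. (a + b) ^ q = a ^ q + b ^ q"
    and power_q_periodic: "\<And>a :: 'k. \<exists>n\<ge>1. a ^ (q ^ n) = a"
begin

section \<open>Iterates of the Frobenius map on the constants\<close>

lemma q_pos: "0 < q"
  using q_ge_2 by simp

lemma power_qn_Suc: "(a :: 'a::monoid_mult) ^ (q ^ Suc n) = (a ^ (q ^ n)) ^ q"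
  by (simp add: power_mult[symmetric] mult.commute)

lemma power_qn_add: "((a :: 'k) + b) ^ (q ^ n) = a ^ (q ^ n) + b ^ (q ^ n)"
  by (induction n) (simp_all only: power_qn_Suc power_q_add power_0 power_one_right)

lemma power_qn_sum: "(\<Sum>i\<in>I. f i :: 'k) ^ (q ^ n) = (\<Sum>i\<in>I. f i ^ (q ^ n))"
  using q_pos by (induction I rule: infinite_finite_induct) (auto simp: power_qn_add)

lemma power_qn_mult: "(a :: 'a::monoid_mult) ^ (q ^ (m + n)) = (a ^ (q ^ m)) ^ (q ^ n)"
  by (simp add: power_add power_mult)

lemma power_qn_periodic_mult:
  assumes "(a :: 'k) ^ (q ^ n) = a"
  shows "a ^ (q ^ (n * k)) = a"
proof (induction k)
  case (Suc k)
  then show ?case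
    using assms by (simp add: power_qn_mult[of a "n * k" n, symmetric] add.commute del: power_eq_0_iff)
      (metis add.commute power_qn_mult)
qed simp

lemma power_qn_surj: "\<exists>b. (b :: 'k) ^ (q ^ n) = a"
  using nth_root_exists[of "q ^ n" a] q_pos by auto

text \<open>Finitely many constants lie in a common finite subfield: multiply their periods.\<close>

lemma common_period:
  assumes "finite A"
  shows "\<exists>n\<ge>1. \<forall>a\<in>A. (a :: 'k) ^ (q ^ n) = a"
  using assms
proof (induction A)
  case empty
  then show ?case by (auto intro: exI[of _ 1])
next
  case (insert a A)
  then obtain n where n: "n \<ge> 1" "\<And>b. b \<in> A \<Longrightarrow> b ^ (q ^ n) = b" by blast
  obtain m where m: "m \<ge> 1" "a ^ (q ^ m) = a"
    using power_q_periodic by blast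
  have "b ^ (q ^ (n * m)) = b" if "b \<in> insert a A" for b
    using that power_qn_periodic_mult[OF n(2), of b m] power_qn_periodic_mult[OF m(2), of n]
    by (auto simp: mult.commute)
  moreover have "1 \<le> n * m"
    using n m by simp
  ultimately show ?case by blast
qed

text \<open>Semilinear over K rather than linear. It still permutes places and respects valuations,
  and semilinearity is what forces fixed vectors to exist; a K-linear automorphism need not have any
  in a given space.\<close>

definition frob_aut :: "nat \<Rightarrow> ('f \<Rightarrow> 'f) \<Rightarrow> bool" where
  "frob_aut n \<sigma> \<longleftrightarrow> bij \<sigma> \<and> (\<forall>x y. \<sigma> (x + y) = \<sigma> x + \<sigma> y) \<and> (\<forall>x y. \<sigma> (x * y) = \<sigma> x * \<sigma> y) \<and>
     (\<forall>a. \<sigma> (emb a) = emb (a ^ (q ^ n)))"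

lemma frob_autD:
  assumes "frob_aut n \<sigma>"
  shows frob_aut_bij: "bij \<sigma>" and frob_aut_inj: "inj \<sigma>"
    and frob_aut_add: "\<sigma> (x + y) = \<sigma> x + \<sigma> y" and frob_aut_mult: "\<sigma> (x * y) = \<sigma> x * \<sigma> y"
    and frob_aut_emb: "\<sigma> (emb a) = emb (a ^ (q ^ n))"
    and frob_aut_0: "\<sigma> 0 = 0" and frob_aut_1: "\<sigma> 1 = 1"
    and frob_aut_diff: "\<sigma> (x - y) = \<sigma> x - \<sigma> y"
    and frob_aut_inverse: "\<sigma> (inverse x) = inverse (\<sigma> x)"
    and frob_aut_power: "\<sigma> (x ^ k) = \<sigma> x ^ k"
    and frob_aut_eq_0_iff: "\<sigma> x = 0 \<longleftrightarrow> x = 0"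
proof -
  show bij: "bij \<sigma>" and add: "\<sigma> (x + y) = \<sigma> x + \<sigma> y" and mult: "\<sigma> (x * y) = \<sigma> x * \<sigma> y"
    and emb: "\<sigma> (emb a) = emb (a ^ (q ^ n))" for x y a
    using assms by (auto simp: frob_aut_def)
  show inj: "inj \<sigma>"
    using bij by (rule bij_is_inj)
  show 0: "\<sigma> 0 = 0" and 1: "\<sigma> 1 = 1"
    using emb[of 0] emb[of 1] q_pos by simp_all
  show "\<sigma> (x - y) = \<sigma> x - \<sigma> y"
    using add[of "x - y" y] by (simp add: algebra_simps)
  show eq_0: "\<sigma> x = 0 \<longleftrightarrow> x = 0" for x
    using inj_eq[OF inj, of x 0] 0 by simp
  show "\<sigma> (inverse x) = inverse (\<sigma> x)"
  proof (cases "x = 0")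
    case False
    then have "\<sigma> x * \<sigma> (inverse x) = 1"
      using mult[of x "inverse x"] 1 by simp
    then show ?thesis
      by (metis inverse_unique)
  qed (simp add: 0)
  show "\<sigma> (x ^ k) = \<sigma> x ^ k"
    by (induction k) (simp_all add: 1 mult)
qed

lemma frob_aut_sum: "frob_aut n \<sigma> \<Longrightarrow> \<sigma> (sum f I) = (\<Sum>i\<in>I. \<sigma> (f i))"
  by (induction I rule: infinite_finite_induct) (auto simp: frob_aut_0 frob_aut_add)

lemma frob_aut_funpow:
  assumes "frob_aut n \<sigma>"
  shows "frob_aut (n * k) (\<sigma> ^^ k)"
proof (induction k)
  case 0
  then show ?case
    using bij_id by (simp add: frob_aut_def id_def)
next
  case (Suc k)
  have "(a ^ (q ^ (n * k))) ^ (q ^ n) = a ^ (q ^ (n * Suc k))" for a :: 'k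
    by (simp add: add.commute flip: power_qn_mult)
  then show ?case
    using Suc assms bij_comp[of "\<sigma> ^^ k" \<sigma>] by (simp add: frob_aut_def comp_def)
qed

section \<open>The rational subfield K(x) and a basis over it\<close>

lemma simple_extension_closed:
  assumes x: "transcendental_over emb x"
    and r: "r \<in> simple_extension emb x" and s: "s \<in> simple_extension emb x"
  shows "r + s \<in> simple_extension emb x" "r * s \<in> simple_extension emb x"
    "r / s \<in> simple_extension emb x"
proof -
  have nz: "ev p x \<noteq> 0" if "p \<noteq> 0" for p
    using x that by (simp add: transcendental_over_iff)
  obtain p p' where p: "p' \<noteq> 0" "r = ev p x / ev p' x"
    using r unfolding simple_extension_iff[OF x] by blast
  obtain u u' where u: "u' \<noteq> 0" "s = ev u x / ev u' x"
    using s unfolding simple_extension_iff[OF x] by blast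
  have "r + s = ev (p * u' + u * p') x / ev (p' * u') x"
    using nz[OF p(1)] nz[OF u(1)] by (simp add: p u ev_add ev_mult divide_simps)
  then show "r + s \<in> simple_extension emb x"
    unfolding simple_extension_iff[OF x] using p(1) u(1) by (metis mult_eq_0_iff)
  have "r * s = ev (p * u) x / ev (p' * u') x"
    by (simp add: p u ev_mult)
  then show "r * s \<in> simple_extension emb x"
    unfolding simple_extension_iff[OF x] using p(1) u(1) by (metis mult_eq_0_iff)
  show "r / s \<in> simple_extension emb x"
  proof (cases "u = 0")
    case True
    then have "r / s = ev 0 x / ev 1 x"
      by (simp add: u)
    then show ?thesis
      unfolding simple_extension_iff[OF x] by (metis one_neq_zero)
  next
    case False
    have "r / s = ev (p * u') x / ev (p' * u) x"
      by (simp add: p u ev_mult)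
    then show ?thesis
      unfolding simple_extension_iff[OF x] using p(1) False by (metis mult_eq_0_iff)
  qed
qed

lemma simple_extension_base:
  assumes x: "transcendental_over emb x"
  shows "emb a \<in> simple_extension emb x" "0 \<in> simple_extension emb x" "1 \<in> simple_extension emb x"
    "x \<in> simple_extension emb x"
proof -
  have mem: "ev p x \<in> simple_extension emb x" for p
    unfolding simple_extension_iff[OF x] by (intro exI[of _ p] exI[of _ 1]) simp
  show "emb a \<in> simple_extension emb x" "0 \<in> simple_extension emb x" "1 \<in> simple_extension emb x"
    "x \<in> simple_extension emb x"
    using mem[of "[:a:]"] mem[of 0] mem[of 1] mem[of "[:0, 1:]"] by simp_all
qed

lemma simple_extension_minus:
  assumes x: "transcendental_over emb x" and r: "r \<in> simple_extension emb x"
  shows "- r \<in> simple_extension emb x"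
  using simple_extension_closed(2)[OF x simple_extension_base(1)[OF x, of "- 1"] r]
  by (simp add: emb_minus)

text \<open>A spanning set of least cardinality is independent, since a member with nonzero
  coefficient in a relation could be expressed by the others and dropped.\<close>

lemma basis_over_rational:
  obtains x B where "transcendental_over emb x" "finite B"
    "\<And>y. \<exists>c. (\<forall>b\<in>B. c b \<in> simple_extension emb x) \<and> y = (\<Sum>b\<in>B. c b * b)"
    "\<And>c b. (\<And>b. b \<in> B \<Longrightarrow> c b \<in> simple_extension emb x) \<Longrightarrow> (\<Sum>b\<in>B. c b * b) = 0 \<Longrightarrow> b \<in> B \<Longrightarrow> c b = 0"
proof -
  obtain x B0 where x: "transcendental_over emb x" and B0: "finite B0"
    "\<forall>y. \<exists>c. (\<forall>b\<in>B0. c b \<in> simple_extension emb x) \<and> y = (\<Sum>b\<in>B0. c b * b)"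
    using finite_over_rational by blast
  define spanning where "spanning B \<longleftrightarrow> finite B \<and>
    (\<forall>y. \<exists>c. (\<forall>b\<in>B. c b \<in> simple_extension emb x) \<and> y = (\<Sum>b\<in>B. c b * b))" for B
  have "spanning B0"
    using B0 by (simp add: spanning_def)
  then obtain B where B: "spanning B" and min: "\<And>B'. spanning B' \<Longrightarrow> card B \<le> card B'"
    using ex_has_least_nat[of spanning B0 card] by blast
  have fin: "finite B" and span: "\<And>y. \<exists>c. (\<forall>b\<in>B. c b \<in> simple_extension emb x) \<and> y = (\<Sum>b\<in>B. c b * b)"
    using B by (auto simp: spanning_def)
  note closed = simple_extension_closed[OF x] simple_extension_minus[OF x]
  have "c b0 = 0" if c: "\<And>b. b \<in> B \<Longrightarrow> c b \<in> simple_extension emb x"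
    and sum: "(\<Sum>b\<in>B. c b * b) = 0" and b0: "b0 \<in> B" for c b0
  proof (rule ccontr)
    assume nz: "c b0 \<noteq> 0"
    have "c b0 * b0 = - (\<Sum>b\<in>B - {b0}. c b * b)"
      using sum fin b0 by (simp add: sum.remove eq_neg_iff_add_eq_0)
    then have b0_eq: "b0 = (\<Sum>b\<in>B - {b0}. - c b / c b0 * b)"
      using nz by (simp add: sum_divide_distrib[symmetric] sum_negf field_simps)
    have "spanning (B - {b0})"
      unfolding spanning_def
    proof (intro conjI allI)
      fix y
      obtain d where d: "\<And>b. b \<in> B \<Longrightarrow> d b \<in> simple_extension emb x" "y = (\<Sum>b\<in>B. d b * b)"
        using span by metis
      have "y = d b0 * b0 + (\<Sum>b\<in>B - {b0}. d b * b)"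
        using d(2) fin b0 by (simp add: sum.remove)
      also have "d b0 * b0 = (\<Sum>b\<in>B - {b0}. d b0 * (- c b / c b0) * b)"
        by (subst (2) b0_eq) (simp add: sum_distrib_left mult.assoc)
      finally have "y = (\<Sum>b\<in>B - {b0}. (d b0 * (- c b / c b0) + d b) * b)"
        by (simp only: sum.distrib distrib_right)
      moreover have "\<forall>b\<in>B - {b0}. d b0 * (- c b / c b0) + d b \<in> simple_extension emb x"
        using c d(1) b0 by (intro ballI closed) auto
      ultimately show "\<exists>c. (\<forall>b\<in>B - {b0}. c b \<in> simple_extension emb x) \<and> y = (\<Sum>b\<in>B - {b0}. c b * b)"
        by (intro exI[of _ "\<lambda>b. d b0 * (- c b / c b0) + d b"] conjI)
    qed (use fin in simp)
    then have "card B \<le> card (B - {b0})"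
      by (rule min)
    then show False
      using fin b0 card_gt_0_iff[of B] by auto
  qed
  then show thesis
    using that[OF x fin span] by blast
qed

section \<open>The Frobenius map on K(x)\<close>

definition frob_poly :: "nat \<Rightarrow> 'k poly \<Rightarrow> 'k poly" where
  "frob_poly n p = map_poly (\<lambda>a. a ^ (q ^ n)) p"

lemma coeff_frob_poly: "coeff (frob_poly n p) i = coeff p i ^ (q ^ n)"
  unfolding frob_poly_def using q_pos by (intro coeff_map_poly) simp

lemma frob_poly_add: "frob_poly n (p + r) = frob_poly n p + frob_poly n r"
  by (intro poly_eqI) (simp add: coeff_frob_poly power_qn_add)

lemma frob_poly_mult: "frob_poly n (p * r) = frob_poly n p * frob_poly n r"
  by (intro poly_eqI) (simp add: coeff_frob_poly coeff_mult power_qn_sum power_mult_distrib)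

lemma frob_poly_eq_0_iff [simp]: "frob_poly n p = 0 \<longleftrightarrow> p = 0"
  by (auto simp: poly_eq_iff coeff_frob_poly q_pos)

lemma frob_poly_0 [simp]: "frob_poly n 0 = 0"
  by simp

lemma frob_poly_pCons: "frob_poly n (pCons a p) = pCons (a ^ (q ^ n)) (frob_poly n p)"
  using q_pos by (simp add: frob_poly_def map_poly_pCons)

lemma frob_poly_1 [simp]: "frob_poly n 1 = 1"
  by (simp add: one_pCons frob_poly_pCons)

lemma frob_poly_surj: "\<exists>p. frob_poly n p = r"
proof (induction r)
  case 0
  then show ?case by (intro exI[of _ 0]) simp
next
  case (pCons a r)
  then obtain p where "frob_poly n p = r" by blast
  moreover obtain b where "b ^ (q ^ n) = a"
    using power_qn_surj by blast
  ultimately have "frob_poly n (pCons b p) = pCons a r"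
    by (simp add: frob_poly_pCons)
  then show ?case by blast
qed

text \<open>Frobenius acts on the coefficients and leaves x alone. The fraction is not assumed to be
  reduced; \<open>frob_rat_eq\<close> shows by cross-multiplication that the chosen representation
  does not matter.\<close>

definition frob_rat :: "nat \<Rightarrow> 'f \<Rightarrow> 'f \<Rightarrow> 'f" where
  "frob_rat n x r = (SOME s. \<exists>p p'. p' \<noteq> 0 \<and> r = ev p x / ev p' x \<and>
     s = ev (frob_poly n p) x / ev (frob_poly n p') x)"

lemma frob_rat_eq:
  assumes x: "transcendental_over emb x" and "p' \<noteq> 0"
  shows "frob_rat n x (ev p x / ev p' x) = ev (frob_poly n p) x / ev (frob_poly n p') x"
proof -
  have nz: "ev p x \<noteq> 0" if "p \<noteq> 0" for p
    using x that by (simp add: transcendental_over_iff)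
  define s where "s = frob_rat n x (ev p x / ev p' x)"
  have "\<exists>u u'. u' \<noteq> 0 \<and> ev p x / ev p' x = ev u x / ev u' x \<and>
      s = ev (frob_poly n u) x / ev (frob_poly n u') x"
    unfolding s_def frob_rat_def by (rule someI_ex) (use assms(2) in blast)
  then obtain u u' where u: "u' \<noteq> 0" "ev p x / ev p' x = ev u x / ev u' x"
    "s = ev (frob_poly n u) x / ev (frob_poly n u') x" by blast
  have "ev (p * u' - u * p') x = 0"
    using u(2) nz[OF u(1)] nz[OF assms(2)] by (simp add: ev_diff ev_mult field_simps)
  then have "p * u' = u * p'"
    using nz[of "p * u' - u * p'"] by auto
  then have "frob_poly n p * frob_poly n u' = frob_poly n u * frob_poly n p'"
    by (simp flip: frob_poly_mult)
  then have "ev (frob_poly n p) x * ev (frob_poly n u') x = ev (frob_poly n u) x * ev (frob_poly n p') x"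
    by (simp flip: ev_mult)
  moreover have "ev (frob_poly n u') x \<noteq> 0" "ev (frob_poly n p') x \<noteq> 0"
    using u(1) assms(2) by (simp_all add: nz)
  ultimately show ?thesis
    unfolding s_def[symmetric] u(3) by (simp add: frac_eq_eq)
qed

lemma frob_rat_hom:
  assumes x: "transcendental_over emb x"
    and r: "r \<in> simple_extension emb x" and s: "s \<in> simple_extension emb x"
  shows "frob_rat n x (r + s) = frob_rat n x r + frob_rat n x s"
    and "frob_rat n x (r * s) = frob_rat n x r * frob_rat n x s"
proof -
  have nz: "ev p x \<noteq> 0" if "p \<noteq> 0" for p
    using x that by (simp add: transcendental_over_iff)
  obtain p p' where p: "p' \<noteq> 0" "r = ev p x / ev p' x"
    using r unfolding simple_extension_iff[OF x] by blast
  obtain u u' where u: "u' \<noteq> 0" "s = ev u x / ev u' x"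
    using s unfolding simple_extension_iff[OF x] by blast
  have nz': "ev (frob_poly n p') x \<noteq> 0" "ev (frob_poly n u') x \<noteq> 0"
    using p(1) u(1) by (simp_all add: nz)
  have "r + s = ev (p * u' + u * p') x / ev (p' * u') x"
    using nz[OF p(1)] nz[OF u(1)] by (simp add: p u ev_add ev_mult divide_simps)
  then have "frob_rat n x (r + s) = ev (frob_poly n (p * u' + u * p')) x / ev (frob_poly n (p' * u')) x"
    using frob_rat_eq[OF x, of "p' * u'"] p(1) u(1) by simp
  then show "frob_rat n x (r + s) = frob_rat n x r + frob_rat n x s"
    using nz' by (simp add: p u frob_rat_eq[OF x] frob_poly_add frob_poly_mult ev_add ev_mult divide_simps)
  have "r * s = ev (p * u) x / ev (p' * u') x"
    by (simp add: p u ev_mult)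
  then have "frob_rat n x (r * s) = ev (frob_poly n (p * u)) x / ev (frob_poly n (p' * u')) x"
    using frob_rat_eq[OF x, of "p' * u'"] p(1) u(1) by simp
  then show "frob_rat n x (r * s) = frob_rat n x r * frob_rat n x s"
    by (simp add: p u frob_rat_eq[OF x] frob_poly_mult ev_mult)
qed

lemma frob_rat_closed:
  assumes x: "transcendental_over emb x" and r: "r \<in> simple_extension emb x"
  shows "frob_rat n x r \<in> simple_extension emb x"
    and "frob_rat n x r = 0 \<longleftrightarrow> r = 0"
proof -
  have nz: "ev p x \<noteq> 0" if "p \<noteq> 0" for p
    using x that by (simp add: transcendental_over_iff)
  obtain p p' where p: "p' \<noteq> 0" "r = ev p x / ev p' x"
    using r unfolding simple_extension_iff[OF x] by blast
  show "frob_rat n x r \<in> simple_extension emb x"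
    unfolding simple_extension_iff[OF x] p(2) frob_rat_eq[OF x p(1)] using p(1)
    by (metis frob_poly_eq_0_iff)
  show "frob_rat n x r = 0 \<longleftrightarrow> r = 0"
    unfolding p(2) frob_rat_eq[OF x p(1)] using nz[of p] nz[of "frob_poly n p"] nz[OF p(1)] nz[of "frob_poly n p'"] p(1)
    by (cases "p = 0") auto
qed

lemma frob_rat_surj:
  assumes x: "transcendental_over emb x" and r: "r \<in> simple_extension emb x"
  shows "\<exists>s\<in>simple_extension emb x. frob_rat n x s = r"
proof -
  obtain p p' where p: "p' \<noteq> 0" "r = ev p x / ev p' x"
    using r unfolding simple_extension_iff[OF x] by blast
  obtain u u' where u: "frob_poly n u = p" "frob_poly n u' = p'"
    using frob_poly_surj by metis
  then have "u' \<noteq> 0"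
    using p(1) by auto
  then show ?thesis
    using frob_rat_eq[OF x, of u' n u] u p(2)
    by (intro bexI[of _ "ev u x / ev u' x"]) (auto simp: simple_extension_iff[OF x])
qed

lemma frob_rat_emb:
  assumes "transcendental_over emb x"
  shows "frob_rat n x (emb a) = emb (a ^ (q ^ n))" "frob_rat n x x = x"
    "frob_rat n x 0 = 0" "frob_rat n x 1 = 1"
  using frob_rat_eq[OF assms, of 1 n "[:a:]"] frob_rat_eq[OF assms, of 1 n "[:0, 1:]"]
    frob_rat_eq[OF assms, of 1 n 0] frob_rat_eq[OF assms, of 1 n 1] q_pos
  by (simp_all add: frob_poly_pCons)

text \<open>Finitely many rational functions involve finitely many coefficients, and
  \<open>common_period\<close> gives a power of Frobenius that fixes them all.\<close>

lemma frob_rat_fixed: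
  assumes x: "transcendental_over emb x" and "finite R" "R \<subseteq> simple_extension emb x"
  shows "\<exists>n\<ge>1. \<forall>r\<in>R. frob_rat n x r = r"
proof -
  have "\<exists>p p'. p' \<noteq> 0 \<and> r = ev p x / ev p' x" if "r \<in> R" for r
    using that assms(3) simple_extension_iff[OF x] by blast
  then obtain p p' where p: "\<And>r. r \<in> R \<Longrightarrow> p' r \<noteq> 0 \<and> r = ev (p r) x / ev (p' r) x"
    by metis
  define A where "A = (\<Union>r\<in>R. set (coeffs (p r)) \<union> set (coeffs (p' r)))"
  have "finite A"
    using assms(2) by (simp add: A_def)
  then obtain n where n: "n \<ge> 1" "\<And>a. a \<in> A \<Longrightarrow> a ^ (q ^ n) = a"
    using common_period by blast
  have "frob_rat n x r = r" if "r \<in> R" for r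
  proof -
    have "frob_poly n (p r) = p r" "frob_poly n (p' r) = p' r"
      unfolding frob_poly_def using that by (auto intro!: map_poly_idI n(2) simp: A_def)
    then show ?thesis
      using frob_rat_eq[OF x, of "p' r" n "p r"] p[OF that] by simp
  qed
  then show ?thesis
    using n(1) by blast
qed

text \<open>The automorphism acts on the coordinates with respect to a \<open>K(x)\<close>-basis; it is multiplicative
  because the structure constants of the basis are fixed by a power of the Frobenius map.\<close>

lemma exists_frob_aut:
  obtains n \<sigma> x where "1 \<le> n" "frob_aut n \<sigma>" "x \<notin> range emb" "\<sigma> x = x"
proof -
  obtain x B where x: "transcendental_over emb x" and fin: "finite B"
    and span: "\<And>y. \<exists>c. (\<forall>b\<in>B. c b \<in> simple_extension emb x) \<and> y = (\<Sum>b\<in>B. c b * b)"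
    and indep: "\<And>c b. (\<And>b. b \<in> B \<Longrightarrow> c b \<in> simple_extension emb x) \<Longrightarrow>
      (\<Sum>b\<in>B. c b * b) = 0 \<Longrightarrow> b \<in> B \<Longrightarrow> c b = 0"
    using basis_over_rational by blast
  define Kx where "Kx = simple_extension emb x"
  note closed = simple_extension_closed[OF x, folded Kx_def] simple_extension_minus[OF x, folded Kx_def]
  note base = simple_extension_base[OF x, folded Kx_def]
  obtain crd where crd: "\<And>y b. b \<in> B \<Longrightarrow> crd y b \<in> Kx" "\<And>y. y = (\<Sum>b\<in>B. crd y b * b)"
    using span unfolding Kx_def by metis
  have crd_unique: "crd (\<Sum>b\<in>B. c b * b) b = c b"
    if c: "\<And>b. b \<in> B \<Longrightarrow> c b \<in> Kx" and b: "b \<in> B" for c b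
  proof -
    define y where "y = (\<Sum>b\<in>B. c b * b)"
    have "(\<Sum>b\<in>B. (crd y b + - c b) * b) = (\<Sum>b\<in>B. crd y b * b) - (\<Sum>b\<in>B. c b * b)"
      by (simp add: sum_subtractf algebra_simps)
    also have "\<dots> = 0"
      using crd(2)[of y] by (simp add: y_def)
    finally have eq: "(\<Sum>b\<in>B. (crd y b + - c b) * b) = 0" .
    have mem: "crd y b + - c b \<in> Kx" if "b \<in> B" for b
      using that by (intro closed crd c)
    have "crd y b + - c b = 0"
      using indep[of "\<lambda>b. crd y b + - c b", folded Kx_def, OF mem eq b] .
    then show ?thesis by (simp add: y_def)
  qed
  define R where "R = (\<lambda>(b, b', e). crd (b * b') e) ` (B \<times> B \<times> B)"
  have "finite R" "R \<subseteq> simple_extension emb x"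
    using fin crd(1) by (auto simp: R_def Kx_def)
  then have "\<exists>n\<ge>1. \<forall>r\<in>R. frob_rat n x r = r"
    by (rule frob_rat_fixed[OF x])
  then obtain n where n: "n \<ge> 1" and fixed: "\<And>r. r \<in> R \<Longrightarrow> frob_rat n x r = r" by auto
  define f where "f = frob_rat n x"
  note f_hom = frob_rat_hom[OF x, of _ _ n, folded Kx_def f_def]
  note f_closed = frob_rat_closed[OF x, of _ n, folded Kx_def f_def]
  note f_base = frob_rat_emb[OF x, of n, folded f_def]
  define \<sigma> where "\<sigma> y = (\<Sum>b\<in>B. f (crd y b) * b)" for y
  have \<sigma>_sum: "\<sigma> (\<Sum>b\<in>B. c b * b) = (\<Sum>b\<in>B. f (c b) * b)" if "\<And>b. b \<in> B \<Longrightarrow> c b \<in> Kx" for c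
    unfolding \<sigma>_def by (intro sum.cong refl) (simp add: crd_unique that)
  have add: "\<sigma> (y + y') = \<sigma> y + \<sigma> y'" for y y'
  proof -
    have "y + y' = (\<Sum>b\<in>B. (crd y b + crd y' b) * b)"
      using crd(2)[of y] crd(2)[of y'] by (simp add: sum.distrib distrib_right)
    then have "\<sigma> (y + y') = (\<Sum>b\<in>B. f (crd y b + crd y' b) * b)"
      using \<sigma>_sum[of "\<lambda>b. crd y b + crd y' b"] crd(1) closed(1) by simp
    also have "\<dots> = \<sigma> y + \<sigma> y'"
      unfolding \<sigma>_def sum.distrib[symmetric]
      by (intro sum.cong refl) (simp add: f_hom(1) crd(1) distrib_right)
    finally show ?thesis .
  qed
  have \<sigma>_0: "\<sigma> 0 = 0"
    using add[of 0 0] by (metis add_cancel_left_right add_0)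
  have sum: "\<sigma> (sum g I) = (\<Sum>i\<in>I. \<sigma> (g i))" for g and I :: "'f set"
    by (induction I rule: infinite_finite_induct) (auto simp: add \<sigma>_0)
  have scale: "\<sigma> (r * y) = f r * \<sigma> y" if "r \<in> Kx" for r y
  proof -
    have "r * y = (\<Sum>b\<in>B. (r * crd y b) * b)"
      by (subst crd(2)[of y]) (simp add: sum_distrib_left mult.assoc)
    then have "\<sigma> (r * y) = (\<Sum>b\<in>B. f (r * crd y b) * b)"
      using \<sigma>_sum[of "\<lambda>b. r * crd y b"] crd(1) closed(2) that by simp
    also have "\<dots> = f r * \<sigma> y"
      unfolding \<sigma>_def sum_distrib_left
      by (intro sum.cong refl) (simp add: f_hom(2) crd(1) that mult.assoc)
    finally show ?thesis .
  qed
  have basis: "\<sigma> b = b" if "b \<in> B" for b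
  proof -
    have b: "b = (\<Sum>b'\<in>B. (if b' = b then 1 else 0) * b')"
      using that fin by (simp add: if_distrib[of "\<lambda>c. c * _"] sum.delta cong: if_cong)
    have "\<sigma> (\<Sum>b'\<in>B. (if b' = b then 1 else 0) * b') = (\<Sum>b'\<in>B. f (if b' = b then 1 else 0) * b')"
      by (rule \<sigma>_sum) (simp add: base)
    also have "\<dots> = (\<Sum>b'\<in>B. (if b' = b then 1 else 0) * b')"
      by (intro sum.cong refl) (simp add: f_base)
    finally show ?thesis
      using b by simp
  qed
  have constants: "\<sigma> (b * b') = b * b'" if "b \<in> B" "b' \<in> B" for b b'
  proof -
    have "f (crd (b * b') e) = crd (b * b') e" if "e \<in> B" for e
      unfolding f_def
      by (rule fixed, unfold R_def, rule image_eqI[of _ _ "(b, b', e)"])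
        (use that \<open>b \<in> B\<close> \<open>b' \<in> B\<close> in auto)
    then have "\<sigma> (b * b') = (\<Sum>e\<in>B. crd (b * b') e * e)"
      unfolding \<sigma>_def by (intro sum.cong refl) simp
    then show ?thesis
      using crd(2)[of "b * b'"] by simp
  qed
  have mult: "\<sigma> (y * y') = \<sigma> y * \<sigma> y'" for y y'
  proof -
    have "y * y' = (\<Sum>b\<in>B. crd y b * b) * (\<Sum>b\<in>B. crd y' b * b)"
      by (rule arg_cong2[OF crd(2) crd(2)])
    also have "\<dots> = (\<Sum>b\<in>B. \<Sum>b'\<in>B. (crd y b * crd y' b') * (b * b'))"
      unfolding sum_product by (intro sum.cong refl) (simp add: mult_ac)
    finally have "\<sigma> (y * y') = \<sigma> (\<Sum>b\<in>B. \<Sum>b'\<in>B. (crd y b * crd y' b') * (b * b'))"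
      by (rule arg_cong)
    also have "\<dots> = (\<Sum>b\<in>B. \<Sum>b'\<in>B. f (crd y b * crd y' b') * (b * b'))"
      by (simp add: sum scale constants closed(2) crd(1))
    also have "\<dots> = (\<Sum>b\<in>B. \<Sum>b'\<in>B. (f (crd y b) * b) * (f (crd y' b') * b'))"
      by (intro sum.cong refl) (simp add: f_hom(2) crd(1) mult_ac)
    also have "\<dots> = \<sigma> y * \<sigma> y'"
      by (simp add: \<sigma>_def sum_product)
    finally show ?thesis .
  qed
  have kernel: "y = 0" if "\<sigma> y = 0" for y
  proof -
    have "f (crd y b) \<in> Kx" if "b \<in> B" for b
      using that by (intro f_closed crd(1))
    then have "f (crd y b) = 0" if "b \<in> B" for b
      using indep[of "\<lambda>b. f (crd y b)" b, folded Kx_def] \<open>\<sigma> y = 0\<close> that unfolding \<sigma>_def by blast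
    then have "crd y b = 0" if "b \<in> B" for b
      using f_closed(2)[OF crd(1)[OF that, of y]] that by simp
    then show "y = 0"
      by (subst crd(2)[of y]) simp
  qed
  have "inj \<sigma>"
  proof (rule injI)
    fix y y' assume "\<sigma> y = \<sigma> y'"
    then have "\<sigma> (y - y') = 0"
      using add[of "y - y'" y'] by simp
    then show "y = y'"
      using kernel by fastforce
  qed
  moreover have "\<exists>y'. \<sigma> y' = y" for y
  proof -
    obtain g where g: "\<And>r. r \<in> Kx \<Longrightarrow> g r \<in> Kx \<and> f (g r) = r"
      using frob_rat_surj[OF x, of _ n, folded Kx_def f_def] by metis
    have "\<sigma> (\<Sum>b\<in>B. g (crd y b) * b) = (\<Sum>b\<in>B. crd y b * b)"
      by (subst \<sigma>_sum) (simp_all add: g crd(1))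
    then show ?thesis
      using crd(2)[of y] by metis
  qed
  then have "surj \<sigma>"
    by (metis surjI)
  ultimately have "bij \<sigma>"
    by (simp add: bij_def)
  \<comment> \<open>Since 1 need not belong to \<open>B\<close>, its image is not known from the
    basis; but it is a nonzero idempotent of a field.\<close>
  have "\<sigma> 1 \<noteq> 0"
    using kernel[of 1] by auto
  then have \<sigma>_1: "\<sigma> 1 = 1"
    using mult[of 1 1] by simp
  have \<sigma>_Kx: "\<sigma> r = f r" if "r \<in> Kx" for r
    using scale[OF that, of 1] \<sigma>_1 by simp
  have "frob_aut n \<sigma>"
    unfolding frob_aut_def using \<open>bij \<sigma>\<close> add mult \<sigma>_Kx base(1) f_base(1) by auto
  moreover have "\<sigma> x = x"
    using \<sigma>_Kx[OF base(4)] f_base(2) by simp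
  moreover have "x \<notin> range emb"
  proof
    assume "x \<in> range emb"
    then obtain a where "x = emb a" by auto
    then have "ev [:- a, 1:] x = 0"
      by (simp add: emb_minus)
    then show False
      using x unfolding transcendental_over_iff by (metis pCons_eq_0_iff one_neq_zero)
  qed
  ultimately show thesis
    using that n by blast
qed

subsection \<open>Action on places\<close>

lemma frob_aut_image_emb:
  assumes "frob_aut n \<sigma>"
  shows "\<sigma> ` range emb = range emb"
proof
  show "\<sigma> ` range emb \<subseteq> range emb"
    using frob_aut_emb[OF assms] by auto
  show "range emb \<subseteq> \<sigma> ` range emb"
  proof
    fix y assume "y \<in> range emb"
    then obtain a where "y = emb a" by auto
    moreover obtain b where "b ^ (q ^ n) = a"
      using power_qn_surj by blast
    ultimately have "y = \<sigma> (emb b)"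
      using frob_aut_emb[OF assms] by simp
    then show "y \<in> \<sigma> ` range emb" by simp
  qed
qed

lemma frob_aut_mem_iff: "frob_aut n \<sigma> \<Longrightarrow> \<sigma> x \<in> \<sigma> ` A \<longleftrightarrow> x \<in> A"
  by (simp add: inj_image_mem_iff frob_aut_inj)

lemma frob_aut_obtain:
  assumes "frob_aut n \<sigma>"
  obtains x where "y = \<sigma> x"
  using frob_aut_bij[OF assms] by (metis bij_pointE)

lemma valuation_ring_image:
  assumes \<sigma>: "frob_aut n \<sigma>" and R: "valuation_ring R"
  shows "valuation_ring (\<sigma> ` R)"
  unfolding valuation_ring_def
proof (intro conjI)
  show "\<forall>x\<in>\<sigma> ` R. \<forall>y\<in>\<sigma> ` R. x - y \<in> \<sigma> ` R \<and> x * y \<in> \<sigma> ` R"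
    using R by (auto simp: valuation_ring_diff valuation_ring_mult
        simp flip: frob_aut_diff[OF \<sigma>] frob_aut_mult[OF \<sigma>])
  have "range emb \<subset> R" "R \<subset> UNIV"
    using R by (auto simp: valuation_ring_def)
  then have "\<sigma> ` range emb \<subset> \<sigma> ` R" "\<sigma> ` R \<subset> \<sigma> ` UNIV"
    using frob_aut_inj[OF \<sigma>] by (auto simp: image_strict_mono inj_on_subset)
  then show "range emb \<subset> \<sigma> ` R" "\<sigma> ` R \<subset> UNIV"
    by (auto simp: frob_aut_image_emb[OF \<sigma>])
  show "\<forall>z. z \<in> \<sigma> ` R \<or> inverse z \<in> \<sigma> ` R"
  proof
    fix z
    obtain y where "z = \<sigma> y"
      using frob_aut_obtain[OF \<sigma>] .
    then show "z \<in> \<sigma> ` R \<or> inverse z \<in> \<sigma> ` R"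
      using valuation_ring_cases[OF R, of y]
      by (auto simp: frob_aut_mem_iff[OF \<sigma>] simp flip: frob_aut_inverse[OF \<sigma>])
  qed
qed

lemma nonunits_image:
  assumes \<sigma>: "frob_aut n \<sigma>"
  shows "nonunits (\<sigma> ` R) = \<sigma> ` nonunits R"
proof (rule Set.set_eqI)
  fix z
  obtain y where "z = \<sigma> y"
    using frob_aut_obtain[OF \<sigma>] .
  then show "z \<in> nonunits (\<sigma> ` R) \<longleftrightarrow> z \<in> \<sigma> ` nonunits R"
    by (simp add: nonunits_def frob_aut_mem_iff[OF \<sigma>] frob_aut_eq_0_iff[OF \<sigma>]
        flip: frob_aut_inverse[OF \<sigma>])
qed

lemma place_image:
  assumes \<sigma>: "frob_aut n \<sigma>" and P: "P \<in> places"
  shows "\<sigma> ` P \<in> places" "place_ring (\<sigma> ` P) = \<sigma> ` place_ring P"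
proof -
  obtain R where R: "valuation_ring R" "P = nonunits R"
    using P places_iff by blast
  have \<sigma>R: "valuation_ring (\<sigma> ` R)" "\<sigma> ` P = nonunits (\<sigma> ` R)"
    using valuation_ring_image[OF \<sigma> R(1)] nonunits_image[OF \<sigma>] R(2) by simp_all
  then show "\<sigma> ` P \<in> places"
    using places_iff by blast
  show "place_ring (\<sigma> ` P) = \<sigma> ` place_ring P"
    unfolding \<sigma>R(2) place_ring_nonunits[OF \<sigma>R(1)] using place_ring_nonunits[OF R(1)] R(2) by simp
qed

lemma valuation_image:
  assumes \<sigma>: "frob_aut n \<sigma>" and P: "P \<in> places" and "z \<noteq> 0"
  shows "valuation (\<sigma> ` P) (\<sigma> z) = valuation P z"
proof -
  obtain t where t: "uniformizer P t"
    using uniformizer_exists[OF P] by blast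
  obtain u where u: "place_unit P u" "z = t powi valuation P z * u"
    using valuation_factor[OF P t \<open>z \<noteq> 0\<close>] .
  have "\<sigma> ` {t * y | y. y \<in> place_ring P} = {\<sigma> t * y | y. y \<in> \<sigma> ` place_ring P}"
    by (auto simp: image_iff frob_aut_mult[OF \<sigma>]) (metis frob_aut_mult[OF \<sigma>])
  moreover have "\<sigma> ` P = \<sigma> ` {t * y | y. y \<in> place_ring P}"
    using t unfolding uniformizer_def by (rule arg_cong)
  ultimately have "uniformizer (\<sigma> ` P) (\<sigma> t)"
    unfolding uniformizer_def place_image(2)[OF \<sigma> P] by (rule trans[rotated])
  moreover have "place_unit (\<sigma> ` P) (\<sigma> u)"
    using u(1) by (simp add: place_unit_def place_image[OF \<sigma> P] frob_aut_mem_iff[OF \<sigma>]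
        frob_aut_eq_0_iff[OF \<sigma>] flip: frob_aut_inverse[OF \<sigma>])
  moreover have "\<sigma> z = \<sigma> t powi valuation P z * \<sigma> u"
  proof -
    have "\<sigma> (t powi k) = \<sigma> t powi k" for k
      by (simp add: power_int_def frob_aut_power[OF \<sigma>] frob_aut_inverse[OF \<sigma>])
    then show ?thesis
      by (subst u(2)) (simp add: frob_aut_mult[OF \<sigma>])
  qed
  ultimately show ?thesis
    by (rule valuation_eqI[OF place_image(1)[OF \<sigma> P]])
qed

text \<open>The images of \<open>P\<close> remain among the finitely many zeros of the fixed
  function \<open>y\<close>, so two of them coincide; injectivity of the action cancels the common
  part.\<close>

lemma place_periodic_zero:
  assumes \<tau>: "frob_aut n \<tau>" and y: "\<tau> y = y" "y \<noteq> 0" and P: "P \<in> places" "y \<in> P"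
  shows "\<exists>m\<ge>1. (\<tau> ^^ m) ` P = P"
proof -
  note \<tau>k = frob_aut_funpow[OF \<tau>]
  define orbit where "orbit k = (\<tau> ^^ k) ` P" for k
  have "orbit k \<in> {Q \<in> places. valuation Q y > 0}" for k
    using place_image(1)[OF \<tau>k P(1)] valuation_image[OF \<tau>k P(1) y(2), of k]
      valuation_ge_0_iff(2)[OF P(1) y(2)] P(2) funpow_fixed[of \<tau> y, OF y(1)]
    by (simp add: orbit_def)
  then have "finite (range orbit)"
    by (intro finite_subset[OF _ finite_zeros[OF y(2)]]) auto
  then have "\<not> inj orbit"
    using finite_imageD infinite_UNIV_nat by blast
  then obtain i j where "orbit i = orbit j" "i < j"
    by (metis injI linorder_neqE_nat)
  then have "(\<tau> ^^ i) ` ((\<tau> ^^ (j - i)) ` P) = (\<tau> ^^ i) ` P"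
    by (simp add: orbit_def flip: funpow_image_add)
  then have "(\<tau> ^^ (j - i)) ` P = P"
    using frob_aut_inj[OF \<tau>k] by (simp add: inj_image_eq_iff)
  then show ?thesis
    using \<open>i < j\<close> by (intro exI[of _ "j - i"]) auto
qed

text \<open>At a pole of \<open>x\<close> the fixed function \<open>inverse x\<close> vanishes.
  Elsewhere \<open>x - emb a\<close> vanishes for a constant \<open>a\<close>, and some power of
  \<sigma> fixes that constant. So \<open>place_periodic_zero\<close> applies to \<sigma> or to this
  power.\<close>

lemma place_periodic:
  assumes \<sigma>: "frob_aut n \<sigma>" and x: "\<sigma> x = x" "x \<notin> range emb" and P: "P \<in> places"
  shows "\<exists>m\<ge>1. (\<sigma> ^^ m) ` P = P"
proof (cases "x \<in> place_ring P")
  case True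
  then obtain a where a: "x - emb a \<in> P"
    using residue[OF P] by blast
  obtain m where m: "m \<ge> 1" "a ^ (q ^ m) = a"
    using power_q_periodic by blast
  have "a ^ (q ^ (n * m)) = a"
    using power_qn_periodic_mult[OF m(2), of n] by (simp add: mult.commute)
  then have "(\<sigma> ^^ m) (x - emb a) = x - emb a"
    using frob_aut_diff[OF frob_aut_funpow[OF \<sigma>]] frob_aut_emb[OF frob_aut_funpow[OF \<sigma>]]
      funpow_fixed[of \<sigma> x, OF x(1)] by simp
  moreover have "x - emb a \<noteq> 0"
    using x(2) by auto
  ultimately obtain k where "k \<ge> 1" "((\<sigma> ^^ m) ^^ k) ` P = P"
    using place_periodic_zero[OF frob_aut_funpow[OF \<sigma>] _ _ P a] by blast
  then show ?thesis
    using m(1) by (intro exI[of _ "m * k"]) (simp add: funpow_mult)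
next
  case False
  have "\<sigma> (inverse x) = inverse x"
    using x(1) by (simp add: frob_aut_inverse[OF \<sigma>])
  moreover have "inverse x \<noteq> 0"
    using x(2) emb_0 by (metis inverse_nonzero_iff_nonzero rangeI)
  ultimately show ?thesis
    using place_periodic_zero[OF \<sigma> _ _ P inverse_in_place[OF P False]] by blast
qed

text \<open>Where \<open>x\<close> is regular at a fixed place, applying \<sigma> to its residue
  \<open>a\<close> shows \<open>a ^ (q ^ n) = a\<close>. That leaves finitely many \<open>a\<close>,
  each attained at finitely many places; the poles of \<open>x\<close> are finite in number
  too.\<close>

lemma finite_fixed_places:
  assumes \<sigma>: "frob_aut n \<sigma>" and "n \<ge> 1" and x: "\<sigma> x = x" "x \<notin> range emb"
  shows "finite {P \<in> places. \<sigma> ` P = P}"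
proof -
  have "x \<noteq> 0"
    using x(2) emb_0 by (metis rangeI)
  \<comment> \<open>The condition \<open>n \<ge> 1\<close> separates the two exponents, so that
    \<open>r\<close> is a nonzero polynomial.\<close>
  define r where "r = monom 1 (q ^ n) - monom (1 :: 'k) 1"
  define A where "A = {a :: 'k. a ^ (q ^ n) = a}"
  have "1 < q ^ n"
    using q_ge_2 \<open>n \<ge> 1\<close> by (intro one_less_power) auto
  then have "coeff r (q ^ n) = 1"
    by (simp add: r_def coeff_monom)
  then have "r \<noteq> 0" by auto
  moreover have "A = {a. poly r a = 0}"
    by (auto simp: A_def r_def poly_monom)
  ultimately have "finite A"
    by (simp add: poly_roots_finite)
  have "{P \<in> places. \<sigma> ` P = P} \<subseteq> {P \<in> places. valuation P (inverse x) > 0} \<union>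
      (\<Union>a\<in>A. {P \<in> places. valuation P (x - emb a) > 0})"
  proof
    fix P assume "P \<in> {P \<in> places. \<sigma> ` P = P}"
    then have P: "P \<in> places" "\<sigma> ` P = P" by auto
    show "P \<in> {P \<in> places. valuation P (inverse x) > 0} \<union>
      (\<Union>a\<in>A. {P \<in> places. valuation P (x - emb a) > 0})"
    proof (cases "x \<in> place_ring P")
      case True
      then obtain a where a: "x - emb a \<in> P"
        using residue[OF P(1)] by blast
      then have "\<sigma> (x - emb a) \<in> P"
        using P(2) by blast
      then have "x - emb (a ^ (q ^ n)) \<in> P"
        using x(1) by (simp add: frob_aut_diff[OF \<sigma>] frob_aut_emb[OF \<sigma>])
      then have "(x - emb a) + - (x - emb (a ^ (q ^ n))) \<in> P"
        using a by (intro place_add[OF P(1)] place_minus[OF P(1)])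
      then have "emb (a ^ (q ^ n) - a) \<in> P"
        by (simp add: emb_diff)
      then have "a \<in> A"
        by (simp add: emb_in_place_iff[OF P(1)] A_def)
      moreover have "x - emb a \<noteq> 0"
        using x(2) by auto
      ultimately show ?thesis
        using a P(1) valuation_ge_0_iff(2)[OF P(1), of "x - emb a"] by auto
    next
      case False
      then show ?thesis
        using inverse_in_place[OF P(1)] valuation_ge_0_iff(2)[OF P(1), of "inverse x"] \<open>x \<noteq> 0\<close> P(1)
        by auto
    qed
  qed
  moreover have "finite {P \<in> places. valuation P (x - emb a) > 0}" for a
    using x(2) by (intro finite_zeros) auto
  moreover have "finite {P \<in> places. valuation P (inverse x) > 0}"
    using \<open>x \<noteq> 0\<close> by (intro finite_zeros) auto
  ultimately show ?thesis
    using \<open>finite A\<close> by (auto intro: finite_subset)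
qed

subsection \<open>Fixed vectors of semilinear maps\<close>

lemma span_image_expand:
  assumes "finite I" "y \<in> span (g ` I)"
  shows "\<exists>a. y = (\<Sum>i\<in>I. emb (a i) * g i)"
  using assms(2)
proof (induction rule: span_induct_alt)
  case base
  then show ?case by (intro exI[of _ "\<lambda>_. 0"]) simp
next
  case (step c z y)
  then obtain i a where i: "i \<in> I" "z = g i" and a: "y = (\<Sum>i\<in>I. emb (a i) * g i)" by auto
  have "emb c * z + y = (\<Sum>j\<in>I. emb ((a(i := a i + c)) j) * g j)"
    using i assms(1) by (simp add: a sum.remove[of I i] emb_add algebra_simps)
  then show ?case by blast
qed

text \<open>The coefficients of a fixed vector \<open>\<Sum>i\<le>d. c i * \<sigma>\<^sup>i v\<close> as polynomials in its last
  coefficient, where \<open>\<sigma>\<^sup>d\<^sup>+\<^sup>1 v = \<Sum>i\<le>d. a i * \<sigma>\<^sup>i v\<close>.\<close>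

fun fixed_coeff :: "nat \<Rightarrow> (nat \<Rightarrow> 'k) \<Rightarrow> nat \<Rightarrow> 'k poly" where
  "fixed_coeff Q a 0 = monom (a 0) Q"
| "fixed_coeff Q a (Suc i) = fixed_coeff Q a i ^ Q + monom (a (Suc i)) Q"

text \<open>With X^2 as a factor, the fixed point equation p(y) = y splits off y and leaves y h(y) =
  1, every solution of which is nonzero.\<close>

lemma fixed_coeff_dvd: "2 \<le> Q \<Longrightarrow> monom 1 2 dvd fixed_coeff Q a i"
proof (induction i)
  case 0
  then have "monom (a 0) Q = monom 1 2 * monom (a 0) (Q - 2)"
    by (simp only: mult_monom le_add_diff_inverse mult_1_left)
  then show ?case by simp
next
  case (Suc i)
  from Suc.prems have "monom (a (Suc i)) Q = monom 1 2 * monom (a (Suc i)) (Q - 2)"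
    by (simp only: mult_monom le_add_diff_inverse mult_1_left)
  then have "monom 1 2 dvd monom (a (Suc i)) Q" by simp
  moreover have "monom 1 2 dvd fixed_coeff Q a i ^ Q"
    using Suc by (intro dvd_power_le[of _ _ 1 Q, simplified]) auto
  ultimately show ?case by simp
qed

text \<open>A nonzero stage has degree at least 2, so its \<open>Q\<close>-th power has degree at
  least 2Q and cannot be cancelled by the next monomial, of degree at most \<open>Q\<close>.\<close>

lemma fixed_coeff_nonzero:
  assumes "2 \<le> Q" "i \<le> d" "a i \<noteq> 0"
  shows "fixed_coeff Q a d \<noteq> 0"
proof -
  have step: "fixed_coeff Q a (Suc k) \<noteq> 0" if "fixed_coeff Q a k \<noteq> 0 \<or> a (Suc k) \<noteq> 0" for k
  proof (cases "fixed_coeff Q a k = 0")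
    case True
    then show ?thesis
      using that assms(1) by (simp add: power_0_left monom_eq_0_iff)
  next
    case False
    then have "degree (monom (1 :: 'k) 2) \<le> degree (fixed_coeff Q a k)"
      using fixed_coeff_dvd[OF assms(1)] by (intro dvd_imp_degree_le)
    then have "Q * 2 \<le> degree (fixed_coeff Q a k ^ Q)"
      using False by (simp add: degree_power_eq degree_monom_eq)
    then have "Q < degree (fixed_coeff Q a k ^ Q)"
      using assms(1) by linarith
    then have "degree (monom (a (Suc k)) Q) < degree (fixed_coeff Q a k ^ Q)"
      using degree_monom_le[of "a (Suc k)" Q] by linarith
    then have "degree (fixed_coeff Q a (Suc k)) = degree (fixed_coeff Q a k ^ Q)"
      by (simp add: degree_add_eq_left)
    then show ?thesis
      using \<open>Q < degree (fixed_coeff Q a k ^ Q)\<close> by auto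
  qed
  show ?thesis
    using assms(2)
  proof (induction d rule: dec_induct)
    case base
    then show ?case
      using assms(3) step by (cases i) (auto simp: monom_eq_0_iff)
  next
    case (step k)
    then show ?case
      using \<open>\<And>k. _ \<Longrightarrow> fixed_coeff Q a (Suc k) \<noteq> 0\<close> by blast
  qed
qed

text \<open>Seek w as a combination of the iterates \<open>g i\<close> of \<open>v\<close>, up to
  the first that depends on its predecessors. Comparing coefficients in \<sigma> w = w determines
  all of them from the last one, for which a single polynomial equation over the algebraically
  closed field remains.\<close>

lemma exists_fixed_vector:
  assumes \<sigma>: "frob_aut n \<sigma>" and "n \<ge> 1"
    and V: "fin_dim V" "subspace V" "\<And>v. v \<in> V \<Longrightarrow> \<sigma> v \<in> V" and v: "v \<in> V" "v \<noteq> 0"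
  shows "\<exists>w\<in>V. w \<noteq> 0 \<and> \<sigma> w = w"
proof -
  define Q where "Q = q ^ n"
  have Q: "2 \<le> Q"
    using q_ge_2 \<open>n \<ge> 1\<close> self_le_power[of q n] unfolding Q_def by linarith
  define g where "g i = (\<sigma> ^^ i) v" for i
  have g_Suc: "\<sigma> (g i) = g (Suc i)" for i
    by (simp add: g_def)
  have gV: "g i \<in> V" for i
    by (induction i) (auto simp: g_def v V(3))
  have g_nz: "g i \<noteq> 0" for i
    using v(2) frob_aut_eq_0_iff[OF frob_aut_funpow[OF \<sigma>]] by (simp add: g_def)
  have "\<exists>d. g d \<in> span (g ` {..<d})"
  proof (rule ccontr)
    assume no: "\<not> ?thesis"
    have indep: "independent (g ` {..<d}) \<and> card (g ` {..<d}) = d" for d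
    proof (induction d)
      case (Suc d)
      have "g d \<notin> span (g ` {..<d})"
        using no by blast
      moreover from this have "g d \<notin> g ` {..<d}"
        using span_superset[of "g ` {..<d}"] by blast
      ultimately show ?case
        using Suc independent_insertI[of "g d" "g ` {..<d}"] by (simp add: lessThan_Suc)
    qed (simp add: independent_empty)
    obtain B where B: "finite B" "V \<subseteq> span B"
      using V(1) by (auto simp: fin_dim_def)
    have "card (g ` {..<Suc (card B)}) \<le> card B"
      using independent_span_bound[OF B(1), of "g ` {..<Suc (card B)}"] indep gV B(2) by blast
    then show False
      using indep[of "Suc (card B)"] by simp
  qed
  then obtain d where d: "g d \<in> span (g ` {..<d})" and least: "\<And>k. k < d \<Longrightarrow> g k \<notin> span (g ` {..<k})"
    using exists_least_iff[of "\<lambda>d. g d \<in> span (g ` {..<d})"] by blast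
  have "d \<noteq> 0"
    using d g_nz by (intro notI) simp
  then obtain e where e: "d = Suc e" by (cases d) auto
  obtain a where a: "g (Suc e) = (\<Sum>i<Suc e. emb (a i) * g i)"
    using span_image_expand[OF _ d] unfolding e by auto
  \<comment> \<open>Injectivity of \<sigma> enters here: iterates of the nonzero \<open>v\<close>
    never vanish.\<close>
  have "\<exists>i\<le>e. a i \<noteq> 0"
  proof (rule ccontr)
    assume "\<not> ?thesis"
    then have "g (Suc e) = 0"
      unfolding a by (intro sum.neutral) (auto simp: less_Suc_eq_le)
    then show False
      using g_nz by blast
  qed
  then have p_nz: "fixed_coeff Q a e \<noteq> 0"
    using fixed_coeff_nonzero[OF Q] by blast
  obtain h where h: "fixed_coeff Q a e = monom 1 2 * h"
    using fixed_coeff_dvd[OF Q, of a e] by (rule dvdE)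
  \<comment> \<open>This polynomial is y h(y) - 1; it is nonconstant because \<open>h\<close> is
    nonzero, hence has a root.\<close>
  then have "degree (pCons (- 1) h) > 0"
    using p_nz by auto
  then obtain y where "poly (pCons (- 1) h) y = 0"
    using alg_closed_imp_poly_has_root by blast
  then have y: "y * poly h y = 1"
    by simp
  define c where "c i = poly (fixed_coeff Q a i) y" for i
  have c_e: "c e = y"
    using y by (simp add: c_def h poly_monom power2_eq_square mult.assoc)
  have "y \<noteq> 0"
    using y by auto
  have c_0: "c 0 = y ^ Q * a 0" and c_Suc: "c (Suc i) = c i ^ Q + y ^ Q * a (Suc i)" for i
    by (simp_all add: c_def poly_monom poly_power mult.commute)
  define w where "w = (\<Sum>i<Suc e. emb (c i) * g i)"
  have "\<sigma> w = (\<Sum>i<Suc e. emb (c i ^ Q) * g (Suc i))"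
    by (simp only: w_def frob_aut_sum[OF \<sigma>] frob_aut_mult[OF \<sigma>] frob_aut_emb[OF \<sigma>] g_Suc Q_def)
  also have "\<dots> = (\<Sum>i<e. emb (c i ^ Q) * g (Suc i)) + emb (y ^ Q) * g (Suc e)"
    by (simp add: c_e)
  also have "emb (y ^ Q) * g (Suc e) = (\<Sum>i<Suc e. emb (y ^ Q * a i) * g i)"
    unfolding a by (simp only: sum_distrib_left emb_mult mult.assoc)
  also have "(\<Sum>i<e. emb (c i ^ Q) * g (Suc i)) + \<dots> =
      emb (c 0) * g 0 + (\<Sum>i<e. emb (c (Suc i)) * g (Suc i))"
    by (simp only: sum.lessThan_Suc_shift c_0 c_Suc emb_add distrib_right sum.distrib) simp
  also have "\<dots> = w"
    by (simp only: w_def sum.lessThan_Suc_shift)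
  finally have "\<sigma> w = w" .
  moreover have "w \<in> V"
    unfolding w_def using V(2) gV by (intro subspace_sum subspace_scale)
  \<comment> \<open>By minimality of \<open>d\<close> the iterate \<open>g e\<close> is outside the
    span of the earlier ones, and its coefficient in \<open>w\<close> is the nonzero
    \<open>y\<close>.\<close>
  moreover have "w \<noteq> 0"
  proof
    assume "w = 0"
    then have "emb y * g e = - (\<Sum>i<e. emb (c i) * g i)"
      by (simp add: w_def c_e eq_neg_iff_add_eq_0 add.commute)
    then have "inverse (emb y) * (emb y * g e) = inverse (emb y) * - (\<Sum>i<e. emb (c i) * g i)"
      by (rule arg_cong)
    then have "g e = emb (- inverse y) * (\<Sum>i<e. emb (c i) * g i)"
      using \<open>y \<noteq> 0\<close> by (simp add: emb_minus emb_inverse flip: mult.assoc)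
    also have "\<dots> \<in> span (g ` {..<e})"
      by (intro span_scale span_sum span_base) auto
    finally show False
      using least[of e] e by simp
  qed
  ultimately show ?thesis by blast
qed

subsection \<open>The difference of two places is torsion\<close>

lemma principal_multiple_exists:
  assumes P1: "P1 \<in> places" and P2: "P2 \<in> places"
  shows "\<exists>k>0. principal_divisor (frag_cmul (int k) (frag_of P1 - frag_of P2))"
proof -
  obtain n0 \<sigma>0 x where \<sigma>0: "1 \<le> n0" "frob_aut n0 \<sigma>0" and x: "x \<notin> range emb" "\<sigma>0 x = x"
    using exists_frob_aut .
  obtain m1 where m1: "m1 \<ge> 1" "(\<sigma>0 ^^ m1) ` P1 = P1"
    using place_periodic[OF \<sigma>0(2) x(2,1) P1] by blast
  obtain m2 where m2: "m2 \<ge> 1" "(\<sigma>0 ^^ m2) ` P2 = P2"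
    using place_periodic[OF \<sigma>0(2) x(2,1) P2] by blast
  have fix_power: "(\<tau> ^^ k) ` P = P" if "\<tau> ` P = P" for \<tau> :: "'f \<Rightarrow> 'f" and k P
    using that by (induction k) (simp, simp only: funpow_image_Suc)
  define n where "n = n0 * (m1 * m2)"
  define \<sigma> where "\<sigma> = \<sigma>0 ^^ (m1 * m2)"
  have n: "1 \<le> n"
    using \<sigma>0 m1 m2 by (simp add: n_def)
  have \<sigma>: "frob_aut n \<sigma>" and \<sigma>_x: "\<sigma> x = x"
    using frob_aut_funpow[OF \<sigma>0(2)] funpow_fixed[of \<sigma>0 x, OF x(2)] by (simp_all add: \<sigma>_def n_def)
  have \<sigma>_P: "\<sigma> ` P1 = P1" "\<sigma> ` P2 = P2"
    using fix_power[OF m1(2), of m2] fix_power[OF m2(2), of m1]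
    by (simp_all add: \<sigma>_def funpow_mult mult.commute)
  have inj: "\<sigma> ` P = \<sigma> ` P' \<longleftrightarrow> P = P'" for P P'
    by (simp add: inj_image_eq_iff frob_aut_inj[OF \<sigma>])
  have surj: "\<exists>P'\<in>places. P = \<sigma> ` P'" if P: "P \<in> places" for P
  proof -
    obtain m where "m \<ge> 1" "(\<sigma> ^^ m) ` P = P"
      using place_periodic[OF \<sigma> \<sigma>_x x(1) P] by blast
    then have "P = \<sigma> ` ((\<sigma> ^^ (m - 1)) ` P)"
      by (cases m) (simp_all flip: funpow_image_Suc)
    then show ?thesis
      using place_image(1)[OF frob_aut_funpow[OF \<sigma>] P] by blast
  qed
  \<comment> \<open>Degree \<open>genus\<close> is the smallest for which Riemann's inequality
    guarantees a nonzero function.\<close>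
  define D where "D i = frag_cmul (int i) (frag_of P1 - frag_of P2) + frag_cmul genus (frag_of P2)" for i
  have D: "D i \<in> divisors" for i
    using P1 P2 by (simp add: D_def divisors_add divisors_cmul divisors_diff divisors_frag_of)
  have deg_D: "divisor_degree (D i) = genus" for i
    using P1 P2 by (simp add: D_def divisor_degree_add divisor_degree_cmul divisor_degree_diff
        divisors_cmul divisors_diff divisors_frag_of divisor_degree_frag_of)
  have D_\<sigma>: "lookup (D i) (\<sigma> ` P) = lookup (D i) P" for i P
    using inj[of P P1] inj[of P P2] by (simp add: D_def lookup_add lookup_minus \<sigma>_P)
  have "\<exists>f. f \<noteq> 0 \<and> f \<in> riemann_roch_space (D i) \<and> \<sigma> f = f" for i
  proof -
    have "0 < ell (D i)"
      using riemann_inequality[OF D, of i] by (simp add: deg_D)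
    then obtain v where v: "v \<noteq> 0" "v \<in> riemann_roch_space (D i)"
      using ell_pos_obtain by blast
    have "\<sigma> f \<in> riemann_roch_space (D i)" if f: "f \<in> riemann_roch_space (D i)" for f
    proof (cases "f = 0")
      case False
      have "- lookup (D i) P \<le> valuation P (\<sigma> f)" if P: "P \<in> places" for P
      proof -
        obtain P' where P': "P' \<in> places" "P = \<sigma> ` P'"
          using surj[OF P] by blast
        have "- lookup (D i) P' \<le> valuation P' f"
          using f False P'(1) by (simp add: riemann_roch_space_def)
        then show ?thesis
          using P' False by (simp add: D_\<sigma> valuation_image[OF \<sigma>])
      qed
      then show ?thesis
        by (simp add: riemann_roch_space_def)
    qed (use f frob_aut_0[OF \<sigma>] in simp)
    then have "\<exists>f\<in>riemann_roch_space (D i). f \<noteq> 0 \<and> \<sigma> f = f"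
      by (intro exists_fixed_vector[OF \<sigma> n fin_dim_riemann_roch_space[OF D]
            subspace_riemann_roch_space _ v(2,1)])
    then show ?thesis by blast
  qed
  then obtain f where f: "\<And>i. f i \<noteq> 0" "\<And>i. f i \<in> riemann_roch_space (D i)" "\<And>i. \<sigma> (f i) = f i"
    by metis
  define E where "E i = principal (f i) + D i" for i
  have E: "E i \<in> divisors" for i
    using principal_in_divisors[OF f(1)] D by (simp add: E_def divisors_add)
  have deg_E: "divisor_degree (E i) = genus" for i
    using principal_in_divisors[OF f(1)] D
    by (simp add: E_def divisor_degree_add divisor_degree_principal[OF f(1)] deg_D)
  have lookup_E: "lookup (E i) P = valuation P (f i) + lookup (D i) P" if "P \<in> places" for i P
    using that by (simp add: E_def lookup_add lookup_principal[OF f(1)])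
  have E_nonneg: "0 \<le> lookup (E i) P" for i P
  proof (cases "P \<in> places")
    case True
    then have "- lookup (D i) P \<le> valuation P (f i)"
      using f(1,2)[of i] by (auto simp: riemann_roch_space_def)
    then show ?thesis
      using True by (simp add: lookup_E)
  qed (simp add: lookup_outside[OF E])
  have E_\<sigma>: "lookup (E i) (\<sigma> ` P) = lookup (E i) P" if P: "P \<in> places" for i P
    using P place_image(1)[OF \<sigma> P] valuation_image[OF \<sigma> P f(1)] f(3)
    by (simp add: lookup_E D_\<sigma>)
  have sum_le: "(\<Sum>P\<in>A. lookup (E i) P) \<le> genus" if "finite A" for A i
  proof -
    have "(\<Sum>P\<in>A. lookup (E i) P) \<le> (\<Sum>P\<in>A \<union> Poly_Mapping.keys (E i). lookup (E i) P)"
      using that E_nonneg by (intro sum_mono2) auto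
    also have "\<dots> = genus"
      using that divisor_degree_eq[OF E, of "A \<union> Poly_Mapping.keys (E i)" i] deg_E by simp
    finally show ?thesis .
  qed
  \<comment> \<open>The places whose orbit has at most \<open>genus\<close> members. An invariant
    effective divisor is constant along orbits, so with degree \<open>genus\<close> it has no room
    for a longer one.\<close>
  define S where "S = (\<Union>k\<in>{1..nat genus}. {P \<in> places. (\<sigma> ^^ k) ` P = P})"
  have "finite {P \<in> places. (\<sigma> ^^ k) ` P = P}" if "k \<in> {1..nat genus}" for k
    using that n by (intro finite_fixed_places[OF frob_aut_funpow[OF \<sigma>] _ funpow_fixed[of \<sigma> x, OF \<sigma>_x] x(1)]) auto
  then have "finite S"
    by (simp add: S_def)
  have E_outside: "lookup (E i) P = 0" if "P \<notin> S" for i P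
  proof (rule ccontr)
    assume nz: "lookup (E i) P \<noteq> 0"
    then have P: "P \<in> places"
      using lookup_outside[OF E] by blast
    have orbit: "(\<sigma> ^^ k) ` P \<in> places \<and> lookup (E i) ((\<sigma> ^^ k) ` P) = lookup (E i) P" for k
    proof (induction k)
      case (Suc k)
      then show ?case
        using place_image(1)[OF \<sigma>] E_\<sigma> unfolding funpow_image_Suc by simp
    qed (simp add: P)
    \<comment> \<open>Outside \<open>S\<close> the first \<open>genus + 1\<close> images of
      \<open>P\<close> are distinct, and each would occur with multiplicity at least 1.\<close>
    have "inj_on (\<lambda>k. (\<sigma> ^^ k) ` P) {..nat genus}"
    proof (rule linorder_inj_onI')
      fix k l assume kl: "k \<in> {..nat genus}" "l \<in> {..nat genus}" "k < l"
      show "(\<sigma> ^^ k) ` P \<noteq> (\<sigma> ^^ l) ` P"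
      proof
        assume "(\<sigma> ^^ k) ` P = (\<sigma> ^^ l) ` P"
        also have "(\<sigma> ^^ l) ` P = (\<sigma> ^^ k) ` ((\<sigma> ^^ (l - k)) ` P)"
          using kl by (simp flip: funpow_image_add)
        finally have "(\<sigma> ^^ (l - k)) ` P = P"
          using frob_aut_inj[OF frob_aut_funpow[OF \<sigma>]] by (simp add: inj_image_eq_iff)
        moreover have "l - k \<in> {1..nat genus}"
          using kl by auto
        ultimately show False
          using P \<open>P \<notin> S\<close> by (auto simp: S_def)
      qed
    qed
    then have "(1 + genus) * lookup (E i) P =
        (\<Sum>P'\<in>(\<lambda>k. (\<sigma> ^^ k) ` P) ` {..nat genus}. lookup (E i) P')"
      using orbit genus_nonneg by (simp add: sum.reindex)
    also have "\<dots> \<le> genus"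
      by (rule sum_le) simp
    finally have "(1 + genus) * lookup (E i) P \<le> genus" .
    moreover have "(1 + genus) * 1 \<le> (1 + genus) * lookup (E i) P"
      using nz E_nonneg[of i P] genus_nonneg by (intro mult_left_mono) linarith+
    ultimately have "(1 + genus) * 1 \<le> genus"
      by (rule order_trans[rotated])
    then show False by simp
  qed
  \<comment> \<open>\<open>restrict\<close> fixes the values outside \<open>S\<close>, which places
    all these functions in a finite extensional product.\<close>
  define F where "F i = restrict (lookup (E i)) S" for i
  have "range F \<subseteq> S \<rightarrow>\<^sub>E {0..genus}"
    using E_nonneg sum_le[of "{P}" for P] by (auto simp: F_def)
  then have "finite (range F)"
    by (rule finite_subset) (intro finite_PiE \<open>finite S\<close> finite_atLeastAtMost_int)
  then have "\<not> inj F"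
    using finite_imageD infinite_UNIV_nat by blast
  then obtain i j where ij: "F i = F j" "i < j"
    by (metis injI linorder_neqE_nat)
  have E_eq: "lookup (E i) P = lookup (E j) P" for P
    using E_outside[of P] fun_cong[OF ij(1), of P] by (cases "P \<in> S") (auto simp: F_def)
  define k where "k = j - i"
  have "principal_divisor (frag_cmul (int k) (frag_of P1 - frag_of P2))"
    unfolding principal_divisor_def
  proof (intro conjI exI[of _ "f i / f j"] ballI)
    show "frag_cmul (int k) (frag_of P1 - frag_of P2) \<in> divisors"
      using P1 P2 by (simp add: divisors_cmul divisors_diff divisors_frag_of)
    show "f i / f j \<noteq> 0"
      using f(1) by simp
    fix P assume P: "P \<in> places"
    \<comment> \<open>As \<open>E i = E j\<close>, the divisor of the quotient is
      \<open>D j - D i\<close>; the summand at \<open>P2\<close> of degree \<open>genus\<close>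
      cancels and \<open>j - i\<close> copies of P1 - P2 are left.\<close>
    have "valuation P (f i / f j) = lookup (D j) P - lookup (D i) P"
      using E_eq[of P] P f(1) by (simp add: valuation_divide lookup_E)
    then show "lookup (frag_cmul (int k) (frag_of P1 - frag_of P2)) P = valuation P (f i / f j)"
      using ij(2) by (simp add: D_def k_def lookup_add lookup_minus of_nat_diff algebra_simps)
  qed
  moreover have "k > 0"
    using ij(2) by (simp add: k_def)
  ultimately show ?thesis by blast
qed

lemma period:
  assumes P1: "P1 \<in> places" and P2: "P2 \<in> places"
  shows "0 < period P1 P2"
    and "principal_divisor (frag_cmul (int (period P1 P2)) (frag_of P1 - frag_of P2))"
  using LeastI_ex[OF principal_multiple_exists[OF assms]] by (simp_all add: period_def)

end

subsection \<open>The algebraic closure of a finite field\<close>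

lemma prime_CHAR_finite_field: "prime CHAR('q::{finite,field})"
  by (intro prime_CHAR_semidom finite_imp_CHAR_pos) simp

text \<open>In prime characteristic the power of a difference is the difference of the powers, and a
  field has no nilpotents.\<close>

lemma power_CHAR_eq_iff:
  fixes a b :: "'a::field"
  assumes "prime CHAR('a)"
  shows "a ^ (CHAR('a) ^ n) = b ^ (CHAR('a) ^ n) \<longleftrightarrow> a = b"
proof
  assume "a ^ (CHAR('a) ^ n) = b ^ (CHAR('a) ^ n)"
  moreover have "((a - b) + b) ^ (CHAR('a) ^ n) = (a - b) ^ (CHAR('a) ^ n) + b ^ (CHAR('a) ^ n)"
    by (rule freshmans_dream'[OF assms refl])
  ultimately have "(a - b) ^ (CHAR('a) ^ n) = 0" by simp
  then show "a = b" by simp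
qed simp

text \<open>Two iterates of \<open>a\<close> in the finite set agree; injectivity of the iterated
  Frobenius map strips off the earlier one and leaves \<open>a\<close> itself.\<close>

lemma power_CHAR_periodic:
  fixes a :: "'a::field"
  assumes "prime CHAR('a)" "N \<ge> 1" "finite A" "\<And>i. a ^ (CHAR('a) ^ (N * i)) \<in> A"
  shows "\<exists>n\<ge>1. a ^ (CHAR('a) ^ (N * n)) = a"
proof -
  define h where "h i = a ^ (CHAR('a) ^ (N * i))" for i
  have "finite (range h)"
    using assms(3,4) by (auto simp: h_def intro: finite_subset)
  then have "\<not> inj h"
    using finite_imageD infinite_UNIV_nat by blast
  then obtain i j where ij: "h i = h j" "i < j"
    by (metis injI linorder_neqE_nat)
  have "h j = (a ^ (CHAR('a) ^ (N * (j - i)))) ^ (CHAR('a) ^ (N * i))"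
    using ij(2) by (simp add: h_def flip: power_mult power_add distrib_left)
  then have "a ^ (CHAR('a) ^ (N * (j - i))) = a"
    using ij(1) power_CHAR_eq_iff[OF assms(1)] by (metis h_def)
  then show ?thesis
    using ij(2) by (intro exI[of _ "j - i"]) auto
qed

text \<open>Proceed element by element: the period of the next element is found as a multiple of the
  common period reached so far.\<close>

lemma finite_field_common_power:
  fixes A :: "'q::{finite,field} set"
  shows "\<exists>n\<ge>1. \<forall>a\<in>A. a ^ (CHAR('q) ^ n) = a"
proof -
  note prime = prime_CHAR_finite_field[where 'q = 'q]
  have "finite A" by simp
  then show ?thesis
  proof (induction A)
    case empty
    then show ?case by (auto intro: exI[of _ 1])
  next
    case (insert a A)
    then obtain n where n: "n \<ge> 1" "\<And>b. b \<in> A \<Longrightarrow> b ^ (CHAR('q) ^ n) = b" by blast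
    obtain m where m: "m \<ge> 1" "a ^ (CHAR('q) ^ (n * m)) = a"
      using power_CHAR_periodic[OF prime n(1), of UNIV a] by auto
    have "b ^ (CHAR('q) ^ (n * k)) = b" if "b \<in> A" for b k
    proof (induction k)
      case (Suc k)
      have "b ^ (CHAR('q) ^ (n * Suc k)) = (b ^ (CHAR('q) ^ (n * k))) ^ (CHAR('q) ^ n)"
        by (simp add: add.commute flip: power_mult power_add)
      then show ?case
        using Suc n(2)[OF that] by simp
    qed simp
    then show ?case
      using n(1) m by (intro exI[of _ "n * m"]) auto
  qed
qed

text \<open>An element of the closure is a root of a polynomial over the finite field. The power map
  that fixes the coefficients sends roots to roots, and there are only finitely many of
  them.\<close>

lemma alg_closure_power_periodic:
  fixes a :: "'q::{finite,field} alg_closure"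
  shows "\<exists>n\<ge>1. a ^ (CHAR('q) ^ n) = a"
proof -
  have prime: "prime CHAR('q alg_closure)"
    by (simp add: prime_CHAR_finite_field)
  obtain N where N: "N \<ge> 1" "\<And>c :: 'q. c ^ (CHAR('q) ^ N) = c"
    using finite_field_common_power[of UNIV] by blast
  obtain p :: "'q poly" where p: "p \<noteq> 0" "poly (map_poly to_ac p) a = 0"
    using alg_closure_algebraic .
  define r where "r = map_poly to_ac p"
  have "r \<noteq> 0"
    using p(1) by (simp add: r_def map_poly_eq_0_iff)
  have coeff_r: "coeff r i ^ (CHAR('q) ^ N) = coeff r i" for i
    by (simp add: r_def coeff_map_poly N(2) flip: to_ac_power)
  have root: "poly r (b ^ (CHAR('q) ^ N)) = 0" if "poly r b = 0" for b
  proof -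
    have "poly r (b ^ (CHAR('q) ^ N)) = (\<Sum>i\<le>degree r. coeff r i ^ (CHAR('q) ^ N) * (b ^ (CHAR('q) ^ N)) ^ i)"
      unfolding poly_altdef coeff_r ..
    also have "\<dots> = (\<Sum>i\<le>degree r. (coeff r i * b ^ i) ^ (CHAR('q) ^ N))"
      by (simp add: power_mult_distrib mult.commute flip: power_mult)
    also have "\<dots> = poly r b ^ (CHAR('q) ^ N)"
      unfolding poly_altdef by (subst freshmans_dream_sum'[OF prime]) auto
    finally show ?thesis
      using that prime_gt_0_nat[OF prime] by simp
  qed
  have "poly r (a ^ (CHAR('q) ^ (N * i))) = 0" for i
  proof (induction i)
    case (Suc i)
    have "a ^ (CHAR('q) ^ (N * Suc i)) = (a ^ (CHAR('q) ^ (N * i))) ^ (CHAR('q) ^ N)"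
      by (simp add: add.commute flip: power_mult power_add)
    then show ?case
      using root[OF Suc] by simp
  qed (use p(2) r_def in simp)
  then obtain n where "n \<ge> 1" "a ^ (CHAR('q) ^ (N * n)) = a"
    using power_CHAR_periodic[OF prime N(1) poly_roots_finite[OF \<open>r \<noteq> 0\<close>], of a] by auto
  then show ?thesis
    using N(1) by (intro exI[of _ "N * n"]) auto
qed

text \<open>Finiteness is claimed explicitly because \<open>card\<close> is 0 on infinite sets. The
  summation range is described by an integer inequality, so that it is empty in genus 0.\<close>

theorem proposition3p4:
  fixes emb :: "'q::{finite,field} alg_closure \<Rightarrow> 'f::field"
    and P1 P2 :: "'f set"
  assumes "function_field emb"
    and "P1 \<in> function_field.places emb" and "P2 \<in> function_field.places emb"
    and "P1 \<noteq> P2"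
  shows "(\<forall>i j :: nat. function_field.pure_gaps_box emb P1 P2 i j =
            (\<lambda>s. s + function_field.shift_vector emb P1 P2 j) `
              function_field.pure_gaps_box emb P1 P2 (i + j) 0) \<and>
         finite (function_field.pure_gaps emb P1 P2) \<and>
         card (function_field.pure_gaps emb P1 P2) =
           (\<Sum>k\<in>{k::nat. int k \<le> \<lceil>(2 * real_of_int (function_field.genus emb) - 1) /
                                real (function_field.period emb P1 P2)\<rceil> - 1}.
              (k + 1) * card (function_field.pure_gaps_box emb P1 P2 k 0))"
proof -
  have prime: "prime CHAR('q alg_closure)"
    by (simp add: prime_CHAR_finite_field)
  interpret function_field emb
    by (rule assms(1))
  interpret frobenius_function_field emb "CHAR('q)"
  proof
    show "2 \<le> CHAR('q)"
      using prime_ge_2_nat[OF prime] by simp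
    show "(a + b) ^ CHAR('q) = a ^ CHAR('q) + b ^ CHAR('q)" for a b :: "'q alg_closure"
      by (rule freshmans_dream[OF prime]) simp
    show "\<exists>n\<ge>1. a ^ (CHAR('q) ^ n) = a" for a :: "'q alg_closure"
      by (rule alg_closure_power_periodic)
  qed
  note P = assms(2,3)
  show ?thesis
    using pure_gaps_box_translate[OF P period(2)[OF P]] finite_pure_gaps[OF P assms(4)]
      card_pure_gaps[OF P assms(4) period(2)[OF P] period(1)[OF P]]
    by blast
qed

end
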